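(* For every integer $d\geq 3$ there exists $R_d<\infty$, depending only on $d$, such that the following holds. Let $0<a<b<\infty$, let $\Omega=B_b\setminus\overline{B}_a(0)\subset\mathbb{R}^d$, and assume that $\log\left(\frac{b}{a}\right)\geq R_d$. Then for all $u\in W^{2,2}_0(\Omega)$, $$\int_{\Omega}(\Delta u)^2dx\geq\left(\frac{d^2}{4}+\frac{\pi^2}{\log^2\left(\frac{b}{a}\right)}\right)\left(\frac{(d-4)^2}{4}+\frac{\pi^2}{\log^2\left(\frac{b}{a}\right)}\right)\int_{\Omega}\frac{u^2}{|x|^4}dx.$$ Furthermore, for all $u\in W^{2,2}_0(\Omega)$: if $d\geq 5$, $$\int_{\Omega}(\Delta u)^2dx\geq\frac{d^2(d-4)^2+((d-2)^2+4)\dfrac{8\pi^2}{\log^2\left(\frac{b}{a}\right)}+\dfrac{16\pi^4}{\log^4\left(\frac{b}{a}\right)}}{4(d-4)^2+\dfrac{16\pi^2}{\log^2\left(\frac{b}{a}\right)}}\int_{\Omega}\frac{|\nabla u|^2}{|x|^2}dx;$$ if $d=3$, $$\int_{\Omega}(\Delta u)^2dx\geq\frac{25+\dfrac{104\pi^2}{\log^2\left(\frac{b}{a}\right)}+\dfrac{16\pi^4}{\log^4\left(\frac{b}{a}\right)}}{36+\dfrac{16\pi^2}{\log^2\left(\frac{b}{a}\right)}}\int_{\Omega}\frac{|\nabla u|^2}{|x|^2}dx;$$ and if $d=4$, $$\int_{\Omega}(\Delta u)^2dx\geq\frac{9+\dfrac{10\pi^2}{\log^2\left(\frac{b}{a}\right)}+\dfrac{\pi^4}{\log^4\left(\frac{b}{a}\right)}}{3+\dfrac{\pi^2}{\log^2\left(\frac{b}{a}\right)}}\int_{\Omega}\frac{|\nabla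 u|^2}{|x|^2}dx.$$
   Context: $B_r=B_r(0)$ is the open ball of radius $r$ centred at $0$ in $\mathbb{R}^d$. $W^{2,2}_0(\Omega)$ is the closure of $C^\infty_c(\Omega)$ in $W^{2,2}(\Omega)$. *)

theory Defs
  imports "HOL-Analysis.Analysis"
begin

definition partial_deriv :: "'n::finite \<Rightarrow> (real ^ 'n \<Rightarrow> real) \<Rightarrow> real ^ 'n \<Rightarrow> real" where
  "partial_deriv i f x = frechet_derivative f (at x) (axis i 1)"

text \<open>A multi-index of order \<open>m\<close> is given as a list of coordinates of length \<open>m\<close>.\<close>

definition iterated_deriv :: "'n::finite list \<Rightarrow> (real ^ 'n \<Rightarrow> real) \<Rightarrow> real ^ 'n \<Rightarrow> real" where
  "iterated_deriv \<alpha> f = foldr partial_deriv \<alpha> f"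

fun continuously_differentiable :: "nat \<Rightarrow> (real ^ 'n::finite \<Rightarrow> real) \<Rightarrow> bool" where
  "continuously_differentiable 0 f \<longleftrightarrow> continuous_on UNIV f"
| "continuously_differentiable (Suc k) f \<longleftrightarrow>
     f differentiable_on UNIV \<and> (\<forall>i. continuously_differentiable k (partial_deriv i f))"

text \<open>\<open>C\<^sub>c\<^sup>\<infinity>(\<Omega>)\<close>, its elements being extended by zero to the whole space.\<close>

definition test_functions :: "(real ^ 'n::finite) set \<Rightarrow> (real ^ 'n \<Rightarrow> real) set" where
  "test_functions \<Omega> = {\<phi>. (\<forall>k. continuously_differentiable k \<phi>) \<and>
     compact (closure {x. \<phi> x \<noteq> 0}) \<and> closure {x. \<phi> x \<noteq> 0} \<subseteq> \<Omega>}"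

definition locally_integrable :: "(real ^ 'n::finite) set \<Rightarrow> (real ^ 'n \<Rightarrow> real) \<Rightarrow> bool" where
  "locally_integrable \<Omega> u \<longleftrightarrow> (\<forall>K. compact K \<and> K \<subseteq> \<Omega> \<longrightarrow> u absolutely_integrable_on K)"

definition has_weak_deriv ::
  "(real ^ 'n::finite) set \<Rightarrow> 'n list \<Rightarrow> (real ^ 'n \<Rightarrow> real) \<Rightarrow> (real ^ 'n \<Rightarrow> real) \<Rightarrow> bool" where
  "has_weak_deriv \<Omega> \<alpha> u v \<longleftrightarrow> locally_integrable \<Omega> u \<and> locally_integrable \<Omega> v \<and>
     (\<forall>\<phi>\<in>test_functions \<Omega>.
        (LINT x:\<Omega>|lebesgue. u x * iterated_deriv \<alpha> \<phi> x) =
          (-1) ^ length \<alpha> * (LINT x:\<Omega>|lebesgue. v x * \<phi> x))"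

text \<open>On an open set a weak derivative is unique up to null sets; an arbitrary representative is
  chosen. The value is unspecified where no weak derivative exists.\<close>

definition weak_deriv ::
  "(real ^ 'n::finite) set \<Rightarrow> 'n list \<Rightarrow> (real ^ 'n \<Rightarrow> real) \<Rightarrow> real ^ 'n \<Rightarrow> real" where
  "weak_deriv \<Omega> \<alpha> u = (SOME v. has_weak_deriv \<Omega> \<alpha> u v)"

definition weak_gradient ::
  "(real ^ 'n::finite) set \<Rightarrow> (real ^ 'n \<Rightarrow> real) \<Rightarrow> real ^ 'n \<Rightarrow> real ^ 'n" where
  "weak_gradient \<Omega> u x = (\<chi> i. weak_deriv \<Omega> [i] u x)"

definition weak_laplacian ::
  "(real ^ 'n::finite) set \<Rightarrow> (real ^ 'n \<Rightarrow> real) \<Rightarrow> real ^ 'n \<Rightarrow> real" where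
  "weak_laplacian \<Omega> u x = (\<Sum>i\<in>UNIV. weak_deriv \<Omega> [i, i] u x)"

definition square_integrable :: "(real ^ 'n::finite) set \<Rightarrow> (real ^ 'n \<Rightarrow> real) set" where
  "square_integrable \<Omega> = {u. set_borel_measurable lebesgue \<Omega> u \<and>
     (\<lambda>x. (u x)\<^sup>2) absolutely_integrable_on \<Omega>}"

text \<open>The Sobolev space \<open>W\<^sup>k\<^sup>,\<^sup>2(\<Omega>)\<close>, with functions in place of almost-everywhere classes.\<close>

definition sobolev :: "nat \<Rightarrow> (real ^ 'n::finite) set \<Rightarrow> (real ^ 'n \<Rightarrow> real) set" where
  "sobolev k \<Omega> = {u \<in> square_integrable \<Omega>.
     \<forall>\<alpha>. length \<alpha> \<le> k \<longrightarrow> (\<exists>v\<in>square_integrable \<Omega>. has_weak_deriv \<Omega> \<alpha> u v)}"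

text \<open>Summing over lists counts mixed derivatives with multiplicity, which gives a norm equivalent
  to the one summing over multi-indices.\<close>

definition sobolev_norm :: "nat \<Rightarrow> (real ^ 'n::finite) set \<Rightarrow> (real ^ 'n \<Rightarrow> real) \<Rightarrow> real" where
  "sobolev_norm k \<Omega> u =
     sqrt (\<Sum>\<alpha> | length \<alpha> \<le> k. LINT x:\<Omega>|lebesgue. (weak_deriv \<Omega> \<alpha> u x)\<^sup>2)"

text \<open>\<open>W\<^sub>0\<^sup>k\<^sup>,\<^sup>2(\<Omega>)\<close>, the closure of \<open>C\<^sub>c\<^sup>\<infinity>(\<Omega>)\<close> in \<open>W\<^sup>k\<^sup>,\<^sup>2(\<Omega>)\<close>.\<close>

definition sobolev0 :: "nat \<Rightarrow> (real ^ 'n::finite) set \<Rightarrow> (real ^ 'n \<Rightarrow> real) set" where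
  "sobolev0 k \<Omega> = {u \<in> sobolev k \<Omega>.
     \<forall>\<epsilon>>0. \<exists>\<phi>\<in>test_functions \<Omega>. sobolev_norm k \<Omega> (\<lambda>x. u x - \<phi> x) < \<epsilon>}"

definition annulus :: "real \<Rightarrow> real \<Rightarrow> (real ^ 'n::finite) set" where
  "annulus a b = ball 0 b - cball 0 a"

end

theory Submission
  imports Defs
begin

text \<open>
  Write \<open>r = \<bar>x\<bar>\<close> and \<open>t = log r\<close>. In these coordinates the annulus is a cylinder of length
  \<open>\<ell> = log (b/a)\<close> over the unit sphere, and \<open>r\<^sup>2 \<Delta> = \<partial>\<^sub>t\<^sup>2 + (d - 2) \<partial>\<^sub>t - L\<close>, where \<open>L \<ge> 0\<close> is the Laplacian of
  the sphere. With respect to the measure \<open>r\<^sup>-\<^sup>4 dx\<close> the operator \<open>T = \<partial>\<^sub>t + (d - 4)/2\<close> is skew-symmetric,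
  and \<open>r\<^sup>2 \<Delta> = (T\<^sup>2 - c - L) + 2 T\<close> with \<open>c = d (d - 4)/4\<close> is the sum of a symmetric and a skew operator that
  commute. Hence \<open>\<integral> (\<Delta>u)\<^sup>2\<close> is a sum of quadratic terms in \<open>T\<close> and \<open>L\<close> without cross terms
  (\<open>lap_norm\<close>), and likewise for the weighted integrals of \<open>u\<^sup>2\<close> and \<open>\<bar>\<nabla>u\<bar>\<^sup>2\<close> (\<open>gradient_norm\<close>). The operators
  \<open>T\<close> and \<open>L\<close> now enter through two facts only.

  The first is the sharp Poincare inequality \<open>\<parallel>T f\<parallel>\<^sup>2 \<ge> s \<parallel>f\<parallel>\<^sup>2\<close>, \<open>s = \<pi>\<^sup>2 / \<ell>\<^sup>2\<close>, for functions vanishing at both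
  ends of the cylinder (\<open>radial_Poincare\<close>); it follows by completing a square with the logarithmic
  derivative of the sine. The second is the spectral gap of the sphere: nonzero eigenvalues of \<open>L\<close> are
  at least \<open>d - 1\<close>. Spherical harmonics are avoided by proving it as \<open>\<parallel>L f\<parallel>\<^sup>2 \<ge> (d - 1) \<langle>L f, f\<rangle>\<close> by means
  of Bochner's formula (\<open>Lichnerowicz\<close>). What remains is an inequality for a quadratic polynomial
  in the eigenvalue \<open>\<lambda>\<close>. The extremal value is \<open>\<lambda> = 0\<close> for the weight \<open>\<bar>x\<bar>\<^sup>-\<^sup>4\<close>, and for the gradient if \<open>d \<ge> 5\<close>; for
  the gradient in dimensions 3 and 4 it is \<open>\<lambda> = d - 1\<close>, and there \<open>s \<le> 1\<close> is used, i.e.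
  \<open>R = \<pi>\<close>.

  The polar calculus is carried out with operators in Cartesian coordinates, \<open>r \<partial>\<^sub>i\<close> and multiplication by
  \<open>x\<^sub>i / r\<close>, from a short list of algebraic rules (\<open>polar_calculus\<close>), and integration by parts takes place
  in the whole space. This proves the inequalities for test functions. They pass to \<open>W\<^sub>0\<^sup>2\<^sup>,\<^sup>2\<close> by density,
  because on the annulus the weights are bounded (\<open>sobolev0_inequality\<close>). As weak derivatives are chosen
  arbitrarily among their representatives, this step needs their uniqueness up to null sets, i.e. the
  fundamental lemma of the calculus of variations (\<open>fundamental_lemma\<close>).
\<close>

section \<open>Polar coordinates as an operator calculus\<close>

text \<open>The intended operators are \<open>P i f = r \<partial>\<^sub>i f\<close> and \<open>n i f = (x\<^sub>i / r) f\<close>, where \<open>r = \<bar>x\<bar>\<close>,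
acting on functions supported away from the origin, and \<open>B f g = \<integral> f g r\<^sup>-\<^sup>4\<close>.
Both operators are homogeneous of degree zero, so that everything built from them commutes with
dilations; with this normalisation the sphere can be treated as if \<open>r = 1\<close>, although no sphere and no
surface measure occur. Apart from the radial
Poincare inequality, the assumptions are all that the proof uses about these operators: the
product rule for \<open>P i\<close>, \<open>\<Sum> n\<^sub>i\<^sup>2 = 1\<close>, symmetry of second derivatives (the commutator of \<open>P i\<close> and
\<open>P j\<close>), and integration by parts, where the constant \<open>3\<close> comes from differentiating \<open>r\<^sup>-\<^sup>3\<close>.\<close>

locale polar_calculus =
  fixes P :: "'n::finite \<Rightarrow> 'v::real_vector \<Rightarrow> 'v"
    and n :: "'n \<Rightarrow> 'v \<Rightarrow> 'v"
    and B :: "'v \<Rightarrow> 'v \<Rightarrow> real"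
    and N :: real
  assumes N_eq: "N = real CARD('n)"
    and linear_P: "linear (P i)"
    and linear_n: "linear (n i)"
    and P_n: "P i (n j f) = (if i = j then f else 0) - n i (n j f) + n j (P i f)"
    and n_commute: "n i (n j f) = n j (n i f)"
    and n_unit: "(\<Sum>i\<in>UNIV. n i (n i f)) = f"
    and P_commutator: "P i (P j f) - P j (P i f) = n i (P j f) - n j (P i f)"
    and bilinear_B: "bilinear B"
    and B_sym: "B f g = B g f"
    and B_nonneg: "0 \<le> B f f"
    and B_n: "B (n i f) g = B f (n i g)"
    and B_P: "B (P i f) g = - B f (P i g) + 3 * B f (n i g)"
begin

text \<open>\<open>E\<close> is the Euler field \<open>x \<cdot> \<nabla>\<close>, i.e. \<open>\<partial>/\<partial>t\<close> with \<open>t = log r\<close>; \<open>D i\<close> is the tangential part of \<open>r \<partial>\<^sub>i\<close>; \<open>L\<close> is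
minus the Laplace-Beltrami operator of the unit sphere. The constant in \<open>T\<close> is the one that makes the
operator skew-symmetric for \<open>B\<close>. Since \<open>\<Sum> (r \<partial>\<^sub>i) (r \<partial>\<^sub>i) = r\<^sup>2 \<Delta> + x \<cdot> \<nabla>\<close>, \<open>lap\<close> is \<open>r\<^sup>2 \<Delta>\<close>.\<close>

definition E :: "'v \<Rightarrow> 'v" where "E f = (\<Sum>i\<in>UNIV. n i (P i f))"
definition D :: "'n \<Rightarrow> 'v \<Rightarrow> 'v" where "D i f = P i f - n i (E f)"
definition L :: "'v \<Rightarrow> 'v" where "L f = - (\<Sum>i\<in>UNIV. D i (D i f))"
definition T :: "'v \<Rightarrow> 'v" where "T f = E f + ((N - 4) / 2) *\<^sub>R f"
definition lap :: "'v \<Rightarrow> 'v" where "lap f = (\<Sum>i\<in>UNIV. P i (P i f)) - E f"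

lemmas P_lin = linear_add[OF linear_P] linear_diff[OF linear_P] linear_scale[OF linear_P]
  linear_neg[OF linear_P] linear_sum[OF linear_P] linear_0[OF linear_P]
lemmas n_lin = linear_add[OF linear_n] linear_diff[OF linear_n] linear_scale[OF linear_n]
  linear_neg[OF linear_n] linear_sum[OF linear_n] linear_0[OF linear_n]

lemma linear_E: "linear E"
  by (rule linearI) (simp_all add: E_def P_lin n_lin sum.distrib scaleR_sum_right)

lemmas E_lin = linear_add[OF linear_E] linear_diff[OF linear_E] linear_scale[OF linear_E]
  linear_neg[OF linear_E] linear_sum[OF linear_E] linear_0[OF linear_E]

lemma linear_D: "linear (D i)"
  by (rule linearI) (simp_all add: D_def P_lin n_lin E_lin algebra_simps)

lemmas D_lin = linear_add[OF linear_D] linear_diff[OF linear_D] linear_scale[OF linear_D]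
  linear_neg[OF linear_D] linear_sum[OF linear_D] linear_0[OF linear_D]

lemma linear_B_right: "linear (B f)"
  using bilinear_B by (simp add: bilinear_def)
lemma linear_B_left: "linear (\<lambda>f. B f g)"
  using bilinear_B by (simp add: bilinear_def)

lemmas B_lin = linear_add[OF linear_B_right] linear_diff[OF linear_B_right]
  linear_scale[OF linear_B_right] linear_neg[OF linear_B_right]
  linear_sum[OF linear_B_right] linear_0[OF linear_B_right]
  linear_add[OF linear_B_left] linear_diff[OF linear_B_left]
  linear_scale[OF linear_B_left] linear_neg[OF linear_B_left]
  linear_sum[OF linear_B_left] linear_0[OF linear_B_left]

lemma sum_n_D: "(\<Sum>i\<in>UNIV. n i (D i f)) = 0"
  by (simp add: D_def n_lin sum_subtractf n_unit flip: E_def)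

lemma sum_delta: "(\<Sum>i\<in>UNIV. n i (if i = j then f else 0)) = n j f"
  "(\<Sum>i\<in>UNIV. n i (if j = i then f else 0)) = n j f"
proof -
  have "(\<Sum>i\<in>UNIV. n i (if i = j then f else 0)) = (\<Sum>i\<in>UNIV. if i = j then n i f else 0)"
    by (intro sum.cong) (auto simp: n_lin)
  then show "(\<Sum>i\<in>UNIV. n i (if i = j then f else 0)) = n j f" by simp
  then show "(\<Sum>i\<in>UNIV. n i (if j = i then f else 0)) = n j f"
    by (simp add: eq_commute)
qed

lemma E_n: "E (n j f) = n j (E f)"
proof -
  have "(\<Sum>i\<in>UNIV. n i (n j (P i f))) = n j (E f)"
    by (simp add: E_def n_lin n_commute[of j])
  then show ?thesis
    unfolding E_def[of "n j f"] by (simp add: P_n n_lin sum.distrib sum_subtractf sum_delta n_unit)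
qed

lemma D_n: "D i (n j f) = (if i = j then f else 0) - n i (n j f) + n j (D i f)"
  by (simp add: D_def P_n E_n n_lin n_commute[of i j])

lemma E_P: "E (P j f) = P j (E f)"
proof -
  have "P j (E f) = (\<Sum>i\<in>UNIV. (if j = i then P i f else 0) - n j (n i (P i f)) + n i (P j (P i f)))"
    by (simp add: E_def P_lin P_n)
  also have "\<dots> = P j f - n j (E f) + (\<Sum>i\<in>UNIV. n i (P j (P i f)))"
    by (simp add: sum.distrib sum_subtractf E_def n_lin)
  finally have 1: "P j (E f) = P j f - n j (E f) + (\<Sum>i\<in>UNIV. n i (P j (P i f)))" .
  have "P i (P j f) = P j (P i f) + n i (P j f) - n j (P i f)" for i
    using P_commutator[of i j f] by (simp add: algebra_simps)
  then have "E (P j f) = (\<Sum>i\<in>UNIV. n i (P j (P i f) + n i (P j f) - n j (P i f)))"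
    by (simp add: E_def)
  also have "\<dots> = (\<Sum>i\<in>UNIV. n i (P j (P i f))) + P j f - n j (E f)"
    by (simp add: n_lin sum.distrib sum_subtractf n_unit E_def n_commute[of j])
  finally have "E (P j f) + n j (E f) = P j (E f) + n j (E f)" using 1 by simp
  then show ?thesis by simp
qed

lemma E_D: "E (D j f) = D j (E f)"
  by (simp add: D_def E_lin E_P E_n)

lemma T_D: "T (D j f) = D j (T f)"
  by (simp add: T_def E_D D_lin)

lemma T_L: "T (L f) = L (T f)"
  by (simp add: L_def T_def E_D D_lin E_lin sum.distrib scaleR_sum_right)

text \<open>Apart from \<open>P i (P j f)\<close> the right-hand side is symmetric in \<open>i\<close> and \<open>j\<close>, so that the commutator of
the tangential derivatives is inherited from that of the full ones.\<close>

lemma D_D: "D i (D j f) = P i (P j f) - (if i = j then E f else 0) + n i (n j (E f))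
    - n j (P i (E f)) - n i (P j (E f)) + n i (n j (E (E f)))"
proof -
  have "D i (D j f) = P i (P j f) - P i (n j (E f)) - n i (D j (E f))"
    by (subst D_def) (simp add: E_D, simp add: D_def P_lin)
  then show ?thesis by (simp add: P_n D_def n_lin algebra_simps)
qed

lemma D_commutator: "D i (D j f) = D j (D i f) + n i (D j f) - n j (D i f)"
proof -
  have "P i (P j f) = P j (P i f) + n i (P j f) - n j (P i f)"
    using P_commutator[of i j f] by (simp add: algebra_simps)
  then show ?thesis
    unfolding D_D[of i j] D_D[of j i] by (simp add: D_def n_lin n_commute[of i j])
qed

text \<open>The Laplacian in polar coordinates, \<open>r\<^sup>2 \<Delta> = \<partial>\<^sub>t\<^sup>2 + (N - 2) \<partial>\<^sub>t - L\<close>.\<close>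

lemma lap_polar: "lap f = E (E f) + (N - 2) *\<^sub>R E f - L f"
proof -
  have "(\<Sum>i\<in>UNIV. n i (P i (E f))) = E (E f)" by (simp add: E_def[of "E f"])
  moreover have "(\<Sum>i\<in>UNIV. D i (D i f)) = (\<Sum>i\<in>UNIV. P i (P i f)) - N *\<^sub>R E f + E f
    - E (E f) - E (E f) + E (E f)"
    by (simp add: D_D sum.distrib sum_subtractf n_unit calculation sum_constant_scaleR N_eq)
  ultimately show ?thesis by (simp add: lap_def L_def algebra_simps scaleR_2)
qed

lemma sum_B_n_n: "(\<Sum>i\<in>UNIV. B (n i f) (n i g)) = B f g"
proof -
  have "(\<Sum>i\<in>UNIV. B (n i f) (n i g)) = B f (\<Sum>i\<in>UNIV. n i (n i g))"
    by (simp add: B_n B_lin)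
  then show ?thesis by (simp add: n_unit)
qed

lemma B_E: "B (E f) g = - B f (E g) - (N - 4) * B f g"
proof -
  have "B (E f) g = (\<Sum>i\<in>UNIV. - B f (P i (n i g)) + 3 * B f (n i (n i g)))"
    by (simp add: E_def B_lin B_n B_P)
  also have "\<dots> = B f (\<Sum>i\<in>UNIV. - P i (n i g) + 3 *\<^sub>R n i (n i g))"
    by (simp add: B_lin)
  also have "(\<Sum>i\<in>UNIV. - P i (n i g) + 3 *\<^sub>R n i (n i g)) = - (N *\<^sub>R g) + g - E g + 3 *\<^sub>R g"
    by (simp add: P_n sum.distrib sum_subtractf n_unit sum_negf E_def sum_constant_scaleR N_eq
      flip: scaleR_sum_right)
  finally show ?thesis by (simp add: B_lin algebra_simps)
qed

lemma B_T: "B (T f) g = - B f (T g)"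
  by (simp add: T_def B_lin B_E field_simps)

text \<open>The multiple of \<open>n i\<close> is the mean curvature term of the divergence theorem on the sphere.\<close>

lemma B_D: "B (D i f) g = - B f (D i g) + (N - 1) * B f (n i g)"
  by (simp add: D_def B_lin B_P B_n B_E E_n algebra_simps)

lemma B_n_D: "(\<Sum>i\<in>UNIV. B (n i g) (D i f)) = 0" "(\<Sum>i\<in>UNIV. B (D i f) (n i g)) = 0"
proof -
  have "(\<Sum>i\<in>UNIV. B (n i g) (D i f)) = B g (\<Sum>i\<in>UNIV. n i (D i f))"
    by (simp add: B_lin B_n)
  then show "(\<Sum>i\<in>UNIV. B (n i g) (D i f)) = 0" by (simp add: sum_n_D B_lin)
  then show "(\<Sum>i\<in>UNIV. B (D i f) (n i g)) = 0" by (simp add: B_sym)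
qed

lemma B_L: "B (L f) g = (\<Sum>i\<in>UNIV. B (D i f) (D i g))"
proof -
  have "B (L f) g = (\<Sum>i\<in>UNIV. B (D i f) (D i g)) - (N - 1) * (\<Sum>i\<in>UNIV. B (D i f) (n i g))"
    by (simp add: L_def B_lin B_D[of _ "D _ f"] sum_subtractf sum_distrib_left sum.distrib sum_negf)
  then show ?thesis by (simp add: B_n_D)
qed

lemma B_L_right: "B f (L g) = (\<Sum>i\<in>UNIV. B (D i f) (D i g))"
  using B_L[of g f] by (simp add: B_sym)

section \<open>The spectral gap of the sphere\<close>

definition tangential :: "'v \<Rightarrow> real" where
  "tangential f = (\<Sum>i\<in>UNIV. B (D i f) (D i f))"

text \<open>Differentiating \<open>\<Sum> n\<^sub>j D\<^sub>j f = 0\<close>: the tangential gradient turns with the tangent plane.\<close>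

lemma sum_n_D_D: "(\<Sum>j\<in>UNIV. n j (D i (D j f))) = - D i f"
proof -
  have "0 = D i (\<Sum>j\<in>UNIV. n j (D j f))" by (simp add: sum_n_D D_lin)
  also have "\<dots> = (\<Sum>j\<in>UNIV. (if i = j then D j f else 0) - n i (n j (D j f)) + n j (D i (D j f)))"
    by (simp add: D_lin D_n)
  also have "\<dots> = D i f - n i (\<Sum>j\<in>UNIV. n j (D j f)) + (\<Sum>j\<in>UNIV. n j (D i (D j f)))"
    by (simp add: sum.distrib sum_subtractf n_lin)
  finally show ?thesis by (simp add: sum_n_D n_lin eq_neg_iff_add_eq_0 add.commute)
qed

text \<open>Integration by parts moves \<open>D i\<close> to the other side, where commuting it past \<open>D j\<close> produces the
curvature term \<open>(N - 2) \<bar>\<nabla>f\<bar>\<^sup>2\<close>.\<close>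

lemma Hessian_swapped:
  "(\<Sum>i\<in>UNIV. \<Sum>j\<in>UNIV. B (D i (D j f)) (D j (D i f))) = B (L f) (L f) - (N - 2) * tangential f"
proof -
  have 1: "(\<Sum>i\<in>UNIV. n i (D j (D i f))) = - D j f" for j by (rule sum_n_D_D)
  have 2: "(\<Sum>i\<in>UNIV. D i (D j (D i f))) = - D j (L f) - D j f + n j (L f)" for j
  proof -
    have "(\<Sum>i\<in>UNIV. D i (D j (D i f)))
       = (\<Sum>i\<in>UNIV. D j (D i (D i f)) + n i (D j (D i f)) - n j (D i (D i f)))"
      by (intro sum.cong refl) (rule D_commutator)
    also have "\<dots> = D j (\<Sum>i\<in>UNIV. D i (D i f)) + (\<Sum>i\<in>UNIV. n i (D j (D i f)))
         - n j (\<Sum>i\<in>UNIV. D i (D i f))"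
      by (simp add: sum.distrib sum_subtractf D_lin n_lin)
    also have "(\<Sum>i\<in>UNIV. D i (D i f)) = - L f" by (simp add: L_def)
    finally show ?thesis by (simp add: 1 D_lin n_lin)
  qed
  have "(\<Sum>i\<in>UNIV. \<Sum>j\<in>UNIV. B (D i (D j f)) (D j (D i f)))
     = (\<Sum>j\<in>UNIV. \<Sum>i\<in>UNIV. - B (D j f) (D i (D j (D i f))) + (N - 1) * B (D j f) (n i (D j (D i f))))"
    by (subst sum.swap) (simp add: B_D[of _ "D _ f"])
  also have "\<dots> = (\<Sum>j\<in>UNIV. - B (D j f) (\<Sum>i\<in>UNIV. D i (D j (D i f)))
       + (N - 1) * B (D j f) (\<Sum>i\<in>UNIV. n i (D j (D i f))))"
    by (simp add: sum.distrib sum_negf sum_subtractf B_lin sum_distrib_left)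
  also have "\<dots> = (\<Sum>j\<in>UNIV. B (D j f) (D j (L f)) - (N - 2) * B (D j f) (D j f) - B (D j f) (n j (L f)))"
    by (intro sum.cong refl) (simp add: 1 2 B_lin algebra_simps)
  also have "\<dots> = B (L f) (L f) - (N - 2) * tangential f"
    by (simp add: sum_subtractf B_n_D B_L tangential_def sum_distrib_left)
  finally show ?thesis .
qed

text \<open>The integrated Bochner formula. The matrix \<open>D\<^sub>i D\<^sub>j f + n\<^sub>j D\<^sub>i f\<close> is the covariant Hessian of \<open>f\<close> on the
sphere, the second summand removing the normal component of the derivative of the gradient; \<open>N - 2\<close>
is the Ricci curvature of the unit sphere in dimension \<open>N\<close>.\<close>

lemma Bochner:
  "(\<Sum>i\<in>UNIV. \<Sum>j\<in>UNIV. B (D i (D j f) + n j (D i f)) (D i (D j f) + n j (D i f)))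
    = B (L f) (L f) - (N - 2) * tangential f" (is "?H = _")
proof -
  let ?W = "\<Sum>i\<in>UNIV. \<Sum>j\<in>UNIV. B (D i (D j f)) (D i (D j f))"
  have mixed: "(\<Sum>i\<in>UNIV. \<Sum>j\<in>UNIV. B (D i (D j f)) (n j (D i f))) = - tangential f"
  proof -
    have "(\<Sum>j\<in>UNIV. B (D i (D j f)) (n j (D i f))) = B (\<Sum>j\<in>UNIV. n j (D i (D j f))) (D i f)" for i
      by (simp add: B_lin B_n)
    then show ?thesis by (simp add: sum_n_D_D B_lin tangential_def sum_negf)
  qed
  have diag: "(\<Sum>i\<in>UNIV. \<Sum>j\<in>UNIV. B (n j (D i f)) (n j (D i f))) = tangential f"
    by (simp add: sum_B_n_n tangential_def)
  have "?H = ?W + 2 * (\<Sum>i\<in>UNIV. \<Sum>j\<in>UNIV. B (D i (D j f)) (n j (D i f)))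
      + (\<Sum>i\<in>UNIV. \<Sum>j\<in>UNIV. B (n j (D i f)) (n j (D i f)))"
    by (simp add: B_lin sum.distrib sum_distrib_left B_sym[of "n _ _" "D _ _"])
  then have H: "?H = ?W - tangential f" by (simp add: mixed diag)
  have "?W = (\<Sum>i\<in>UNIV. \<Sum>j\<in>UNIV. B (D i (D j f)) (D j (D i f) + n i (D j f) - n j (D i f)))"
    by (intro sum.cong refl) (metis D_commutator)
  also have "\<dots> = (\<Sum>i\<in>UNIV. \<Sum>j\<in>UNIV. B (D i (D j f)) (D j (D i f)))
     + (\<Sum>j\<in>UNIV. \<Sum>i\<in>UNIV. B (D i (D j f)) (n i (D j f)))
     - (\<Sum>i\<in>UNIV. \<Sum>j\<in>UNIV. B (D i (D j f)) (n j (D i f)))"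
    unfolding sum.swap[of "\<lambda>j i. B (D i (D j f)) (n i (D j f))"]
    by (simp add: B_lin sum.distrib sum_subtractf)
  finally have "?W = B (L f) (L f) - (N - 2) * tangential f + tangential f"
    by (simp add: mixed Hessian_swapped B_n_D)
  with H show ?thesis by simp
qed

text \<open>The square of the trace-free part of the Hessian is nonnegative, which improves the Bochner formula
by \<open>\<bar>Lf\<bar>\<^sup>2 / (N - 1)\<close>. Spectrally the result says that every nonzero eigenvalue \<open>\<lambda>\<close> of \<open>L\<close> satisfies
\<open>\<lambda> \<ge> N - 1\<close>, in the form \<open>\<lambda> (\<lambda> - (N - 1)) \<ge> 0\<close>, which needs no spectral decomposition.\<close>

lemma Lichnerowicz:
  assumes "N > 2"
  shows "(N - 1) * tangential f \<le> B (L f) (L f)"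
proof -
  define h where "h i j = D i (D j f) + n j (D i f)" for i j
  define k where "k = (1 / (N - 1)) *\<^sub>R L f"
  \<comment> \<open>\<open>h\<close> is the Hessian; \<open>g\<close> is the round metric times minus the mean of the trace of \<open>h\<close>\<close>
  define g where "g i j = (if i = j then k else 0) - n i (n j k)" for i j
  have tr: "(\<Sum>i\<in>UNIV. h i i) = - L f"
    by (simp add: h_def sum.distrib sum_n_D L_def)
  have nh: "(\<Sum>i\<in>UNIV. n i (h i j)) = 0" for j
    using sum_n_D[of "D j f"] by (simp add: h_def n_lin sum.distrib n_commute[of _ j] sum_n_D
      flip: linear_sum[OF linear_n])
  have hg: "(\<Sum>i\<in>UNIV. \<Sum>j\<in>UNIV. B (h i j) (g i j)) = - B (L f) k"
  proof -
    have "(\<Sum>i\<in>UNIV. \<Sum>j\<in>UNIV. B (h i j) (g i j))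
       = (\<Sum>i\<in>UNIV. \<Sum>j\<in>UNIV. if i = j then B (h i j) k else 0) - (\<Sum>i\<in>UNIV. \<Sum>j\<in>UNIV. B (n i (h i j)) (n j k))"
      unfolding sum_subtractf[symmetric] by (intro sum.cong refl) (simp add: g_def B_lin B_n)
    also have "(\<Sum>i\<in>UNIV. \<Sum>j\<in>UNIV. if i = j then B (h i j) k else 0) = B (\<Sum>i\<in>UNIV. h i i) k"
      by (simp add: B_lin)
    also have "(\<Sum>i\<in>UNIV. \<Sum>j\<in>UNIV. B (n i (h i j)) (n j k)) = (\<Sum>j\<in>UNIV. B (\<Sum>i\<in>UNIV. n i (h i j)) (n j k))"
      by (subst sum.swap) (simp add: B_lin)
    finally show ?thesis by (simp add: tr nh B_lin)
  qed
  have gg: "(\<Sum>i\<in>UNIV. \<Sum>j\<in>UNIV. B (g i j) (g i j)) = (N - 1) * B k k"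
  proof -
    have "B (g i j) (g i j) = (if i = j then B k k - 2 * B (n i k) (n j k) else 0)
        + B (n i (n j k)) (n i (n j k))" for i j
    proof (cases "i = j")
      case True
      have "B (n i (n i k)) k = B (n i k) (n i k)" "B k (n i (n i k)) = B (n i k) (n i k)"
        by (simp_all add: B_n)
      with True show ?thesis by (simp add: g_def B_lin)
    qed (simp add: g_def B_lin)
    then have "(\<Sum>i\<in>UNIV. \<Sum>j\<in>UNIV. B (g i j) (g i j))
       = (\<Sum>i\<in>UNIV. B k k - 2 * B (n i k) (n i k)) + (\<Sum>i\<in>UNIV. \<Sum>j\<in>UNIV. B (n i (n j k)) (n i (n j k)))"
      by (simp add: sum.distrib)
    also have "(\<Sum>i\<in>UNIV. \<Sum>j\<in>UNIV. B (n i (n j k)) (n i (n j k))) = B k k"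
      by (subst sum.swap) (simp add: sum_B_n_n)
    finally show ?thesis by (simp add: sum_subtractf sum_B_n_n N_eq algebra_simps flip: sum_distrib_left)
  qed
  have "0 \<le> (\<Sum>i\<in>UNIV. \<Sum>j\<in>UNIV. B (h i j + g i j) (h i j + g i j))"
    by (intro sum_nonneg B_nonneg)
  also have "\<dots> = (\<Sum>i\<in>UNIV. \<Sum>j\<in>UNIV. B (h i j) (h i j)) + 2 * (\<Sum>i\<in>UNIV. \<Sum>j\<in>UNIV. B (h i j) (g i j))
      + (\<Sum>i\<in>UNIV. \<Sum>j\<in>UNIV. B (g i j) (g i j))"
    by (simp add: B_lin sum.distrib sum_distrib_left B_sym[of "g _ _" "h _ _"])
  also have "\<dots> = B (L f) (L f) - (N - 2) * tangential f - B (L f) (L f) / (N - 1)"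
    using assms unfolding hg gg Bochner[of f, folded h_def]
    by (simp add: k_def B_lin divide_simps)
  finally have "0 \<le> (N - 1) * (B (L f) (L f) - (N - 2) * tangential f - B (L f) (L f) / (N - 1))"
    using assms by simp
  also have "\<dots> = (N - 2) * (B (L f) (L f) - (N - 1) * tangential f)"
    using assms by (simp add: field_simps)
  finally show ?thesis
    using assms by (simp add: zero_le_mult_iff)
qed


section \<open>Rellich inequalities in polar form\<close>

lemma lap_T: "lap f = T (T f) + 2 *\<^sub>R T f - (N * (N - 4) / 4) *\<^sub>R f - L f"
proof -
  define g where "g = (N - 4) / 2"
  have N2: "N - 2 = g + g + 2" and c: "N * (N - 4) / 4 = g * g + (g + g)"
    by (auto simp: g_def field_simps)
  have T: "T h = E h + g *\<^sub>R h" for h by (simp add: T_def g_def)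
  show ?thesis unfolding lap_polar T N2 c
    by (simp add: E_lin scaleR_add_left scaleR_add_right scaleR_2 flip: mult_2)
      (simp flip: scaleR_add_left)
qed

lemma B_T_self: "B (T f) f = 0"
  using B_T[of f f] B_sym[of f "T f"] by simp

lemma linear_T: "linear T"
  by (rule linearI) (simp_all add: T_def E_lin algebra_simps)

text \<open>In \<open>r\<^sup>2 \<Delta> = (T\<^sup>2 - c - L) + 2 T\<close> the first operator is symmetric, the second is skew, and they commute.
Therefore the cross term vanishes and only squares remain.\<close>

lemma lap_norm:
  defines "c \<equiv> N * (N - 4) / 4"
  shows "B (lap f) (lap f) = B (T (T f)) (T (T f)) + (2 * c + 4) * B (T f) (T f)
      + 2 * tangential (T f) + c\<^sup>2 * B f f + 2 * c * tangential f + B (L f) (L f)"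
proof -
  \<comment> \<open>the symmetric part of \<open>r\<^sup>2 \<Delta>\<close> applied to \<open>f\<close>\<close>
  define g where "g = T (T f) - c *\<^sub>R f - L f"
  have T_g: "T g = T (T (T f)) - c *\<^sub>R T f - L (T f)"
    by (simp add: g_def linear_diff[OF linear_T] linear_scale[OF linear_T] T_L)
  have LT: "B (L h) (T (T h)) = - tangential (T h)" for h
    using B_T[of "T h" "L h"] by (simp add: B_sym[of "L h"] T_L B_L_right tangential_def)
  have "B (L f) (T f) = 0"
    using B_T[of "L f" f] B_L_right[of "T f" f] B_L[of "T f" f] B_sym[of "T f" "L f"]
    by (simp add: T_L B_sym)
  then have cross: "B g (T f) = 0"
    using B_T_self[of "T f"] B_T_self[of f] B_sym[of f "T f"] by (simp add: g_def B_lin)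
  have "lap f = g + 2 *\<^sub>R T f"
    by (simp add: lap_T g_def c_def)
  then have "B (lap f) (lap f) = B g g + 4 * B (T f) (T f)"
    by (simp add: B_lin cross B_sym[of "T f" g])
  moreover have "B g g = B (T (T f)) (T (T f)) + 2 * c * B (T f) (T f)
      + 2 * tangential (T f) + c\<^sup>2 * B f f + 2 * c * tangential f + B (L f) (L f)"
  proof -
    have "B f (T (T f)) = - B (T f) (T f)" by (simp add: B_T)
    moreover have "B (T (T f)) f = - B (T f) (T f)" by (simp add: B_T)
    moreover have "B (T (T f)) (L f) = - tangential (T f)" using LT[of f] B_sym by simp
    ultimately show ?thesis
      by (simp add: g_def B_lin LT power2_eq_square algebra_simps)
         (simp add: B_L B_L_right tangential_def algebra_simps)
  qed
  ultimately show ?thesis by (simp add: algebra_simps)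
qed

lemma gradient_norm:
  "(\<Sum>i\<in>UNIV. B (P i f) (P i f)) = B (T f) (T f) + (N - 4)\<^sup>2 / 4 * B f f + tangential f"
proof -
  have P: "P i f = D i f + n i (E f)" for i by (simp add: D_def)
  have E: "E f = T f - ((N - 4) / 2) *\<^sub>R f" by (simp add: T_def)
  have "(\<Sum>i\<in>UNIV. B (P i f) (P i f)) = tangential f + B (E f) (E f)"
    by (simp add: P B_lin sum.distrib B_n_D tangential_def sum_B_n_n)
  also have "B (E f) (E f) = B (T f) (T f) + (N - 4)\<^sup>2 / 4 * B f f"
    using B_T_self[of f] B_sym[of f "T f"] by (simp add: E B_lin power2_eq_square)
  finally show ?thesis by simp
qed

text \<open>The square of \<open>\<mu> - L\<close>, which vanishes on the first nonconstant spherical harmonics if \<open>\<mu> = N - 1\<close>.\<close>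

lemma angular_square:
  assumes "\<mu> > 0"
  shows "2 * tangential f \<le> \<mu> * B f f + B (L f) (L f) / \<mu>"
proof -
  have "0 \<le> B (\<mu> *\<^sub>R f - L f) (\<mu> *\<^sub>R f - L f)" by (rule B_nonneg)
  also have "\<dots> = \<mu> * (\<mu> * B f f + B (L f) (L f) / \<mu> - 2 * tangential f)"
    using assms by (simp add: B_lin B_sym[of f "L f"] algebra_simps)
       (simp add: B_L tangential_def)
  finally show ?thesis using assms by (simp add: zero_le_mult_iff)
qed

lemma tangential_nonneg: "0 \<le> tangential f"
  unfolding tangential_def by (intro sum_nonneg B_nonneg)

text \<open>The one-dimensional Poincare inequality in the variable \<open>t = log r\<close> with constant \<open>s\<close>, for the functions
to which it is applied below. On the annulus it holds with \<open>s = \<pi>\<^sup>2 / log\<^sup>2 (b/a)\<close>.\<close>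

definition radial_gap :: "real \<Rightarrow> 'v \<Rightarrow> bool" where
  "radial_gap s f \<longleftrightarrow> s * B f f \<le> B (T f) (T f) \<and> s * B (T f) (T f) \<le> B (T (T f)) (T (T f)) \<and>
     (\<forall>i. s * B (D i f) (D i f) \<le> B (T (D i f)) (T (D i f)))"

lemma tangential_gap:
  assumes "radial_gap s f"
  shows "s * tangential f \<le> tangential (T f)"
  using assms unfolding radial_gap_def tangential_def sum_distrib_left
  by (auto simp: T_D intro!: sum_mono)

text \<open>If \<open>L\<close> acts as \<open>\<lambda>\<close> and \<open>T\<^sup>2\<close> as \<open>- s\<close>, the Laplacian contributes \<open>s\<^sup>2 + (2 (c + \<lambda>) + 4) s + (c + \<lambda>)\<^sup>2\<close>,
and for \<open>\<lambda> = 0\<close> this is the stated product. For \<open>N \<ge> 4\<close> it increases with \<open>\<lambda>\<close> because \<open>c \<ge> 0\<close>. For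
\<open>N = 3\<close> one has \<open>c = - 3/4\<close>, and \<open>(c + \<lambda>)\<^sup>2 \<ge> c\<^sup>2\<close> holds for \<open>\<lambda> = 0\<close> and for \<open>\<lambda> \<ge> 3/2\<close>, but not in between:
here the spectral gap \<open>\<lambda> \<ge> 2\<close> of the sphere is needed.\<close>

lemma Rellich_inequality:
  assumes gap: "radial_gap s f" and "s \<ge> 0" and N: "N = 3 \<or> N \<ge> 4"
  shows "(N\<^sup>2 / 4 + s) * ((N - 4)\<^sup>2 / 4 + s) * B f f \<le> B (lap f) (lap f)"
proof -
  define c where "c = N * (N - 4) / 4"
  define m t p where "m = B f f" "t = B (T f) (T f)" "p = tangential f"
  have c4: "2 * c + 4 = N\<^sup>2 / 4 + (N - 4)\<^sup>2 / 4" "c\<^sup>2 = (N\<^sup>2 / 4) * ((N - 4)\<^sup>2 / 4)"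
    by (simp_all add: c_def field_simps power2_eq_square)
  then have "2 * c + 4 \<ge> 0" by simp
  then have t: "(2 * c + 4) * (s * m) \<le> (2 * c + 4) * t" "s * (s * m) \<le> s * t"
    using gap \<open>s \<ge> 0\<close> by (auto intro!: mult_left_mono simp: radial_gap_def m_t_p_def)
  have a: "s * t \<le> B (T (T f)) (T (T f))" using gap by (simp add: radial_gap_def m_t_p_def)
  have p: "0 \<le> p" "0 \<le> tangential (T f)" by (simp_all add: m_t_p_def tangential_nonneg)
  have cp: "0 \<le> 2 * c * p + B (L f) (L f)"
  proof (cases "N = 3")
    case True
    then show ?thesis using Lichnerowicz[of f] p(1) by (simp add: c_def m_t_p_def)
  next
    case False
    then have "c \<ge> 0" using N by (simp add: c_def)
    then show ?thesis using p(1) B_nonneg[of "L f"] by simp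
  qed
  have "(N\<^sup>2 / 4 + s) * ((N - 4)\<^sup>2 / 4 + s) * m = s * (s * m) + (2 * c + 4) * (s * m) + c\<^sup>2 * m"
    unfolding c4 by (simp add: algebra_simps)
  also have "\<dots> \<le> B (lap f) (lap f)"
    using t a p cp lap_norm[of f] unfolding c_def[symmetric] by (simp add: m_t_p_def)
  finally show ?thesis by (simp add: m_t_p_def)
qed

text \<open>For \<open>N \<ge> 5\<close> radial functions are extremal. The contribution of the angular part is bounded below by
\<open>\<lambda> (s + 2 c - N\<^sup>2 / 4 + \<lambda>)\<close>, which the spectral gap \<open>\<lambda> \<ge> N - 1\<close> makes nonnegative.\<close>

lemma gradient_inequality_high:
  assumes gap: "radial_gap s f" and "s \<ge> 0" and N: "N \<ge> 5"
  shows "(N\<^sup>2 / 4 + s) * (\<Sum>i\<in>UNIV. B (P i f) (P i f)) \<le> B (lap f) (lap f)"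
proof -
  define c where "c = N * (N - 4) / 4"
  define g where "g = (N - 4)\<^sup>2 / 4"
  define m t p where "m = B f f" "t = B (T f) (T f)" "p = tangential f"
  have c4: "2 * c + 4 = N\<^sup>2 / 4 + g" "c\<^sup>2 = N\<^sup>2 / 4 * g"
    by (simp_all add: c_def g_def field_simps power2_eq_square)
  have t: "g * (s * m) \<le> g * t" and a: "s * t \<le> B (T (T f)) (T (T f))"
    using gap by (auto intro!: mult_left_mono simp: radial_gap_def m_t_p_def g_def)
  have pt: "s * p \<le> tangential (T f)" using tangential_gap[OF gap] by (simp add: m_t_p_def)
  have sp: "0 \<le> s * p" using \<open>s \<ge> 0\<close> by (simp add: m_t_p_def tangential_nonneg)
  have "0 \<le> (2 * c - N\<^sup>2 / 4 + (N - 1)) * p"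
  proof -
    have "(2 * c - N\<^sup>2 / 4 + (N - 1)) = ((N - 2)\<^sup>2 - 8) / 4"
      by (simp add: c_def field_simps power2_eq_square)
    moreover have "(N - 2)\<^sup>2 \<ge> 3\<^sup>2" using N by (intro power_mono) auto
    ultimately show ?thesis by (simp add: m_t_p_def tangential_nonneg)
  qed
  also have "\<dots> \<le> (2 * c - N\<^sup>2 / 4) * p + B (L f) (L f)"
    using Lichnerowicz[of f] N by (simp add: m_t_p_def algebra_simps)
  finally have cp: "0 \<le> (2 * c - N\<^sup>2 / 4) * p + B (L f) (L f)" .
  have "(N\<^sup>2 / 4 + s) * (t + g * m + p)
      = (2 * c + 4) * t - g * t + s * t + g * (s * m) + c\<^sup>2 * m + N\<^sup>2 / 4 * p + s * p"
    unfolding c4 by (simp add: algebra_simps)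
  also have "\<dots> \<le> B (lap f) (lap f)"
    using t a pt cp sp lap_norm[of f] unfolding c_def[symmetric]
    by (simp add: m_t_p_def left_diff_distrib)
  finally show ?thesis by (simp add: gradient_norm m_t_p_def g_def)
qed

text \<open>Here the first nonconstant spherical harmonics, \<open>\<lambda> = \<mu> = N - 1\<close>, are extremal, and the constant \<open>C\<close> is
determined by the last assumption: after the radial Poincare inequality the difference of both sides
is the quadratic polynomial \<open>p(\<lambda>) = F + (2 s + 2 c - C) \<lambda> + \<lambda>\<^sup>2\<close>, and \<open>p(\<mu>) = 0\<close>. Since \<open>p\<close> may be negative
between \<open>0\<close> and \<open>\<mu>\<close>, the spectral gap of the sphere is essential. The decomposition
\<open>p(\<lambda>) = F (1 - \<lambda>/\<mu>)\<^sup>2 + (1 - F/\<mu>\<^sup>2) \<lambda> (\<lambda> - \<mu>)\<close> shows this without splitting off the spherical mean: the first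
summand is a square, and the second is the inequality of Lichnerowicz.\<close>

lemma gradient_inequality_low:
  assumes gap: "radial_gap s f" and N: "N > 2"
  defines "c \<equiv> N * (N - 4) / 4" and "g \<equiv> (N - 4)\<^sup>2 / 4"
  assumes A: "0 \<le> s + 2 * c + 4 - C"
    and F: "F = s * (s + 2 * c + 4 - C) + c\<^sup>2 - C * g" "0 \<le> F" "F \<le> (N - 1)\<^sup>2"
    and C: "F + (2 * s + 2 * c - C) * (N - 1) + (N - 1)\<^sup>2 = 0"
  shows "C * (\<Sum>i\<in>UNIV. B (P i f) (P i f)) \<le> B (lap f) (lap f)"
proof -
  define A where "A = s + 2 * c + 4 - C"
  define \<mu> where "\<mu> = N - 1"
  define m t p l where "m = B f f" "t = B (T f) (T f)" "p = tangential f" "l = B (L f) (L f)"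
  have \<mu>: "\<mu> > 0" using N by (simp add: \<mu>_def)
  have t: "A * (s * m) \<le> A * t" and a: "s * t \<le> B (T (T f)) (T (T f))"
    using gap A by (auto intro!: mult_left_mono simp: radial_gap_def m_t_p_l_def A_def)
  have pt: "s * p \<le> tangential (T f)" using tangential_gap[OF gap] by (simp add: m_t_p_l_def)
  have K: "2 * s + 2 * c - C = - (F / \<mu> + \<mu>)"
    using C \<mu> unfolding \<mu>_def[symmetric] by (simp add: field_simps power2_eq_square)
  have "0 \<le> F / \<mu> * (\<mu> * m + l / \<mu> - 2 * p)"
    using F \<mu> angular_square[OF \<mu>, of f] by (simp add: m_t_p_l_def)
  moreover have "0 \<le> (1 - F / \<mu>\<^sup>2) * (l - \<mu> * p)"
    using F \<mu> Lichnerowicz[OF N, of f] by (simp add: m_t_p_l_def \<mu>_def)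
  moreover have "F / \<mu> * (\<mu> * m + l / \<mu> - 2 * p) + (1 - F / \<mu>\<^sup>2) * (l - \<mu> * p)
     = F * m - (F / \<mu> + \<mu>) * p + l"
    using \<mu> by (simp add: field_simps power2_eq_square)
  ultimately have "0 \<le> F * m - (F / \<mu> + \<mu>) * p + l" by linarith
  then have "0 \<le> F * m + (2 * s + 2 * c - C) * p + l"
    unfolding K by (simp add: algebra_simps)
  also have "\<dots> = A * (s * m) + c\<^sup>2 * m - C * g * m + 2 * (s * p) + 2 * c * p - C * p + l"
    unfolding F(1) A_def by (simp add: algebra_simps)
  finally have ineq: "0 \<le> A * (s * m) + c\<^sup>2 * m - C * g * m + 2 * (s * p) + 2 * c * p - C * p + l" .
  have "A * t = s * t + (2 * c + 4) * t - C * t" by (simp add: A_def algebra_simps)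
  then have "C * t + C * g * m + C * p \<le> B (lap f) (lap f)"
    using ineq t a pt lap_norm[of f] unfolding c_def[symmetric] by (simp add: m_t_p_l_def)
  then show ?thesis by (simp add: gradient_norm m_t_p_l_def g_def algebra_simps)
qed

end

section \<open>Smooth functions with compact support\<close>

text \<open>The derivative of a function vanishes off its support, so weights need to be smooth on the support only.\<close>

definition support :: "(real ^ 'n::finite \<Rightarrow> real) \<Rightarrow> (real ^ 'n) set" where
  "support f = closure {x. f x \<noteq> 0}"

abbreviation smooth :: "(real ^ 'n::finite \<Rightarrow> real) \<Rightarrow> bool" where
  "smooth f \<equiv> \<forall>k. continuously_differentiable k f"

lemma partial_deriv_eqI:
  assumes "(f has_derivative f') (at x)"
  shows "partial_deriv i f x = f' (axis i 1)"
  using frechet_derivative_at[OF assms] by (simp add: partial_deriv_def)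

lemma has_derivative_frechet:
  assumes "f differentiable at x"
  shows "(f has_derivative frechet_derivative f (at x)) (at x)"
  using assms by (simp add: frechet_derivative_works)

lemma continuously_differentiable_imp_differentiable:
  assumes "continuously_differentiable (Suc k) f"
  shows "f differentiable at x"
  using assms by (simp add: differentiable_on_def)

lemma continuously_differentiable_imp_continuous:
  "continuously_differentiable k f \<Longrightarrow> continuous_on UNIV f"
  by (cases k) (auto intro: differentiable_imp_continuous_on)

lemma continuously_differentiable_SucD:
  "continuously_differentiable (Suc k) f \<Longrightarrow> continuously_differentiable k f"
proof (induction k arbitrary: f)
  case 0
  then show ?case by (simp add: differentiable_imp_continuous_on)
next
  case (Suc k)
  then show ?case by (metis continuously_differentiable.simps(2))
qed

lemma smooth_partial_deriv: "smooth f \<Longrightarrow> smooth (partial_deriv i f)"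
  by (metis continuously_differentiable.simps(2))

lemma smooth_imp_differentiable: "smooth f \<Longrightarrow> f differentiable at x"
  using continuously_differentiable_imp_differentiable by blast

lemma smooth_imp_continuous: "smooth f \<Longrightarrow> continuous_on UNIV f"
  using continuously_differentiable_imp_continuous by blast

lemma partial_deriv_add:
  assumes "f differentiable at x" "g differentiable at x"
  shows "partial_deriv i (\<lambda>x. f x + g x) x = partial_deriv i f x + partial_deriv i g x"
  unfolding partial_deriv_eqI[OF has_derivative_add[OF assms[THEN has_derivative_frechet]]]
  by (simp add: partial_deriv_def)

lemma partial_deriv_mult:
  assumes "f differentiable at x" "g differentiable at x"
  shows "partial_deriv i (\<lambda>x. f x * g x) x = f x * partial_deriv i g x + partial_deriv i f x * g x"
  unfolding partial_deriv_eqI[OF has_derivative_mult[OF assms[THEN has_derivative_frechet]]]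
  by (simp add: partial_deriv_def)

lemma partial_deriv_const: "partial_deriv i (\<lambda>x. c) = (\<lambda>x. 0)"
  by (rule ext, rule partial_deriv_eqI[OF has_derivative_const, THEN trans]) simp

lemma partial_deriv_coord: "partial_deriv i (\<lambda>x::real ^ 'n::finite. x $ j) = (\<lambda>x. if i = j then 1 else 0)"
proof
  fix x :: "real ^ 'n"
  have "((\<lambda>x. x $ j) has_derivative (\<lambda>x. x $ j)) (at x)"
    by (rule bounded_linear.has_derivative[OF bounded_linear_vec_nth]) (rule has_derivative_ident)
  then show "partial_deriv i (\<lambda>x. x $ j) x = (if i = j then 1 else 0)"
    by (simp add: partial_deriv_eqI axis_def)
qed

lemma continuously_differentiable_add:
  "continuously_differentiable k f \<Longrightarrow> continuously_differentiable k g \<Longrightarrow>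
    continuously_differentiable k (\<lambda>x. f x + g x)"
proof (induction k arbitrary: f g)
  case 0 then show ?case by (auto intro: continuous_on_add)
next
  case (Suc k)
  then have "partial_deriv i (\<lambda>x. f x + g x) = (\<lambda>x. partial_deriv i f x + partial_deriv i g x)" for i
    by (intro ext partial_deriv_add continuously_differentiable_imp_differentiable)
  with Suc show ?case by auto
qed

lemma continuously_differentiable_mult:
  "continuously_differentiable k f \<Longrightarrow> continuously_differentiable k g \<Longrightarrow>
    continuously_differentiable k (\<lambda>x. f x * g x)"
proof (induction k arbitrary: f g)
  case 0 then show ?case by (auto intro: continuous_on_mult)
next
  case (Suc k)
  then have "partial_deriv i (\<lambda>x. f x * g x) = (\<lambda>x. f x * partial_deriv i g x + partial_deriv i f x * g x)" for i
    by (intro ext partial_deriv_mult continuously_differentiable_imp_differentiable)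
  moreover have "continuously_differentiable k (\<lambda>x. f x * partial_deriv i g x + partial_deriv i f x * g x)" for i
    using Suc.prems continuously_differentiable_SucD
    by (intro continuously_differentiable_add Suc.IH) auto
  ultimately show ?case using Suc.prems by auto
qed

lemma continuously_differentiable_const: "continuously_differentiable k (\<lambda>x. c)"
  by (induction k arbitrary: c) (auto simp: partial_deriv_const)

lemma continuously_differentiable_coord: "continuously_differentiable k (\<lambda>x::real ^ 'n::finite. x $ j)"
proof (cases k)
  case (Suc l)
  have "(\<lambda>x::real ^ 'n. x $ j) differentiable_on UNIV"
    by (auto intro!: linear_imp_differentiable_on simp: bounded_linear_vec_nth bounded_linear.linear)
  then show ?thesis
    using Suc by (auto simp: partial_deriv_coord continuously_differentiable_const)
qed (auto intro: continuous_intros)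

lemma smooth_add: "smooth f \<Longrightarrow> smooth g \<Longrightarrow> smooth (\<lambda>x. f x + g x)"
  and smooth_mult: "smooth f \<Longrightarrow> smooth g \<Longrightarrow> smooth (\<lambda>x. f x * g x)"
  by (auto intro: continuously_differentiable_add continuously_differentiable_mult)

subsection \<open>Supports\<close>

lemma closed_support [simp]: "closed (support f)"
  by (simp add: support_def)

lemma support_subset_imp:
  assumes "\<And>x. f x = 0 \<Longrightarrow> g x = 0"
  shows "support g \<subseteq> support f"
  unfolding support_def by (rule closure_mono) (use assms in auto)

lemma not_in_support: "x \<notin> support f \<Longrightarrow> f x = 0"
  unfolding support_def using closure_subset[of "{x. f x \<noteq> 0}"] by blast

lemma has_derivative_off_support:
  assumes "x \<notin> support f"
  shows "((\<lambda>x. f x * w x) has_derivative (\<lambda>h. 0)) (at x)"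
proof (rule has_derivative_transform_within_open[where s = "- support f"])
  show "((\<lambda>x. 0::real) has_derivative (\<lambda>h. 0)) (at x)" by simp
  show "open (- support f)" by (simp add: open_Compl)
  show "x \<in> - support f" using assms by simp
  fix y assume "y \<in> - support f"
  then have "f y = 0" by (intro not_in_support) (rule ComplD)
  then show "0 = f y * w y" by (simp only: mult_zero_left)
qed

lemma frechet_off_support:
  assumes "x \<notin> support f" shows "frechet_derivative f (at x) = (\<lambda>h. 0)"
  using frechet_derivative_at[OF has_derivative_off_support[OF assms, of "\<lambda>x. 1"], symmetric] by simp

lemma partial_deriv_off_support: "x \<notin> support f \<Longrightarrow> partial_deriv i f x = 0"
  by (simp add: partial_deriv_def frechet_off_support)

lemma support_partial_deriv: "support (partial_deriv i f) \<subseteq> support f"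
  unfolding support_def[of "partial_deriv i f"]
  by (rule closure_minimal) (use partial_deriv_off_support[of _ f i] in auto)

text \<open>Where \<open>w\<close> is not differentiable, \<open>f\<close> vanishes near \<open>x\<close> and the product rule holds with any \<open>w'\<close>.\<close>

lemma has_derivative_mult_supported:
  assumes f: "f differentiable at x"
    and w: "x \<in> support f \<Longrightarrow> (w has_derivative w') (at x)"
  shows "((\<lambda>x. f x * w x) has_derivative (\<lambda>h. f x * w' h + frechet_derivative f (at x) h * w x)) (at x)"
proof (cases "x \<in> support f")
  case True
  then show ?thesis using has_derivative_mult[OF has_derivative_frechet[OF f] w] by simp
next
  case False
  then show ?thesis
    using has_derivative_off_support[OF False] by (simp add: not_in_support[OF False] frechet_off_support[OF False])
qed

lemma continuous_on_mult_supported: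
  fixes f w :: "real ^ 'n::finite \<Rightarrow> real"
  assumes f: "continuous_on UNIV f" and w: "continuous_on U w" and "open U" and "support f \<subseteq> U"
  shows "continuous_on UNIV (\<lambda>x. f x * w x)"
proof -
  have "continuous_on U (\<lambda>x. f x * w x)"
    by (intro continuous_on_mult w continuous_on_subset[OF f]) auto
  moreover have "continuous_on (- support f) (\<lambda>x. f x * w x) = continuous_on (- support f) (\<lambda>x. 0::real)"
    by (intro continuous_on_cong refl) (use not_in_support[of _ f] in auto)
  moreover have "U \<union> - support f = UNIV" using assms by auto
  ultimately show ?thesis
    using continuous_on_open_Un[OF \<open>open U\<close>, of "- support f" "\<lambda>x. f x * w x"] by (simp add: open_Compl)
qed

subsection \<open>Test functions\<close>

lemma test_functionsD:
  assumes "f \<in> test_functions U"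
  shows "smooth f" "compact (support f)" "support f \<subseteq> U"
  using assms by (auto simp: test_functions_def support_def)

lemma test_functions_mono: "f \<in> test_functions U \<Longrightarrow> U \<subseteq> V \<Longrightarrow> f \<in> test_functions V"
  by (auto simp: test_functions_def)

lemma test_functionI:
  assumes "smooth g" "f \<in> test_functions U" "support g \<subseteq> support f"
  shows "g \<in> test_functions U"
proof -
  have "compact (support g)"
    using test_functionsD(2)[OF assms(2)] assms(3) by (metis closed_support compact_Int_closed inf.absorb_iff2)
  then show ?thesis using assms test_functionsD[OF assms(2)]
    by (auto simp: test_functions_def support_def[symmetric])
qed

lemma test_partial:
  assumes "f \<in> test_functions U" shows "partial_deriv i f \<in> test_functions U"
  by (rule test_functionI[OF smooth_partial_deriv[OF test_functionsD(1)[OF assms]] assms support_partial_deriv])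

lemma test_mult_smooth:
  assumes "f \<in> test_functions U" "smooth g" shows "(\<lambda>x. f x * g x) \<in> test_functions U"
  by (rule test_functionI[OF smooth_mult[OF test_functionsD(1)[OF assms(1)] assms(2)] assms(1)])
    (rule support_subset_imp, simp)

lemma test_mult: "f \<in> test_functions U \<Longrightarrow> g \<in> test_functions V \<Longrightarrow> (\<lambda>x. f x * g x) \<in> test_functions U"
  by (rule test_mult_smooth[OF _ test_functionsD(1)])

lemma test_scale: "f \<in> test_functions U \<Longrightarrow> (\<lambda>x. c * f x) \<in> test_functions U"
  using test_mult_smooth[of f U "\<lambda>_. c"] by (simp add: continuously_differentiable_const mult.commute)

lemma test_coord: "f \<in> test_functions U \<Longrightarrow> (\<lambda>x. x $ i * f x) \<in> test_functions U"
  using test_mult_smooth[of f U "\<lambda>x. x $ i"] by (simp add: continuously_differentiable_coord mult.commute)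

lemma test_add:
  assumes "f \<in> test_functions U" "g \<in> test_functions U"
  shows "(\<lambda>x. f x + g x) \<in> test_functions U"
proof -
  have sub: "support (\<lambda>x. f x + g x) \<subseteq> support f \<union> support g"
    unfolding support_def closure_Un[symmetric] by (rule closure_mono) auto
  moreover have "compact (support f \<union> support g)"
    using assms by (auto intro: compact_Un test_functionsD)
  ultimately have "compact (support (\<lambda>x. f x + g x))"
    by (metis closed_support compact_Int_closed inf.absorb_iff2)
  with sub show ?thesis using smooth_add[of f g] test_functionsD[OF assms(1)] test_functionsD[OF assms(2)]
    by (auto simp: test_functions_def support_def[symmetric])
qed

lemma test_diff: "f \<in> test_functions U \<Longrightarrow> g \<in> test_functions U \<Longrightarrow> (\<lambda>x. f x - g x) \<in> test_functions U"
  using test_add[OF _ test_scale[of g U "-1"], of f] by simp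

lemma test_zero: "(\<lambda>x. 0) \<in> test_functions U"
  by (simp add: test_functions_def continuously_differentiable_const)

lemma test_sum: "(\<And>i. i \<in> I \<Longrightarrow> f i \<in> test_functions U) \<Longrightarrow> (\<lambda>x. \<Sum>i\<in>I. f i x) \<in> test_functions U"
  by (induction I rule: infinite_finite_induct) (auto intro: test_zero test_add)

lemma test_differentiable: "f \<in> test_functions U \<Longrightarrow> f differentiable at x"
  using smooth_imp_differentiable test_functionsD(1) by blast

lemma has_derivative_norm_power:
  fixes x :: "real ^ 'n::finite"
  assumes "x \<noteq> 0"
  shows "((\<lambda>x. inverse (norm x ^ m)) has_derivative (\<lambda>h. - real m * (x \<bullet> h) / norm x ^ (m + 2))) (at x)"
proof -
  have "((\<lambda>y. norm y) has_derivative (\<lambda>h. h \<bullet> sgn x)) (at x)"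
    using has_derivative_norm[OF assms] .
  from Deriv.has_derivative_inverse[OF _ has_derivative_power[OF this, of m]]
  have "((\<lambda>x. inverse (norm x ^ m)) has_derivative (\<lambda>h. - (inverse (norm x ^ m) *
     (of_nat m * (h \<bullet> sgn x) * norm x ^ (m - 1)) * inverse (norm x ^ m)))) (at x)"
    using assms by simp
  moreover have "- (inverse (norm x ^ m) * (of_nat m * (h \<bullet> sgn x) * norm x ^ (m - 1)) * inverse (norm x ^ m))
    = - real m * (x \<bullet> h) / norm x ^ (m + 2)" for h
    using assms by (cases m) (auto simp: sgn_div_norm field_simps inner_commute)
  ultimately show ?thesis by simp
qed

lemma test_div_norm_derivative:
  fixes f :: "real ^ 'n::finite \<Rightarrow> real"
  assumes f: "f \<in> test_functions (- {0})"
  shows "(\<lambda>x. f x / norm x ^ m) differentiable at x" (is ?d)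
    and "partial_deriv i (\<lambda>x. f x / norm x ^ m) x
      = partial_deriv i f x / norm x ^ m - real m * (x $ i * f x) / norm x ^ (m + 2)" (is ?p)
proof -
  have "((\<lambda>x. f x * inverse (norm x ^ m)) has_derivative
    (\<lambda>h. f x * (- real m * (x \<bullet> h) / norm x ^ (m + 2)) + frechet_derivative f (at x) h * inverse (norm x ^ m))) (at x)"
    using test_functionsD(3)[OF f]
    by (intro has_derivative_mult_supported has_derivative_norm_power test_differentiable[OF f]) auto
  note * = this[folded divide_inverse]
  then show ?d by (auto simp: differentiable_def)
  show ?p by (subst partial_deriv_eqI[OF *])
    (auto simp: partial_deriv_def divide_inverse inner_axis algebra_simps)
qed

text \<open>Dividing by a power of \<open>\<bar>x\<bar>\<close> preserves smoothness off the origin: the derivative is again a sum of such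
quotients, so that the claim for all \<open>f\<close> and \<open>m\<close> passes from \<open>C\<^sup>k\<close> to \<open>C\<^sup>k\<^sup>+\<^sup>1\<close>.\<close>

lemma test_div_norm:
  fixes f :: "real ^ 'n::finite \<Rightarrow> real"
  assumes f: "f \<in> test_functions U" and U: "0 \<notin> U"
  shows "(\<lambda>x. f x / norm x ^ m) \<in> test_functions U"
proof -
  have "continuously_differentiable k (\<lambda>x. f x / norm x ^ m)" if "f \<in> test_functions (- {0})" for k m
    and f :: "real ^ 'n::finite \<Rightarrow> real"
    using that
  proof (induction k arbitrary: f m)
    case 0
    have "continuous_on (- {0}) (\<lambda>x::real ^ 'n. inverse (norm x ^ m))"
      by (intro continuous_intros) auto
    from continuous_on_mult_supported[OF _ this, of f] show ?case
      using test_functionsD[OF 0] smooth_imp_continuous by (auto simp: divide_inverse)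
  next
    case (Suc k)
    note f = Suc.prems
    have "continuously_differentiable k (partial_deriv i (\<lambda>x. f x / norm x ^ m))" for i
    proof -
      have 1: "continuously_differentiable k (\<lambda>x. partial_deriv i f x / norm x ^ m)"
        by (rule Suc.IH[OF test_partial[OF f]])
      have 2: "continuously_differentiable k (\<lambda>x. (- real m * (x $ i * f x)) / norm x ^ (m + 2))"
        by (rule Suc.IH[OF test_scale[OF test_coord[OF f]]])
      have "partial_deriv i (\<lambda>x. f x / norm x ^ m) =
         (\<lambda>x. partial_deriv i f x / norm x ^ m + (- real m * (x $ i * f x)) / norm x ^ (m + 2))"
        by (rule ext) (subst test_div_norm_derivative(2)[OF f], simp)
      then show ?thesis using continuously_differentiable_add[OF 1 2] by simp
    qed
    then show ?case using test_div_norm_derivative(1)[OF f] by (simp add: differentiable_on_def)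
  qed
  moreover have "f \<in> test_functions (- {0})" using test_functions_mono[OF f] U by auto
  ultimately show ?thesis
    by (intro test_functionI[OF _ f] support_subset_imp) auto
qed

lemma test_mult_norm:
  fixes f :: "real ^ 'n::finite \<Rightarrow> real"
  assumes f: "f \<in> test_functions U" and U: "0 \<notin> U"
  shows "(\<lambda>x. norm x * f x) \<in> test_functions U"
proof -
  have "(\<lambda>x. (\<Sum>i\<in>UNIV. x $ i * (x $ i * f x)) / norm x ^ 1) \<in> test_functions U"
    by (intro test_div_norm test_sum test_coord f U)
  moreover have "(\<Sum>i\<in>UNIV. x $ i * (x $ i * f x)) / norm x ^ 1 = norm x * f x" for x
  proof -
    have "(\<Sum>i\<in>UNIV. x $ i * (x $ i * f x)) = (norm x)\<^sup>2 * f x"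
      by (simp add: power2_norm_eq_inner inner_vec_def sum_distrib_right mult.assoc)
    then show ?thesis by (simp add: power2_eq_square)
  qed
  ultimately show ?thesis by simp
qed

subsection \<open>Integration\<close>

lemma integrable_compact_support:
  fixes f :: "real ^ 'n::finite \<Rightarrow> real"
  assumes "continuous_on UNIV f" "compact (support f)"
  shows "integrable lborel f"
proof -
  have "integrable lborel (\<lambda>x. indicator (support f) x *\<^sub>R f x)"
    by (intro borel_integrable_compact assms(2) continuous_on_subset[OF assms(1)]) auto
  moreover have "(\<lambda>x. indicator (support f) x *\<^sub>R f x) = f"
    by (rule ext) (auto simp: indicator_def dest: not_in_support)
  ultimately show ?thesis by simp
qed

lemma test_integrable: "f \<in> test_functions U \<Longrightarrow> integrable lborel f"
  by (intro integrable_compact_support smooth_imp_continuous) (auto dest: test_functionsD)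

lemma line_derivative:
  assumes "f differentiable at (x + t *\<^sub>R axis i 1)"
  shows "((\<lambda>t. f (x + t *\<^sub>R axis i 1)) has_real_derivative partial_deriv i f (x + t *\<^sub>R axis i 1)) (at t)"
proof -
  have 1: "((\<lambda>t. x + t *\<^sub>R axis i 1) has_derivative (\<lambda>h. h *\<^sub>R axis i 1)) (at t)"
    by (auto intro!: derivative_eq_intros)
  have lin: "linear (frechet_derivative f (at (x + t *\<^sub>R axis i 1)))"
    by (rule linear_frechet_derivative[OF assms])
  show ?thesis
    using has_derivative_compose[OF 1 has_derivative_frechet[OF assms]]
    by (simp add: has_field_derivative_def partial_deriv_def linear_scale[OF lin] mult_commute_abs)
qed

text \<open>Translation invariance makes the integral of every difference quotient of \<open>f\<close> vanish; the difference
quotients are bounded by \<open>sup \<bar>\<partial>\<^sub>i f\<bar>\<close> on a fixed ball, so that dominated convergence applies.\<close>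

lemma integral_partial_deriv:
  fixes f :: "real ^ 'n::finite \<Rightarrow> real"
  assumes f: "\<And>x. f differentiable at x" and cont: "continuous_on UNIV (partial_deriv i f)"
    and comp: "compact (support f)"
  shows "(LINT x|lborel. partial_deriv i f x) = 0"
proof -
  let ?e = "axis i 1 :: real ^ 'n"
  define h where "h k = inverse (real (Suc k))" for k
  have h: "0 < h k" "h k \<le> 1" for k by (auto simp: h_def field_simps)
  have h0: "h \<longlonglongrightarrow> 0" unfolding h_def by (rule LIMSEQ_inverse_real_of_nat)
  define q where "q k x = (f (x + h k *\<^sub>R ?e) - f x) / h k" for k x
  have contf: "continuous_on UNIV f"
    using f by (simp add: differentiable_imp_continuous_on differentiable_on_def)
  have intf: "integrable lborel f" by (rule integrable_compact_support[OF contf comp])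
  have comp': "compact (support (partial_deriv i f))"
    using comp support_partial_deriv by (metis closed_support compact_Int_closed inf.absorb_iff2)
  obtain R where R: "\<And>x. x \<in> support f \<Longrightarrow> norm x \<le> R"
    using compact_imp_bounded[OF comp] by (auto simp: bounded_iff)
  obtain M where M: "\<And>x. \<bar>partial_deriv i f x\<bar> \<le> M"
  proof -
    have "compact (partial_deriv i f ` support (partial_deriv i f))"
      by (intro compact_continuous_image comp' continuous_on_subset[OF cont]) auto
    then obtain M where M: "\<And>x. x \<in> support (partial_deriv i f) \<Longrightarrow> \<bar>partial_deriv i f x\<bar> \<le> M"
      using compact_imp_bounded[of "partial_deriv i f ` support (partial_deriv i f)"]
      by (auto simp: bounded_iff)
    show ?thesis
      by (rule that[of "max M 0"]) (metis M abs_zero not_in_support le_max_iff_disj order_refl)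
  qed
  have shift: "integrable lborel (\<lambda>x. f (x + c))" "(LINT x|lborel. f (x + c)) = (LINT x|lborel. f x)" for c
  proof -
    have [measurable]: "f \<in> borel_measurable borel" using contf by (simp add: borel_measurable_continuous_onI)
    have m: "(+) c \<in> lborel \<rightarrow>\<^sub>M borel" by simp
    show "integrable lborel (\<lambda>x. f (x + c))"
      using intf integrable_distr_eq[OF m, of f] by (simp add: lborel_distr_plus add.commute)
    show "(LINT x|lborel. f (x + c)) = (LINT x|lborel. f x)"
      using integral_distr[OF m, of f] by (simp add: lborel_distr_plus add.commute)
  qed
  have "(\<lambda>k. LINT x|lborel. q k x) \<longlonglongrightarrow> (LINT x|lborel. partial_deriv i f x)"
  \<comment> \<open>steps have length at most 1, so all difference quotients vanish off the ball of radius \<open>R + 1\<close>\<close>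
  proof (rule integral_dominated_convergence[where w = "\<lambda>x. indicator (cball 0 (R + 1)) x *\<^sub>R M"])
    show "partial_deriv i f \<in> borel_measurable lborel"
      using cont by (simp add: borel_measurable_continuous_onI)
    show "q k \<in> borel_measurable lborel" for k
      using shift(1)[of "h k *\<^sub>R ?e"] intf unfolding q_def by measurable
    show "integrable lborel (\<lambda>x::real ^ 'n. indicator (cball 0 (R + 1)) x *\<^sub>R M)"
      by (intro borel_integrable_compact) auto
    show "AE x in lborel. (\<lambda>k. q k x) \<longlonglongrightarrow> partial_deriv i f x"
    proof (rule AE_I2)
      fix x
      have "((\<lambda>t. f (x + t *\<^sub>R ?e)) has_real_derivative partial_deriv i f x) (at 0)"
        using line_derivative[where t=0 and i=i, of f x] f by simp
      then have "((\<lambda>t. (f (x + t *\<^sub>R ?e) - f x) / t) \<longlongrightarrow> partial_deriv i f x) (at 0)"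
        by (simp add: has_field_derivative_iff)
      moreover have "filterlim h (at 0) sequentially"
        using h0 h(1) by (simp add: filterlim_at less_imp_neq[symmetric])
      ultimately show "(\<lambda>k. q k x) \<longlonglongrightarrow> partial_deriv i f x"
        unfolding q_def by (rule filterlim_compose)
    qed
    show "AE x in lborel. norm (q k x) \<le> indicator (cball 0 (R + 1)) x *\<^sub>R M" for k
    proof (rule AE_I2)
      fix x
      obtain z where "f (x + h k *\<^sub>R ?e) - f (x + 0 *\<^sub>R ?e) = (h k - 0) * partial_deriv i f (x + z *\<^sub>R ?e)"
        using MVT2[OF h(1)[of k], of "\<lambda>t. f (x + t *\<^sub>R ?e)" "\<lambda>t. partial_deriv i f (x + t *\<^sub>R ?e)"]
          line_derivative f by blast
      then have "q k x = partial_deriv i f (x + z *\<^sub>R ?e)" using h(1)[of k] by (simp add: q_def)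
      then have 1: "\<bar>q k x\<bar> \<le> M" using M by simp
      have 2: "q k x = 0" if "norm x > R + 1"
      proof -
        have "norm (x + h k *\<^sub>R ?e) \<ge> norm x - norm (h k *\<^sub>R ?e)" by (metis norm_diff_ineq)
        then have "norm (x + h k *\<^sub>R ?e) > R" using that h[of k] by simp
        then have "f (x + h k *\<^sub>R ?e) = 0" "f x = 0"
          using R that by (force intro: not_in_support)+
        then show ?thesis by (simp add: q_def)
      qed
      show "norm (q k x) \<le> indicator (cball 0 (R + 1)) x *\<^sub>R M"
        using 1 2 by (auto simp: indicator_def)
    qed
  qed
  moreover have "(LINT x|lborel. q k x) = 0" for k
    using shift[of "h k *\<^sub>R ?e"] intf by (simp add: q_def)
  ultimately show ?thesis by (simp add: LIMSEQ_const_iff)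
qed

lemma test_integration_by_parts:
  assumes f: "f \<in> test_functions U" and g: "g \<in> test_functions V"
  shows "(LINT x|lborel. partial_deriv i f x * g x) = - (LINT x|lborel. f x * partial_deriv i g x)"
proof -
  note fg = test_mult[OF f g]
  have "(LINT x|lborel. partial_deriv i (\<lambda>x. f x * g x) x) = 0"
    using test_functionsD[OF fg] test_functionsD[OF test_partial[OF fg]]
    by (intro integral_partial_deriv) (auto intro: smooth_imp_differentiable smooth_imp_continuous)
  moreover have "partial_deriv i (\<lambda>x. f x * g x) = (\<lambda>x. f x * partial_deriv i g x + partial_deriv i f x * g x)"
    by (intro ext partial_deriv_mult test_differentiable[OF f] test_differentiable[OF g])
  moreover have "integrable lborel (\<lambda>x. f x * partial_deriv i g x)" "integrable lborel (\<lambda>x. partial_deriv i f x * g x)"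
    using test_integrable test_mult[OF f test_partial[OF g]] test_mult[OF test_partial[OF f] g] by blast+
  ultimately show ?thesis by simp
qed

subsection \<open>Symmetry of second derivatives\<close>

text \<open>Two applications of the mean value theorem. The left-hand side is symmetric in \<open>i\<close> and \<open>j\<close>, which
gives the symmetry of second derivatives in the limit \<open>h \<rightarrow> 0\<close>.\<close>

lemma second_difference:
  fixes f :: "real ^ 'n::finite \<Rightarrow> real"
  assumes f: "continuously_differentiable 2 f" and "h > 0"
  shows "\<exists>s t. 0 < s \<and> s < h \<and> 0 < t \<and> t < h \<and>
    f (x + h *\<^sub>R axis i 1 + h *\<^sub>R axis j 1) - f (x + h *\<^sub>R axis i 1) - f (x + h *\<^sub>R axis j 1) + f x
      = h * h * partial_deriv j (partial_deriv i f) (x + s *\<^sub>R axis i 1 + t *\<^sub>R axis j 1)"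
proof -
  let ?i = "axis i 1 :: real ^ 'n" and ?j = "axis j 1 :: real ^ 'n"
  have d1: "f differentiable at x" and d2: "partial_deriv i f differentiable at x" for x
    using f by (auto simp: numeral_2_eq_2 differentiable_on_def)
  have "((\<lambda>t. f ((x + h *\<^sub>R ?j) + t *\<^sub>R ?i) - f (x + t *\<^sub>R ?i)) has_real_derivative
    partial_deriv i f ((x + h *\<^sub>R ?j) + t *\<^sub>R ?i) - partial_deriv i f (x + t *\<^sub>R ?i)) (at t)" for t
    by (intro DERIV_diff line_derivative d1)
  from MVT2[OF \<open>h > 0\<close> this] obtain s where s: "0 < s" "s < h"
    "f ((x + h *\<^sub>R ?j) + h *\<^sub>R ?i) - f (x + h *\<^sub>R ?i) - (f (x + h *\<^sub>R ?j) - f x)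
      = h * (partial_deriv i f ((x + h *\<^sub>R ?j) + s *\<^sub>R ?i) - partial_deriv i f (x + s *\<^sub>R ?i))"
    by auto
  have "((\<lambda>t. partial_deriv i f ((x + s *\<^sub>R ?i) + t *\<^sub>R ?j)) has_real_derivative
     partial_deriv j (partial_deriv i f) ((x + s *\<^sub>R ?i) + t *\<^sub>R ?j)) (at t)" for t
    by (intro line_derivative d2)
  from MVT2[OF \<open>h > 0\<close> this] obtain t where t: "0 < t" "t < h"
    "partial_deriv i f ((x + s *\<^sub>R ?i) + h *\<^sub>R ?j) - partial_deriv i f (x + s *\<^sub>R ?i)
      = h * partial_deriv j (partial_deriv i f) ((x + s *\<^sub>R ?i) + t *\<^sub>R ?j)"
    by auto
  have "x + h *\<^sub>R ?j + s *\<^sub>R ?i = (x + s *\<^sub>R ?i) + h *\<^sub>R ?j" "x + h *\<^sub>R ?j + h *\<^sub>R ?i = x + h *\<^sub>R ?i + h *\<^sub>R ?j"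
    by (simp_all add: algebra_simps)
  with s t show ?thesis by (intro exI[of _ s] exI[of _ t]) (simp add: algebra_simps)
qed

lemma partial_deriv_commute:
  fixes f :: "real ^ 'n::finite \<Rightarrow> real"
  assumes f: "continuously_differentiable 2 f"
  shows "partial_deriv i (partial_deriv j f) x = partial_deriv j (partial_deriv i f) x"
proof -
  define a where "a = partial_deriv i (partial_deriv j f)"
  define b where "b = partial_deriv j (partial_deriv i f)"
  have cont: "continuous_on UNIV a" "continuous_on UNIV b"
    using f by (auto simp: numeral_2_eq_2 a_def b_def)
  have "\<bar>a x - b x\<bar> \<le> e" if "e > 0" for e
  proof -
    obtain d1 where d1: "d1 > 0" "\<And>y. dist y x < d1 \<Longrightarrow> dist (a y) (a x) < e / 2"
      using cont(1) \<open>e > 0\<close> unfolding continuous_on_iff by (metis UNIV_I half_gt_zero)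
    obtain d2 where d2: "d2 > 0" "\<And>y. dist y x < d2 \<Longrightarrow> dist (b y) (b x) < e / 2"
      using cont(2) \<open>e > 0\<close> unfolding continuous_on_iff by (metis UNIV_I half_gt_zero)
    define h where "h = min d1 d2 / 2"
    have h: "h > 0" "2 * h \<le> d1" "2 * h \<le> d2" using d1(1) d2(1) by (auto simp: h_def)
    have near: "dist (x + s *\<^sub>R axis k 1 + t *\<^sub>R axis l 1) x < 2 * h"
      if "0 < s" "s < h" "0 < t" "t < h" for s t and k l :: 'n
    proof -
      have "norm (s *\<^sub>R axis k 1 + t *\<^sub>R axis l 1 :: real ^ 'n) \<le> norm (s *\<^sub>R axis k 1 :: real ^ 'n) + norm (t *\<^sub>R axis l 1 :: real ^ 'n)"
        by (rule norm_triangle_ineq)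
      then show ?thesis using that by (simp add: dist_norm add.assoc)
    qed
    obtain s t where st: "0 < s" "s < h" "0 < t" "t < h"
      "f (x + h *\<^sub>R axis j 1 + h *\<^sub>R axis i 1) - f (x + h *\<^sub>R axis j 1) - f (x + h *\<^sub>R axis i 1) + f x
        = h * h * a (x + s *\<^sub>R axis j 1 + t *\<^sub>R axis i 1)"
      using second_difference[OF f h(1), of x j i] unfolding a_def by blast
    obtain s' t' where st': "0 < s'" "s' < h" "0 < t'" "t' < h"
      "f (x + h *\<^sub>R axis i 1 + h *\<^sub>R axis j 1) - f (x + h *\<^sub>R axis i 1) - f (x + h *\<^sub>R axis j 1) + f x
        = h * h * b (x + s' *\<^sub>R axis i 1 + t' *\<^sub>R axis j 1)"
      using second_difference[OF f h(1), of x i j] unfolding b_def by blast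
    have "x + h *\<^sub>R axis j 1 + h *\<^sub>R axis i 1 = x + h *\<^sub>R axis i 1 + h *\<^sub>R axis j 1" by (simp add: algebra_simps)
    with st(5) st'(5) have "h * h * a (x + s *\<^sub>R axis j 1 + t *\<^sub>R axis i 1)
        = h * h * b (x + s' *\<^sub>R axis i 1 + t' *\<^sub>R axis j 1)" by (simp only:)
    then have eq: "a (x + s *\<^sub>R axis j 1 + t *\<^sub>R axis i 1) = b (x + s' *\<^sub>R axis i 1 + t' *\<^sub>R axis j 1)"
      using h(1) by simp
    have "dist (a (x + s *\<^sub>R axis j 1 + t *\<^sub>R axis i 1)) (a x) < e / 2"
      using near[OF st(1-4), of j i] h by (intro d1(2)) linarith
    moreover have "dist (b (x + s' *\<^sub>R axis i 1 + t' *\<^sub>R axis j 1)) (b x) < e / 2"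
      using near[OF st'(1-4), of i j] h by (intro d2(2)) linarith
    ultimately show ?thesis using eq unfolding dist_real_def by linarith
  qed
  then have "\<bar>a x - b x\<bar> \<le> 0" by (rule field_le_epsilon) simp
  then show ?thesis by (simp add: a_def b_def)
qed

section \<open>Polar calculus on test functions\<close>

text \<open>A type of its own for the smooth functions with compact support off the origin makes the operator
calculus apply to a real vector space, without carrier sets.\<close>

typedef (overloaded) ('n::finite) punctured = "test_functions (- {0}) :: (real ^ 'n \<Rightarrow> real) set"
  using test_zero by auto

setup_lifting type_definition_punctured

instantiation punctured :: (finite) real_vector
begin

lift_definition zero_punctured :: "'a punctured" is "\<lambda>x. 0" by (rule test_zero)
lift_definition plus_punctured :: "'a punctured \<Rightarrow> 'a punctured \<Rightarrow> 'a punctured"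
  is "\<lambda>f g x. f x + g x" by (rule test_add)
lift_definition minus_punctured :: "'a punctured \<Rightarrow> 'a punctured \<Rightarrow> 'a punctured"
  is "\<lambda>f g x. f x - g x" by (rule test_diff)
lift_definition uminus_punctured :: "'a punctured \<Rightarrow> 'a punctured"
  is "\<lambda>f x. - f x" using test_scale[where c = "-1"] by auto
lift_definition scaleR_punctured :: "real \<Rightarrow> 'a punctured \<Rightarrow> 'a punctured"
  is "\<lambda>c f x. c * f x" by (rule test_scale)

instance
  by standard (transfer, simp add: fun_eq_iff algebra_simps)+

end

lemma Rep_punctured_sum:
  "Rep_punctured (\<Sum>i\<in>I. f i) x = (\<Sum>i\<in>I. Rep_punctured (f i) x)"
  by (induction I rule: infinite_finite_induct) (simp_all add: zero_punctured.rep_eq plus_punctured.rep_eq)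

lift_definition radial_partial :: "'n::finite \<Rightarrow> 'n punctured \<Rightarrow> 'n punctured"
  is "\<lambda>i f x. norm x * partial_deriv i f x"
  by (intro test_mult_norm test_partial) auto

lift_definition direction_mult :: "'n::finite \<Rightarrow> 'n punctured \<Rightarrow> 'n punctured"
  is "\<lambda>i f x. x $ i * f x / norm x"
proof -
  fix i and f :: "real ^ 'n \<Rightarrow> real" assume "f \<in> test_functions (- {0})"
  from test_div_norm[OF test_coord[OF this, of i], where m = 1] show "(\<lambda>x. x $ i * f x / norm x) \<in> test_functions (- {0})"
    by simp
qed

lift_definition weighted_inner :: "'n::finite punctured \<Rightarrow> 'n punctured \<Rightarrow> real"
  is "\<lambda>f g. LINT x|lborel. f x * g x / norm x ^ 4" .

lemma punctured_eqI: "(\<And>x. Rep_punctured f x = Rep_punctured g x) \<Longrightarrow> f = g"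
  by (rule Rep_punctured_inject[THEN iffD1], rule ext)

lemma differentiable_Rep: "Rep_punctured f differentiable at x"
  by (rule smooth_imp_differentiable[OF test_functionsD(1)[OF Rep_punctured]])

lemma weighted_integrable:
  assumes "f \<in> test_functions (- {0})" "g \<in> test_functions (- {0})"
  shows "integrable lborel (\<lambda>x. f x * g x / norm x ^ m)"
  by (rule test_integrable[OF test_div_norm[OF test_mult[OF assms]]]) simp

lemma test_at_zero: "f \<in> test_functions (- {0}) \<Longrightarrow> f 0 = 0"
  using not_in_support[of 0 f] test_functionsD(3)[of f "- {0}"] by blast

lemma partial_deriv_scale:
  "f differentiable at x \<Longrightarrow> partial_deriv i (\<lambda>x. c * f x) x = c * partial_deriv i f x"
  by (subst partial_deriv_mult) (auto simp: partial_deriv_const)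

lemma partial_deriv_coord_mult:
  "f differentiable at x \<Longrightarrow> partial_deriv i (\<lambda>x. x $ j * f x) x
    = (if i = j then f x else 0) + x $ j * partial_deriv i f x"
  by (subst partial_deriv_mult)
    (auto simp: partial_deriv_coord smooth_imp_differentiable continuously_differentiable_coord)

lemma partial_deriv_norm_mult:
  fixes f :: "real ^ 'n::finite \<Rightarrow> real"
  assumes f: "f \<in> test_functions (- {0})"
  shows "partial_deriv i (\<lambda>x. norm x * f x) x = x $ i * f x / norm x + norm x * partial_deriv i f x"
proof -
  have "((\<lambda>x. f x * norm x) has_derivative
    (\<lambda>h. f x * (h \<bullet> sgn x) + frechet_derivative f (at x) h * norm x)) (at x)"
    using test_functionsD(3)[OF f]
    by (intro has_derivative_mult_supported has_derivative_norm test_differentiable[OF f]) auto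
  from partial_deriv_eqI[OF this, of i]
  have "partial_deriv i (\<lambda>x. f x * norm x) x = f x * (axis i 1 \<bullet> sgn x) + partial_deriv i f x * norm x"
    by (simp add: partial_deriv_def)
  moreover have "axis i 1 \<bullet> sgn x = x $ i / norm x"
    by (simp add: inner_axis' sgn_div_norm divide_inverse)
  moreover have "(\<lambda>x. norm x * f x) = (\<lambda>x. f x * norm x)" by (simp add: mult.commute)
  ultimately show ?thesis by simp
qed

interpretation polar: polar_calculus "radial_partial :: 'n::finite \<Rightarrow> 'n punctured \<Rightarrow> 'n punctured"
  direction_mult weighted_inner "real CARD('n)"
proof (rule polar_calculus.intro)
  fix i j :: 'n and f g :: "'n punctured"
  show "linear (radial_partial i :: 'n punctured \<Rightarrow> 'n punctured)"
    by (rule linearI; rule punctured_eqI)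
      (simp_all only: radial_partial.rep_eq plus_punctured.rep_eq scaleR_punctured.rep_eq
        partial_deriv_add[OF differentiable_Rep differentiable_Rep] partial_deriv_scale[OF differentiable_Rep]
        distrib_left mult.left_commute)
  show "linear (direction_mult i :: 'n punctured \<Rightarrow> 'n punctured)"
    by (rule linearI; rule punctured_eqI)
      (simp_all add: direction_mult.rep_eq plus_punctured.rep_eq scaleR_punctured.rep_eq
        distrib_left add_divide_distrib)
  show "radial_partial i (direction_mult j f) = (if i = j then f else 0) - direction_mult i (direction_mult j f)
    + direction_mult j (radial_partial i f)"
  proof (transfer, rule ext)
    fix i j and f :: "real ^ 'n \<Rightarrow> real" and x :: "real ^ 'n" assume f: "f \<in> test_functions (- {0})"
    have eq: "partial_deriv i (\<lambda>x. x $ j * f x / norm x) x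
      = ((if i = j then f x else 0) + x $ j * partial_deriv i f x) / norm x - x $ i * (x $ j * f x) / norm x ^ 3"
      using test_div_norm_derivative(2)[OF test_coord[OF f, of j], where i = i and m = 1 and x = x]
      by (simp add: partial_deriv_coord_mult[OF test_differentiable[OF f]] numeral_3_eq_3)
    show "norm x * partial_deriv i (\<lambda>x. x $ j * f x / norm x) x
      = (if i = j then f else (\<lambda>x. 0)) x - x $ i * (x $ j * f x / norm x) / norm x
        + x $ j * (norm x * partial_deriv i f x) / norm x"
      unfolding eq using test_at_zero[OF f]
      by (cases "x = 0") (auto simp: field_simps power3_eq_cube)
  qed
  show "direction_mult i (direction_mult j f) = direction_mult j (direction_mult i f)"
    by (rule punctured_eqI) (simp add: direction_mult.rep_eq)
  show "(\<Sum>i\<in>UNIV. direction_mult i (direction_mult i f)) = f"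
  proof (rule punctured_eqI)
    fix x
    have "(\<Sum>i\<in>UNIV. x $ i * (x $ i * Rep_punctured f x / norm x) / norm x)
      = (\<Sum>i\<in>UNIV. x $ i * x $ i) * (Rep_punctured f x / (norm x)\<^sup>2)"
      unfolding sum_distrib_right by (intro sum.cong refl) (simp add: power2_eq_square)
    also have "(\<Sum>i\<in>UNIV. x $ i * x $ i) = (norm x)\<^sup>2" by (simp add: power2_norm_eq_inner inner_vec_def)
    finally show "Rep_punctured (\<Sum>i\<in>UNIV. direction_mult i (direction_mult i f)) x = Rep_punctured f x"
      using test_at_zero[OF Rep_punctured, of f]
      by (cases "x = 0") (auto simp: Rep_punctured_sum direction_mult.rep_eq)
  qed
  show "radial_partial i (radial_partial j f) - radial_partial j (radial_partial i f)
      = direction_mult i (radial_partial j f) - direction_mult j (radial_partial i f)"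
  proof (transfer, rule ext)
    fix i j and f :: "real ^ 'n \<Rightarrow> real" and x :: "real ^ 'n" assume f: "f \<in> test_functions (- {0})"
    have "continuously_differentiable 2 f" using test_functionsD(1)[OF f] by blast
    from partial_deriv_commute[OF this, of i j x]
    show "norm x * partial_deriv i (\<lambda>x. norm x * partial_deriv j f x) x
        - norm x * partial_deriv j (\<lambda>x. norm x * partial_deriv i f x) x
        = x $ i * (norm x * partial_deriv j f x) / norm x - x $ j * (norm x * partial_deriv i f x) / norm x"
      by (simp add: partial_deriv_norm_mult test_partial[OF f] algebra_simps)
  qed
  show "bilinear (weighted_inner :: 'n punctured \<Rightarrow> 'n punctured \<Rightarrow> real)"
  proof -
    have "linear (weighted_inner f)" for f :: "'n punctured"
    proof (rule linearI)
      fix g h :: "'n punctured" and c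
      have i: "integrable lborel (\<lambda>x. Rep_punctured f x * Rep_punctured g x / norm x ^ 4)" for g
        by (intro weighted_integrable Rep_punctured)
      show "weighted_inner f (g + h) = weighted_inner f g + weighted_inner f h"
        using i[of g] i[of h] by (simp add: weighted_inner.rep_eq plus_punctured.rep_eq distrib_left add_divide_distrib)
      have "Rep_punctured f x * (c * Rep_punctured g x) / norm x ^ 4 = c * (Rep_punctured f x * Rep_punctured g x / norm x ^ 4)" for x
        by simp
      then show "weighted_inner f (c *\<^sub>R g) = c *\<^sub>R weighted_inner f g"
        by (simp only: weighted_inner.rep_eq scaleR_punctured.rep_eq integral_mult_right_zero real_scaleR_def)
    qed
    moreover have "weighted_inner f g = weighted_inner g f" for f g :: "'n punctured"
      by (simp add: weighted_inner.rep_eq mult.commute)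
    ultimately show ?thesis unfolding bilinear_def by simp
  qed
  show "weighted_inner f g = weighted_inner g f" by (simp add: weighted_inner.rep_eq mult.commute)
  show "0 \<le> weighted_inner f f" by (simp add: weighted_inner.rep_eq)
  show "weighted_inner (direction_mult i f) g = weighted_inner f (direction_mult i g)"
    by (simp add: weighted_inner.rep_eq direction_mult.rep_eq mult_ac)
  show "weighted_inner (radial_partial i f) g
    = - weighted_inner f (radial_partial i g) + 3 * weighted_inner f (direction_mult i g)"
  proof transfer
    fix i and f g :: "real ^ 'n \<Rightarrow> real" assume f: "f \<in> test_functions (- {0})" and g: "g \<in> test_functions (- {0})"
    note fg = test_mult[OF f g]
    have k: "(\<lambda>x. f x * g x / norm x ^ 3) \<in> test_functions (- {0})"
      by (rule test_div_norm[OF fg]) simp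
    have eq: "partial_deriv i (\<lambda>x. f x * g x / norm x ^ 3) x
      = norm x * partial_deriv i f x * g x / norm x ^ 4 + f x * (norm x * partial_deriv i g x) / norm x ^ 4
        - 3 * (f x * (x $ i * g x / norm x) / norm x ^ 4)" for x
      using test_at_zero[OF f] test_at_zero[OF test_partial[OF f]]
      by (subst test_div_norm_derivative(2)[OF fg], subst partial_deriv_mult)
        (auto simp: test_differentiable[OF f] test_differentiable[OF g] field_simps power_numeral_reduce)
    define A B C where "A = (\<lambda>x. norm x * partial_deriv i f x * g x / norm x ^ 4)"
      and "B = (\<lambda>x. f x * (norm x * partial_deriv i g x) / norm x ^ 4)"
      and "C = (\<lambda>x. f x * (x $ i * g x / norm x) / norm x ^ 4)"
    have "(LINT x|lborel. partial_deriv i (\<lambda>x. f x * g x / norm x ^ 3) x) = 0"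
      using test_functionsD[OF k] test_functionsD[OF test_partial[OF k]]
      by (intro integral_partial_deriv smooth_imp_differentiable smooth_imp_continuous) auto
    then have 0: "(LINT x|lborel. A x + B x - 3 * C x) = 0"
      unfolding eq A_def B_def C_def .
    have "(\<lambda>x. x $ i * g x / norm x) \<in> test_functions (- {0})"
      using test_div_norm[OF test_coord[OF g, of i], where m = 1] by simp
    then have "integrable lborel A" "integrable lborel B" "integrable lborel C"
      unfolding A_def B_def C_def by (intro weighted_integrable test_mult_norm test_partial f g; simp)+
    with 0 have "integral\<^sup>L lborel A = - integral\<^sup>L lborel B + 3 * integral\<^sup>L lborel C"
      by simp
    then show "(LINT x|lborel. norm x * partial_deriv i f x * g x / norm x ^ 4) =
       - (LINT x|lborel. f x * (norm x * partial_deriv i g x) / norm x ^ 4)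
       + 3 * (LINT x|lborel. f x * (x $ i * g x / norm x) / norm x ^ 4)"
      unfolding A_def B_def C_def .
  qed
qed simp

lemma polar_E: "Rep_punctured (polar.E f) x = (\<Sum>i\<in>UNIV. x $ i * partial_deriv i (Rep_punctured f) x)"
  by (cases "x = 0") (simp_all add: polar.E_def Rep_punctured_sum direction_mult.rep_eq radial_partial.rep_eq)

lemma polar_lap:
  "Rep_punctured (polar.lap f) x
    = (norm x)\<^sup>2 * (\<Sum>i\<in>UNIV. partial_deriv i (partial_deriv i (Rep_punctured f)) x)"
proof (cases "x = 0")
  case True
  then show ?thesis using test_at_zero[OF Rep_punctured] by simp
next
  case False
  have "Rep_punctured (radial_partial i (radial_partial i f)) x
     = x $ i * partial_deriv i (Rep_punctured f) x + (norm x)\<^sup>2 * partial_deriv i (partial_deriv i (Rep_punctured f)) x" for i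
    using False by (simp add: radial_partial.rep_eq partial_deriv_norm_mult test_partial[OF Rep_punctured]
      field_simps power2_eq_square)
  then show ?thesis
    by (simp add: polar.lap_def minus_punctured.rep_eq Rep_punctured_sum polar_E sum.distrib sum_distrib_left)
qed

section \<open>The radial Poincare inequality\<close>

text \<open>The divergence theorem for the vector field \<open>g(x) \<rho>(\<bar>x\<bar>) x\<close>, whose divergence is the integrand.\<close>

lemma integral_radial_divergence:
  fixes g :: "real ^ 'n::finite \<Rightarrow> real"
  assumes g: "g \<in> test_functions U" and U: "open U" "0 \<notin> U"
    and \<rho>: "\<And>x. x \<in> U \<Longrightarrow> (\<rho> has_real_derivative \<rho>' (norm x)) (at (norm x))"
    and \<rho>': "continuous_on U (\<lambda>x. \<rho>' (norm x))"
  defines "F \<equiv> \<lambda>x. (\<Sum>i\<in>UNIV. x $ i * partial_deriv i g x) * \<rho> (norm x)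
      + g x * (real CARD('n) * \<rho> (norm x) + norm x * \<rho>' (norm x))"
  shows "integrable lborel F" "integral\<^sup>L lborel F = 0"
proof -
  note supp = test_functionsD(2,3)[OF g]
  have cont_\<rho>: "continuous_on U (\<lambda>x. \<rho> (norm x))"
  proof (rule continuous_at_imp_continuous_on, rule ballI)
    fix x assume "x \<in> U"
    show "isCont (\<lambda>x. \<rho> (norm x)) x"
      by (rule isCont_o2[where f = norm and g = \<rho>, OF _ DERIV_isCont[OF \<rho>[OF \<open>x \<in> U\<close>]]]) (intro continuous_intros)
  qed
  define w w' where "w i x = x $ i * \<rho> (norm x)"
    and "w' i x h = x $ i * (\<rho>' (norm x) * (h \<bullet> sgn x)) + h $ i * \<rho> (norm x)" for i :: 'n and x h :: "real ^ 'n"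
  have w: "(w i has_derivative w' i x) (at x)" if "x \<in> U" for i x
  proof -
    have "x \<noteq> 0" using that U by auto
    have 1: "((\<lambda>x. x $ i) has_derivative (\<lambda>h. h $ i)) (at x)"
      by (rule bounded_linear.has_derivative[OF bounded_linear_vec_nth]) (rule has_derivative_ident)
    have 2: "((\<lambda>x. \<rho> (norm x)) has_derivative (\<lambda>h. \<rho>' (norm x) * (h \<bullet> sgn x))) (at x)"
      using has_derivative_compose[OF has_derivative_norm[OF \<open>x \<noteq> 0\<close>] \<rho>[OF that, unfolded has_field_derivative_def]] .
    show ?thesis using has_derivative_mult[OF 1 2] by (simp add: w_def[abs_def] w'_def[abs_def])
  qed
  have gw: "((\<lambda>x. g x * w i x) has_derivative (\<lambda>h. g x * w' i x h + frechet_derivative g (at x) h * w i x)) (at x)" for i x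
    using supp(2) by (intro has_derivative_mult_supported w test_differentiable[OF g]) auto
  have pd: "partial_deriv i (\<lambda>x. g x * w i x) = (\<lambda>x. g x * w' i x (axis i 1) + partial_deriv i g x * w i x)" for i
    by (rule ext, subst partial_deriv_eqI[OF gw]) (simp add: partial_deriv_def)
  have cont_w: "continuous_on U (w i)" for i
    unfolding w_def by (intro continuous_intros cont_\<rho>)
  have cont_w': "continuous_on U (\<lambda>x. w' i x (axis i 1))" for i
    unfolding w'_def sgn_div_norm using U(2) by (intro continuous_intros cont_\<rho> \<rho>') auto
  have cg: "continuous_on UNIV g" "continuous_on UNIV (partial_deriv i g)" for i
    using test_functionsD(1)[OF g] test_functionsD(1)[OF test_partial[OF g]] smooth_imp_continuous by blast+
  have sp: "support (partial_deriv i g) \<subseteq> U" for i using support_partial_deriv[of i g] supp(2) by blast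
  have cont: "continuous_on UNIV (partial_deriv i (\<lambda>x. g x * w i x))" for i
    unfolding pd by (intro continuous_on_add continuous_on_mult_supported[OF cg(1) cont_w' U(1) supp(2)]
      continuous_on_mult_supported[OF cg(2) cont_w U(1) sp])
  have comp: "compact (support (\<lambda>x. g x * w i x))" for i
    using supp(1) support_subset_imp[of g "\<lambda>x. g x * w i x"]
    by (metis closed_support compact_Int_closed inf.absorb_iff2 mult_zero_left)
  have comp': "compact (support (partial_deriv i (\<lambda>x. g x * w i x)))" for i
    using comp[of i] support_partial_deriv[of i "\<lambda>x. g x * w i x"] by (metis closed_support compact_Int_closed inf.absorb_iff2)
  have int: "integrable lborel (partial_deriv i (\<lambda>x. g x * w i x))" for i
    by (rule integrable_compact_support[OF cont comp'])
  have zero: "(LINT x|lborel. partial_deriv i (\<lambda>x. g x * w i x) x) = 0" for i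
    using gw by (intro integral_partial_deriv cont comp) (auto simp: differentiable_def)
  have F: "F = (\<lambda>x. \<Sum>i\<in>UNIV. partial_deriv i (\<lambda>x. g x * w i x) x)"
  proof
    fix x
    have "(\<Sum>i\<in>UNIV. w' i x (axis i 1)) = real CARD('n) * \<rho> (norm x) + norm x * \<rho>' (norm x)"
    proof -
      have "(\<Sum>i\<in>UNIV. w' i x (axis i 1)) = (\<Sum>i\<in>UNIV. x $ i * x $ i) * (\<rho>' (norm x) / norm x)
         + real CARD('n) * \<rho> (norm x)"
        by (simp add: w'_def sum.distrib inner_axis' sgn_div_norm sum_distrib_left divide_inverse mult_ac)
      also have "(\<Sum>i\<in>UNIV. x $ i * x $ i) = norm x * norm x"
        using power2_norm_eq_inner[of x] by (simp add: inner_vec_def power2_eq_square)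
      finally show ?thesis by (cases "x = 0") auto
    qed
    then have 1: "(\<Sum>i\<in>UNIV. g x * w' i x (axis i 1)) = g x * (real CARD('n) * \<rho> (norm x) + norm x * \<rho>' (norm x))"
      by (simp flip: sum_distrib_left)
    have 2: "(\<Sum>i\<in>UNIV. partial_deriv i g x * w i x) = (\<Sum>i\<in>UNIV. x $ i * partial_deriv i g x) * \<rho> (norm x)"
      unfolding w_def sum_distrib_right by (intro sum.cong refl) (simp add: mult_ac)
    show "F x = (\<Sum>i\<in>UNIV. partial_deriv i (\<lambda>x. g x * w i x) x)"
      unfolding pd F_def sum.distrib 1 2 by simp
  qed
  show "integrable lborel F" unfolding F by (rule Bochner_Integration.integrable_sum[OF int])
  show "integral\<^sup>L lborel F = 0" unfolding F by (simp add: Bochner_Integration.integral_sum[OF int] zero)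
qed

lemma open_annulus: "open (annulus a b)"
  by (simp add: annulus_def open_Diff)

lemma annulus_iff: "x \<in> annulus a b \<longleftrightarrow> a < norm x \<and> norm x < b"
  by (auto simp: annulus_def)

text \<open>With \<open>\<kappa> = \<pi> / log (b/a)\<close>, the ground state \<open>sin (\<kappa> log (r/a))\<close> of the interval has logarithmic derivative
\<open>\<theta> = \<kappa> cot (\<kappa> log (r/a))\<close>, which is finite on the open annulus and satisfies the Riccati equation
\<open>r \<theta>' = - (\<kappa>\<^sup>2 + \<theta>\<^sup>2)\<close>. Therefore \<open>(T f - \<theta> f)\<^sup>2 \<ge> 0\<close> differs from \<open>(T f)\<^sup>2 - \<kappa>\<^sup>2 f\<^sup>2\<close> by a divergence only. The
constant is sharp, which is essential for the constants of the theorem.\<close>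

lemma radial_Poincare:
  fixes f :: "'n::finite punctured"
  assumes ab: "0 < a" "a < b" and f: "Rep_punctured f \<in> test_functions (annulus a b)"
  shows "(pi\<^sup>2 / (ln (b / a))\<^sup>2) * weighted_inner f f \<le> weighted_inner (polar.T f) (polar.T f)"
proof -
  define U :: "(real ^ 'n) set" where "U = annulus a b"
  define \<kappa> where "\<kappa> = pi / ln (b / a)"
  define \<theta> where "\<theta> r = \<kappa> * cot (\<kappa> * ln (r / a))" for r
  define \<rho> \<rho>' where "\<rho> r = \<theta> r / r ^ 4" and "\<rho>' r = (- (\<kappa>\<^sup>2 + (\<theta> r)\<^sup>2) - 4 * \<theta> r) / r ^ 5" for r
  let ?f = "Rep_punctured f" and ?N = "real CARD('n)"
  define Ef where "Ef x = (\<Sum>i\<in>UNIV. x $ i * partial_deriv i ?f x)" for x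
  have U: "open U" "0 \<notin> U" using ab by (auto simp: U_def open_annulus annulus_iff)
  have L: "ln (b / a) > 0" using ab by simp
  have tf: "?f \<in> test_functions U" using f by (simp add: U_def)
  have sin: "sin (\<kappa> * ln (r / a)) \<noteq> 0" if "a < r" "r < b" for r
  proof -
    have "0 < ln (r / a)" "ln (r / a) < ln (b / a)" using that ab by (auto simp: divide_strict_right_mono)
    then have "0 < \<kappa> * ln (r / a)" "\<kappa> * ln (r / a) < pi" using L by (auto simp: \<kappa>_def field_simps)
    then show ?thesis using sin_gt_zero by force
  qed
  have d\<rho>: "(\<rho> has_real_derivative \<rho>' r) (at r)" if r: "a < r" "r < b" for r
  proof -
    have "r > 0" using r ab by simp
    have s: "1 / (sin (\<kappa> * ln (r / a)))\<^sup>2 = 1 + (cot (\<kappa> * ln (r / a)))\<^sup>2"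
      using sin[OF r] sin_cos_squared_add[of "\<kappa> * ln (r / a)"] by (simp add: cot_def field_simps)
    have "(\<theta> has_real_derivative \<kappa> * (- inverse ((sin (\<kappa> * ln (r / a)))\<^sup>2) * (\<kappa> * (1 / r)))) (at r)"
      unfolding \<theta>_def[abs_def]
    proof (intro DERIV_cmult DERIV_chain2[of cot _ "\<lambda>r. \<kappa> * ln (r / a)"] DERIV_cot sin r)
      show "((\<lambda>r. ln (r / a)) has_real_derivative 1 / r) (at r)"
        using \<open>r > 0\<close> ab by (auto intro!: derivative_eq_intros simp: field_simps)
    qed
    also have "\<kappa> * (- inverse ((sin (\<kappa> * ln (r / a)))\<^sup>2) * (\<kappa> * (1 / r))) = - (\<kappa>\<^sup>2 + (\<theta> r)\<^sup>2) / r"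
      unfolding inverse_eq_divide s using \<open>r > 0\<close> by (simp add: \<theta>_def power2_eq_square field_simps)
    finally have "(\<theta> has_real_derivative - (\<kappa>\<^sup>2 + (\<theta> r)\<^sup>2) / r) (at r)" .
    then show ?thesis unfolding \<rho>_def[abs_def] \<rho>'_def using \<open>r > 0\<close>
      by (auto intro!: derivative_eq_intros simp: field_simps power_numeral_reduce)
  qed
  have cont: "continuous_on U (\<lambda>x. \<rho>' (norm x))"
  proof (rule continuous_at_imp_continuous_on, rule ballI)
    fix x :: "real ^ 'n" assume "x \<in> U"
    then have "a < norm x" "norm x < b" "x \<noteq> 0" using ab by (auto simp: U_def annulus_iff)
    then show "isCont (\<lambda>x. \<rho>' (norm x)) x"
      unfolding \<rho>'_def \<theta>_def using ab sin[of "norm x"]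
      by (intro continuous_intros isCont_cot isCont_o2[where g = cot]) auto
  qed
  define F where "F x = (\<Sum>i\<in>UNIV. x $ i * partial_deriv i (\<lambda>x. ?f x * ?f x) x) * \<rho> (norm x)
      + ?f x * ?f x * (?N * \<rho> (norm x) + norm x * \<rho>' (norm x))" for x
  have F: "integrable lborel F" "integral\<^sup>L lborel F = 0"
    unfolding F_def using integral_radial_divergence[OF test_mult[OF tf tf] U _ cont, of \<rho>] d\<rho>
    by (auto simp: U_def annulus_iff)
  have T: "Rep_punctured (polar.T f) x = Ef x + (?N - 4) / 2 * ?f x" for x
    by (simp add: polar.T_def plus_punctured.rep_eq scaleR_punctured.rep_eq polar_E Ef_def)
  have point: "F x \<le> Rep_punctured (polar.T f) x * Rep_punctured (polar.T f) x / norm x ^ 4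
      - \<kappa>\<^sup>2 * (?f x * ?f x / norm x ^ 4)" for x
  proof (cases "x \<in> support ?f")
    case False
    then show ?thesis by (simp add: F_def T Ef_def not_in_support partial_deriv_off_support
       partial_deriv_mult[OF test_differentiable[OF tf] test_differentiable[OF tf]])
  next
    case True
    then have x: "norm x > 0" using test_functionsD(3)[OF f] ab by (auto simp: annulus_iff)
    have EF: "(\<Sum>i\<in>UNIV. x $ i * partial_deriv i (\<lambda>x. ?f x * ?f x) x) = 2 * ?f x * Ef x"
      by (simp add: Ef_def partial_deriv_mult[OF test_differentiable[OF tf] test_differentiable[OF tf]]
        sum_distrib_left algebra_simps sum.distrib)
    have "0 \<le> (Ef x + (?N - 4) / 2 * ?f x - \<theta> (norm x) * ?f x)\<^sup>2 / norm x ^ 4" by simp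
    also have "\<dots> = Rep_punctured (polar.T f) x * Rep_punctured (polar.T f) x / norm x ^ 4
      - \<kappa>\<^sup>2 * (?f x * ?f x / norm x ^ 4) - F x"
      unfolding F_def EF T \<rho>_def \<rho>'_def using x
      by (simp add: field_simps power_numeral_reduce)
    finally show ?thesis by simp
  qed
  have 1: "integrable lborel (\<lambda>x. Rep_punctured (polar.T f) x * Rep_punctured (polar.T f) x / norm x ^ 4)"
    and 2: "integrable lborel (\<lambda>x. ?f x * ?f x / norm x ^ 4)"
    by (intro weighted_integrable Rep_punctured)+
  note 3 = integrable_mult_right[OF 2, of "\<kappa>\<^sup>2"]
  have "integral\<^sup>L lborel F \<le> (LINT x|lborel. Rep_punctured (polar.T f) x * Rep_punctured (polar.T f) x / norm x ^ 4
      - \<kappa>\<^sup>2 * (?f x * ?f x / norm x ^ 4))"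
    by (intro integral_mono F(1) point Bochner_Integration.integrable_diff 1 3)
  also have "\<dots> = weighted_inner (polar.T f) (polar.T f) - \<kappa>\<^sup>2 * weighted_inner f f"
    unfolding Bochner_Integration.integral_diff[OF 1 3] integral_mult_right_zero weighted_inner.rep_eq ..
  finally show ?thesis by (simp add: F(2) \<kappa>_def power_divide)
qed

lemma test_polar:
  fixes f :: "'n::finite punctured"
  assumes "Rep_punctured f \<in> test_functions U" and U: "0 \<notin> U"
  shows "Rep_punctured (polar.T f) \<in> test_functions U" "Rep_punctured (polar.D i f) \<in> test_functions U"
proof -
  have P: "Rep_punctured (radial_partial i g) \<in> test_functions U"
    and n: "Rep_punctured (direction_mult i g) \<in> test_functions U"
    if "Rep_punctured g \<in> test_functions U" for i and g :: "'n punctured"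
    using test_mult_norm[OF test_partial[OF that] U] test_div_norm[OF test_coord[OF that] U, where m = 1]
    by (simp_all add: radial_partial.rep_eq direction_mult.rep_eq)
  have "Rep_punctured (polar.E f) = (\<lambda>x. \<Sum>i\<in>UNIV. x $ i * partial_deriv i (Rep_punctured f) x)"
    by (rule ext) (rule polar_E)
  then have E: "Rep_punctured (polar.E f) \<in> test_functions U"
    by (simp add: test_sum test_coord test_partial assms)
  show "Rep_punctured (polar.T f) \<in> test_functions U"
    unfolding polar.T_def plus_punctured.rep_eq scaleR_punctured.rep_eq by (intro test_add test_scale E assms)
  show "Rep_punctured (polar.D i f) \<in> test_functions U"
    by (simp add: polar.D_def minus_punctured.rep_eq test_diff P n E assms)
qed

lemma radial_gap_annulus:
  fixes f :: "'n::finite punctured"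
  assumes ab: "0 < a" "a < b" and f: "Rep_punctured f \<in> test_functions (annulus a b)"
  shows "polar.radial_gap (pi\<^sup>2 / (ln (b / a))\<^sup>2) f"
  unfolding polar.radial_gap_def using ab
  by (intro conjI allI radial_Poincare test_polar f) (auto simp: annulus_iff)

section \<open>The fundamental lemma of the calculus of variations\<close>

text \<open>The powers of \<open>t\<close> make the family closed under differentiation, up to linear combinations.\<close>

definition flat_exp :: "nat \<Rightarrow> real \<Rightarrow> real" where
  "flat_exp m t = (if t > 0 then exp (- 1 / t) / t ^ m else 0)"

lemma flat_exp_div: "t \<noteq> 0 \<Longrightarrow> flat_exp m t / t = flat_exp (Suc m) t"
  by (simp add: flat_exp_def)

lemma flat_exp_tendsto_0: "(flat_exp m \<longlongrightarrow> 0) (at 0)"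
proof -
  have "((\<lambda>t. inverse t ^ m / exp (inverse t)) \<longlongrightarrow> (0::real)) (at_right 0)"
    by (rule filterlim_compose[OF tendsto_power_div_exp_0 filterlim_inverse_at_top_right])
  then have "(flat_exp m \<longlongrightarrow> 0) (at_right 0)"
    by (rule Lim_transform_eventually)
      (auto simp: eventually_at_filter flat_exp_def exp_minus field_simps power_inverse)
  moreover have "(flat_exp m \<longlongrightarrow> 0) (at_left 0)"
    by (rule tendsto_eventually) (auto simp: eventually_at_filter flat_exp_def)
  ultimately show ?thesis by (simp add: filterlim_at_split)
qed

lemma flat_exp_derivative:
  "(flat_exp m has_real_derivative flat_exp (m + 2) t - real m * flat_exp (Suc m) t) (at t)"
proof -
  consider "t > 0" | "t = 0" | "t < 0" by linarith
  then show ?thesis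
  proof cases
    case 1
    then have "((\<lambda>t. exp (- 1 / t) / t ^ m) has_real_derivative flat_exp (m + 2) t - real m * flat_exp (Suc m) t) (at t)"
      by (auto intro!: derivative_eq_intros simp: flat_exp_def)
         (cases m; simp add: field_simps power2_eq_square)
    then show ?thesis
      by (rule has_field_derivative_transform_within_open[where S = "{0<..}"]) (use 1 in \<open>auto simp: flat_exp_def\<close>)
  next
    case 2
    have "((\<lambda>s. (flat_exp m s - flat_exp m 0) / (s - 0)) \<longlongrightarrow> 0) (at 0)"
      by (rule Lim_transform_eventually[OF flat_exp_tendsto_0[of "Suc m"]])
        (auto simp: eventually_at_filter flat_exp_div[symmetric], simp add: flat_exp_def)
    then show ?thesis using 2 by (simp add: has_field_derivative_iff flat_exp_def)
  next
    case 3
    have "((\<lambda>t. 0) has_real_derivative 0) (at t)" by simp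
    then have "(flat_exp m has_real_derivative 0) (at t)"
      by (rule has_field_derivative_transform_within_open[where S = "{..<0}"]) (use 3 in \<open>auto simp: flat_exp_def\<close>)
    then show ?thesis using 3 by (simp add: flat_exp_def)
  qed
qed

lemma smooth_flat_exp: "smooth (\<lambda>x::real ^ 'n::finite. flat_exp m (\<alpha> * x $ i + \<beta>))"
proof
  fix k
  show "continuously_differentiable k (\<lambda>x::real ^ 'n. flat_exp m (\<alpha> * x $ i + \<beta>))"
  proof (induction k arbitrary: m)
    have der: "((\<lambda>x::real ^ 'n. flat_exp m (\<alpha> * x $ i + \<beta>)) has_derivative
      (\<lambda>h. (flat_exp (m + 2) (\<alpha> * x $ i + \<beta>) - real m * flat_exp (Suc m) (\<alpha> * x $ i + \<beta>)) * (\<alpha> * h $ i))) (at x)" for m x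
    proof -
      have "((\<lambda>x. x $ i) has_derivative (\<lambda>h. h $ i)) (at x)"
        by (rule bounded_linear.has_derivative[OF bounded_linear_vec_nth]) (rule has_derivative_ident)
      then have "((\<lambda>x. \<alpha> * x $ i + \<beta>) has_derivative (\<lambda>h. \<alpha> * h $ i)) (at x)"
        by (auto intro!: derivative_eq_intros)
      from has_derivative_compose[OF this flat_exp_derivative[of m, unfolded has_field_derivative_def]]
      show ?thesis .
    qed
    have diff: "(\<lambda>x::real ^ 'n. flat_exp m (\<alpha> * x $ i + \<beta>)) differentiable_on UNIV" for m
      unfolding differentiable_on_def differentiable_def using der by blast
    {
      case 0
      show ?case using differentiable_imp_continuous_on[OF diff] by simp
    next
      case (Suc k)
      have "partial_deriv j (\<lambda>x::real ^ 'n. flat_exp m (\<alpha> * x $ i + \<beta>))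
        = (\<lambda>x. (if j = i then \<alpha> else 0) * flat_exp (m + 2) (\<alpha> * x $ i + \<beta>)
            + (if j = i then - \<alpha> * real m else 0) * flat_exp (Suc m) (\<alpha> * x $ i + \<beta>))" for j
        by (rule ext, subst partial_deriv_eqI[OF der]) (auto simp: axis_def algebra_simps)
      moreover have "continuously_differentiable k (\<lambda>x. (if j = i then \<alpha> else 0) * flat_exp (m + 2) (\<alpha> * x $ i + \<beta>)
            + (if j = i then - \<alpha> * real m else 0) * flat_exp (Suc m) (\<alpha> * x $ i + \<beta>))" for j
        by (intro continuously_differentiable_add continuously_differentiable_mult
          continuously_differentiable_const Suc.IH)
      ultimately show ?case using diff by simp
    }
  qed
qed

lemma smooth_prod: "(\<And>i. i \<in> I \<Longrightarrow> smooth (f i)) \<Longrightarrow> smooth (\<lambda>x. \<Prod>i\<in>I. f i x)"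
proof (induction I rule: infinite_finite_induct)
  case (insert i I)
  then show ?case using smooth_mult[of "f i" "\<lambda>x. \<Prod>i\<in>I. f i x"] by simp
qed (simp_all add: continuously_differentiable_const)

text \<open>As \<open>exp (- 1 / (k t)) \<rightarrow> 1\<close> for \<open>t > 0\<close>, the plain rescaling of one bump function approximates the
indicator function of the open box, boundedly and from within.\<close>

definition box_bump :: "real ^ 'n \<Rightarrow> real ^ 'n \<Rightarrow> nat \<Rightarrow> real ^ 'n::finite \<Rightarrow> real" where
  "box_bump c d k x = (\<Prod>i\<in>UNIV. flat_exp 0 (real (Suc k) * x $ i + - real (Suc k) * c $ i) *
     flat_exp 0 (- real (Suc k) * x $ i + real (Suc k) * d $ i))"

lemma flat_exp_0_bounds: "0 \<le> flat_exp 0 t" "flat_exp 0 t \<le> 1"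
  by (simp_all add: flat_exp_def)

lemma box_bump_bounds: "0 \<le> box_bump c d k x" "box_bump c d k x \<le> 1"
  unfolding box_bump_def by (intro prod_nonneg prod_le_1 ballI conjI mult_nonneg_nonneg mult_le_one flat_exp_0_bounds)+

lemma box_bump_outside:
  assumes "x \<notin> box c d" shows "box_bump c d k x = 0"
proof -
  obtain i where "x $ i \<le> c $ i \<or> d $ i \<le> x $ i" using assms by (auto simp: mem_box_cart not_less)
  then have "real (Suc k) * x $ i + - real (Suc k) * c $ i \<le> 0 \<or> - real (Suc k) * x $ i + real (Suc k) * d $ i \<le> 0"
    using mult_left_mono[of "x $ i" "c $ i" "real (Suc k)"] mult_left_mono[of "d $ i" "x $ i" "real (Suc k)"]
    by (simp only: mult_minus_left) linarith
  then have "flat_exp 0 (real (Suc k) * x $ i + - real (Suc k) * c $ i) *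
     flat_exp 0 (- real (Suc k) * x $ i + real (Suc k) * d $ i) = 0"
    by (elim disjE) (simp_all only: flat_exp_def not_less[symmetric] if_False mult_zero_left mult_zero_right)
  then show ?thesis unfolding box_bump_def by (intro prod_zero) auto
qed

lemma box_bump_limit: "(\<lambda>k. box_bump c d k x) \<longlonglongrightarrow> indicator (box c d) x"
proof (cases "x \<in> box c d")
  case True
  have lim: "(\<lambda>k. flat_exp 0 (real (Suc k) * t)) \<longlonglongrightarrow> 1" if "t > 0" for t :: real
  proof -
    have "(\<lambda>k. exp (- (1 / t) * inverse (real (Suc k)))) \<longlonglongrightarrow> exp (- (1 / t) * 0)"
      by (intro tendsto_intros LIMSEQ_inverse_real_of_nat)
    moreover have "flat_exp 0 (real (Suc k) * t) = exp (- (1 / t) * inverse (real (Suc k)))" for k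
      using that by (simp add: flat_exp_def divide_simps)
    ultimately show ?thesis by simp
  qed
  have "(\<lambda>k. box_bump c d k x) \<longlonglongrightarrow> (\<Prod>i\<in>(UNIV::'a set). 1 * 1)"
    unfolding box_bump_def
  proof (intro tendsto_prod tendsto_mult)
    fix i
    have "x $ i - c $ i > 0" "d $ i - x $ i > 0" using True by (auto simp: mem_box_cart)
    from this[THEN lim]
    show "(\<lambda>k. flat_exp 0 (real (Suc k) * x $ i + - real (Suc k) * c $ i)) \<longlonglongrightarrow> 1"
      "(\<lambda>k. flat_exp 0 (- real (Suc k) * x $ i + real (Suc k) * d $ i)) \<longlonglongrightarrow> 1"
      by (simp_all only: right_diff_distrib mult_minus_left minus_mult_commute) (simp_all add: algebra_simps)
  qed
  with True show ?thesis by simp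
qed (simp add: box_bump_outside)

lemma box_bump_test:
  fixes c d :: "real ^ 'n::finite"
  assumes "cbox c d \<subseteq> U"
  shows "box_bump c d k \<in> test_functions U"
proof -
  have "support (box_bump c d k) \<subseteq> cbox c d"
    unfolding support_def
    by (rule closure_minimal) (use box_bump_outside box_subset_cbox[of c d] in force)+
  moreover from this have "compact (support (box_bump c d k))"
    by (metis closed_support compact_cbox compact_Int_closed inf.absorb_iff2)
  moreover have "smooth (box_bump c d k)"
    unfolding box_bump_def[abs_def] by (intro smooth_prod smooth_mult smooth_flat_exp)
  ultimately show ?thesis using assms by (auto simp: test_functions_def support_def)
qed

text \<open>Open boxes form a generator of the Borel sets that is stable under intersection, and the sets on
which the integral of \<open>f\<close> vanishes form a Dynkin system.\<close>

lemma integral_boxes_zero_imp_AE_zero: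
  fixes f :: "real ^ 'n::finite \<Rightarrow> real"
  assumes f: "integrable lborel f" and total: "integral\<^sup>L lborel f = 0"
    and box: "\<And>c d. (LINT x:box c d|lborel. f x) = 0"
  shows "AE x in lborel. f x = 0"
proof (rule sigma_finite_measure.density_zero[OF sigma_finite_lborel f])
  fix A :: "(real ^ 'n) set" assume "A \<in> sets lborel"
  let ?G = "range (\<lambda>(a, b). box a b :: (real ^ 'n) set)"
  have si: "set_integrable lborel B f" if "B \<in> sets lborel" for B
    using integrable_mult_indicator[OF that f] by (simp add: set_integrable_def)
  have meas: "B \<in> sets lborel" if "B \<in> sigma_sets UNIV ?G" for B
    using that by (simp add: borel_eq_box)
  have "Int_stable ?G" by (auto simp: Int_stable_def box_Int_box)
  moreover have "?G \<subseteq> Pow UNIV" by simp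
  moreover have "A \<in> sigma_sets UNIV ?G" using \<open>A \<in> sets lborel\<close> by (simp add: borel_eq_box)
  ultimately show "(LINT x:A|lborel. f x) = 0"
  proof (induction rule: sigma_sets_induct_disjoint)
    case (basic A)
    then show ?case using box by auto
  next
    case empty
    show ?case by (simp add: set_lebesgue_integral_def)
  next
    case (compl A)
    have "(LINT x:A \<union> (UNIV - A)|lborel. f x) = (LINT x:A|lborel. f x) + (LINT x:UNIV - A|lborel. f x)"
      using meas[OF compl(1)] by (intro set_integral_Un si) auto
    then show ?case using compl total by (simp add: set_lebesgue_integral_def)
  next
    case (union A)
    have m: "A i \<in> sets lborel" for i using union(2) meas by blast
    have "(LINT x:(\<Union>i. A i)|lborel. f x) = (\<Sum>i. (LINT x:A i|lborel. f x))"
    proof (rule lebesgue_integral_countable_add[OF m])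
      show "A i \<inter> A j = {}" if "i \<noteq> j" for i j
        using union(1) that unfolding disjoint_family_on_def by blast
      show "set_integrable lborel (\<Union>i. A i) f" by (intro si sets.countable_nat_UN) (use m in blast)
    qed
    then show ?case using union(3) by simp
  qed
qed

lemma test_bounded:
  assumes "\<phi> \<in> test_functions U"
  obtains M where "\<And>x. \<bar>\<phi> x\<bar> \<le> M"
proof -
  note \<phi> = test_functionsD[OF assms]
  have "compact (\<phi> ` support \<phi>)"
    by (intro compact_continuous_image \<phi>(2) continuous_on_subset[OF smooth_imp_continuous[OF \<phi>(1)]]) auto
  then obtain M where M: "\<And>x. x \<in> support \<phi> \<Longrightarrow> \<bar>\<phi> x\<bar> \<le> M"
    using compact_imp_bounded[of "\<phi> ` support \<phi>"] by (auto simp: bounded_iff)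
  show thesis
    by (rule that[of "max M 0"]) (metis M abs_zero not_in_support le_max_iff_disj order_refl)
qed

lemma test_borel_measurable:
  assumes "\<phi> \<in> test_functions U"
  shows "\<phi> \<in> borel_measurable borel" "\<phi> \<in> borel_measurable lebesgue"
proof -
  show 1: "\<phi> \<in> borel_measurable borel"
    by (rule borel_measurable_continuous_onI[OF smooth_imp_continuous[OF test_functionsD(1)[OF assms]]])
  show "\<phi> \<in> borel_measurable lebesgue"
    by (rule measurable_completion) (use 1 in simp)
qed

lemma test_times_locally_integrable:
  assumes v: "locally_integrable U v" and \<phi>: "\<phi> \<in> test_functions U"
  shows "set_integrable lebesgue U (\<lambda>x. v x * \<phi> x)"
proof -
  let ?K = "support \<phi>"
  have K: "compact ?K" "?K \<subseteq> U" using test_functionsD[OF \<phi>] by auto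
  then have "set_integrable lebesgue ?K v" using v by (simp add: locally_integrable_def)
  then have int: "integrable lebesgue (\<lambda>x. indicator ?K x *\<^sub>R v x)" by (simp add: set_integrable_def)
  obtain M where M: "\<And>x. \<bar>\<phi> x\<bar> \<le> M" using test_bounded[OF \<phi>] by blast
  have "integrable lebesgue (\<lambda>x. (indicator ?K x *\<^sub>R v x) * \<phi> x)"
  proof (rule Bochner_Integration.integrable_bound)
    show "integrable lebesgue (\<lambda>x. M * (indicator ?K x *\<^sub>R v x))" using int by simp
    show "(\<lambda>x. (indicator ?K x *\<^sub>R v x) * \<phi> x) \<in> borel_measurable lebesgue"
      by (intro borel_measurable_times borel_measurable_integrable[OF int] test_borel_measurable(2)[OF \<phi>])
    show "AE x in lebesgue. norm ((indicator ?K x *\<^sub>R v x) * \<phi> x) \<le> norm (M * (indicator ?K x *\<^sub>R v x))"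
    proof (rule AE_I2)
      fix x
      have "\<bar>\<phi> x\<bar> \<le> \<bar>M\<bar>" using M[of x] by linarith
      then show "norm ((indicator ?K x *\<^sub>R v x) * \<phi> x) \<le> norm (M * (indicator ?K x *\<^sub>R v x))"
        by (simp add: abs_mult mult.commute[of _ "\<bar>\<phi> x\<bar>"] mult_right_mono)
    qed
  qed
  also have "(\<lambda>x. (indicator ?K x *\<^sub>R v x) * \<phi> x) = (\<lambda>x. indicator U x *\<^sub>R (v x * \<phi> x))"
    using K(2) by (auto simp: indicator_def fun_eq_iff dest: not_in_support)
  finally show ?thesis by (simp add: set_integrable_def)
qed

text \<open>Bump functions test the integral over every box whose closure lies in \<open>U\<close>, and countably many such
boxes cover \<open>U\<close>.\<close>

lemma fundamental_lemma:
  fixes f :: "real ^ 'n::finite \<Rightarrow> real"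
  assumes U: "open U" and f: "locally_integrable U f"
    and zero: "\<And>\<phi>. \<phi> \<in> test_functions U \<Longrightarrow> (LINT x:U|lebesgue. f x * \<phi> x) = 0"
  shows "AE x in lebesgue. x \<in> U \<longrightarrow> f x = 0"
proof -
  have si: "integrable lebesgue (\<lambda>x. indicator (cbox c d) x *\<^sub>R f x)" if "cbox c d \<subseteq> U" for c d
    using f that by (auto simp: locally_integrable_def set_integrable_def)
  have box: "(LINT x:box c d|lebesgue. f x) = 0" if cd: "cbox c d \<subseteq> U" for c d
  proof -
    note int = si[OF cd]
    have "(\<lambda>k. LINT x|lebesgue. box_bump c d k x * (indicator (cbox c d) x *\<^sub>R f x))
      \<longlonglongrightarrow> (LINT x|lebesgue. indicator (box c d) x * (indicator (cbox c d) x *\<^sub>R f x))"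
    proof (rule integral_dominated_convergence[OF _ _ integrable_abs[OF int]])
      show "AE x in lebesgue. (\<lambda>k. box_bump c d k x * (indicator (cbox c d) x *\<^sub>R f x))
        \<longlonglongrightarrow> indicator (box c d) x * (indicator (cbox c d) x *\<^sub>R f x)"
        by (intro AE_I2 tendsto_mult box_bump_limit tendsto_const)
      show "AE x in lebesgue. norm (box_bump c d k x * (indicator (cbox c d) x *\<^sub>R f x))
          \<le> \<bar>indicator (cbox c d) x *\<^sub>R f x\<bar>" for k
        by (rule AE_I2) (simp add: abs_mult box_bump_bounds mult_left_le_one_le)
    qed (intro borel_measurable_times borel_measurable_integrable[OF int]
          test_borel_measurable(2)[OF box_bump_test[OF cd]] borel_measurable_indicator; simp)+
    moreover have "(LINT x|lebesgue. box_bump c d k x * (indicator (cbox c d) x *\<^sub>R f x)) = 0" for k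
    proof -
      have "(\<lambda>x. box_bump c d k x * (indicator (cbox c d) x *\<^sub>R f x)) = (\<lambda>x. indicator U x *\<^sub>R (f x * box_bump c d k x))"
        using cd box_subset_cbox[of c d] by (auto simp: fun_eq_iff indicator_def intro!: box_bump_outside)
      then show ?thesis using zero[OF box_bump_test[OF cd]] by (simp add: set_lebesgue_integral_def)
    qed
    moreover have "(\<lambda>x. indicator (box c d) x * (indicator (cbox c d) x *\<^sub>R f x)) = (\<lambda>x. indicator (box c d) x *\<^sub>R f x)"
      using box_subset_cbox[of c d] by (auto simp: fun_eq_iff indicator_def)
    ultimately show ?thesis by (simp add: LIMSEQ_const_iff set_lebesgue_integral_def)
  qed
  have on_box: "AE x in lebesgue. x \<in> box p q \<longrightarrow> f x = 0" if pq: "cbox p q \<subseteq> U" for p q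
  proof -
    define g where "g x = indicator (box p q) x *\<^sub>R f x" for x
    have g: "integrable lebesgue g"
    proof -
      have "g = (\<lambda>x. indicator (box p q) x *\<^sub>R (indicator (cbox p q) x *\<^sub>R f x))"
        using box_subset_cbox[of p q] by (auto simp: g_def fun_eq_iff indicator_def)
      then show ?thesis using integrable_mult_indicator[OF _ si[OF pq], of "box p q"] by simp
    qed
    obtain h where h: "h \<in> borel_measurable lborel" "AE x in lborel. g x = h x"
      using completion_ex_borel_measurable_real[OF borel_measurable_integrable[OF g]] by auto
    have gh: "AE x in lebesgue. g x = h x" using h(2) by (rule AE_completion)
    have hl: "h \<in> borel_measurable lebesgue" using h(1) by (rule measurable_completion)
    have int_h: "integrable lborel h"
      using g h(1) integrable_cong_AE[OF borel_measurable_integrable[OF g] hl gh] integrable_completion[OF h(1)] by simp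
    have int_on: "(LINT x:A|lborel. h x) = (LINT x:A|lebesgue. g x)" if A: "A \<in> sets borel" for A
    proof -
      have "(\<lambda>x. indicator A x *\<^sub>R h x) \<in> borel_measurable lborel" using h(1) A by simp
      then have "(LINT x:A|lborel. h x) = (LINT x:A|lebesgue. h x)"
        unfolding set_lebesgue_integral_def by (rule integral_completion[symmetric])
      also have "\<dots> = (LINT x:A|lebesgue. g x)"
        unfolding set_lebesgue_integral_def
        by (intro integral_cong_AE borel_measurable_scaleR borel_measurable_indicator hl borel_measurable_integrable[OF g])
          (use gh A in auto)
      finally show ?thesis .
    qed
    have "AE x in lborel. h x = 0"
    proof (rule integral_boxes_zero_imp_AE_zero[OF int_h])
      show "integral\<^sup>L lborel h = 0"
      proof -
        have "integral\<^sup>L lborel h = (LINT x:UNIV|lborel. h x)" by (simp add: set_lebesgue_integral_def)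
        also have "\<dots> = (LINT x:UNIV|lebesgue. g x)" by (rule int_on) simp
        also have "\<dots> = (LINT x:box p q|lebesgue. f x)" by (simp add: set_lebesgue_integral_def g_def[abs_def])
        finally show ?thesis using box[OF pq] by simp
      qed
      fix c d
      obtain c' d' where cd: "box c d \<inter> box p q = box c' d'" "cbox c' d' \<subseteq> cbox p q \<or> box c' d' = {}"
      proof -
        obtain c' d' where e: "box c d \<inter> box p q = box c' d'" using box_Int_box[of c d p q] by blast
        have "cbox c' d' \<subseteq> cbox p q" if ne: "box c' d' \<noteq> {}"
        proof -
          have "box c' d' \<subseteq> box p q" "box p q \<noteq> {}" using e ne by auto
          then show ?thesis using closure_mono[of "box c' d'" "box p q"] ne by (simp add: closure_box)
        qed
        then show thesis using that e by blast
      qed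
      have "(LINT x:box c d|lborel. h x) = (LINT x:box c d|lebesgue. g x)" by (rule int_on) simp
      also have "\<dots> = (LINT x:box c' d'|lebesgue. f x)"
        unfolding set_lebesgue_integral_def g_def cd(1)[symmetric]
        by (intro Bochner_Integration.integral_cong refl) (auto simp: indicator_def)
      also have "\<dots> = 0"
        using cd(2) box[of c' d'] pq by (auto simp: set_lebesgue_integral_def)
      finally show "(LINT x:box c d|lborel. h x) = 0" .
    qed
    then have "AE x in lebesgue. h x = 0" by (rule AE_completion)
    with gh show ?thesis by eventually_elim (auto simp: g_def)
  qed
  let ?F = "{box c d | c d. cbox c d \<subseteq> U}"
  obtain F where F: "F \<subseteq> ?F" "countable F" "\<Union>F = \<Union>?F"
    using Lindelof[of ?F] open_box by blast
  have "AE x in lebesgue. \<forall>B\<in>F. x \<in> B \<longrightarrow> f x = 0"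
  proof (rule AE_ball_countable'[OF _ F(2)])
    fix B assume "B \<in> F"
    then obtain c d where B: "B = box c d" "cbox c d \<subseteq> U" using F(1) by blast
    show "AE x in lebesgue. x \<in> B \<longrightarrow> f x = 0" unfolding B(1) by (rule on_box[OF B(2)])
  qed
  then show ?thesis
  proof eventually_elim
    case (elim x)
    show ?case
    proof
      assume "x \<in> U"
      then obtain c d where "cbox c d \<subseteq> U" "x \<in> box c d"
        using open_contains_cbox[OF U \<open>x \<in> U\<close>] by metis
      then have "x \<in> \<Union>F" unfolding F(3) by blast
      then show "f x = 0" using elim by blast
    qed
  qed
qed

section \<open>Weak derivatives\<close>

lemma locally_integrable_diff:
  "locally_integrable U u \<Longrightarrow> locally_integrable U v \<Longrightarrow> locally_integrable U (\<lambda>x. u x - v x)"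
  unfolding locally_integrable_def by (blast intro: set_integral_diff(1))

lemma iterated_deriv_test: "\<phi> \<in> test_functions U \<Longrightarrow> iterated_deriv \<alpha> \<phi> \<in> test_functions U"
  by (induction \<alpha>) (auto simp: iterated_deriv_def intro: test_partial)

lemma set_lebesgue_integral_diff_test:
  assumes "locally_integrable U u" "locally_integrable U v" "\<phi> \<in> test_functions U"
  shows "(LINT x:U|lebesgue. (u x - v x) * \<phi> x) = (LINT x:U|lebesgue. u x * \<phi> x) - (LINT x:U|lebesgue. v x * \<phi> x)"
  using set_integral_diff(2)[OF test_times_locally_integrable[OF assms(1,3)] test_times_locally_integrable[OF assms(2,3)]]
  by (simp add: left_diff_distrib)

lemma has_weak_derivD:
  assumes "has_weak_deriv U \<alpha> u v"
  shows "locally_integrable U u" "locally_integrable U v"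
    and "\<phi> \<in> test_functions U \<Longrightarrow>
      (LINT x:U|lebesgue. u x * iterated_deriv \<alpha> \<phi> x) = (-1) ^ length \<alpha> * (LINT x:U|lebesgue. v x * \<phi> x)"
  using assms unfolding has_weak_deriv_def by blast+

lemma weak_deriv_unique:
  assumes U: "open U" and v: "has_weak_deriv U \<alpha> u v" and w: "has_weak_deriv U \<alpha> u w"
  shows "AE x in lebesgue. x \<in> U \<longrightarrow> v x = w x"
proof -
  have li: "locally_integrable U v" "locally_integrable U w" using has_weak_derivD(1,2)[OF v] has_weak_derivD(1,2)[OF w] by auto
  have "AE x in lebesgue. x \<in> U \<longrightarrow> v x - w x = 0"
  proof (rule fundamental_lemma[OF U locally_integrable_diff[OF li]])
    fix \<phi> assume \<phi>: "\<phi> \<in> test_functions U"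
    have "(-1) ^ length \<alpha> * (LINT x:U|lebesgue. v x * \<phi> x) = (-1) ^ length \<alpha> * (LINT x:U|lebesgue. w x * \<phi> x)"
      using has_weak_derivD(3)[OF v \<phi>] has_weak_derivD(3)[OF w \<phi>] by simp
    then show "(LINT x:U|lebesgue. (v x - w x) * \<phi> x) = 0"
      unfolding set_lebesgue_integral_diff_test[OF li \<phi>] by simp
  qed
  then show ?thesis by simp
qed

lemma has_weak_deriv_diff:
  assumes v: "has_weak_deriv U \<alpha> u v" and w: "has_weak_deriv U \<alpha> u' w"
  shows "has_weak_deriv U \<alpha> (\<lambda>x. u x - u' x) (\<lambda>x. v x - w x)"
proof -
  have li: "locally_integrable U u" "locally_integrable U u'" "locally_integrable U v" "locally_integrable U w"
    using has_weak_derivD(1,2)[OF v] has_weak_derivD(1,2)[OF w] by auto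
  show ?thesis unfolding has_weak_deriv_def
  proof (intro conjI ballI locally_integrable_diff li)
    fix \<phi> assume \<phi>: "\<phi> \<in> test_functions U"
    show "(LINT x:U|lebesgue. (u x - u' x) * iterated_deriv \<alpha> \<phi> x) = (-1) ^ length \<alpha> * (LINT x:U|lebesgue. (v x - w x) * \<phi> x)"
      unfolding set_lebesgue_integral_diff_test[OF li(1,2) iterated_deriv_test[OF \<phi>]] set_lebesgue_integral_diff_test[OF li(3,4) \<phi>]
      using has_weak_derivD(3)[OF v \<phi>] has_weak_derivD(3)[OF w \<phi>] by (simp add: right_diff_distrib)
  qed
qed

lemma set_lebesgue_integral_supported:
  fixes g :: "real ^ 'n::finite \<Rightarrow> real"
  assumes "g \<in> borel_measurable borel" "\<And>x. x \<notin> U \<Longrightarrow> g x = 0"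
  shows "(LINT x:U|lebesgue. g x) = (LINT x|lborel. g x)"
proof -
  have "(\<lambda>x. indicator U x *\<^sub>R g x) = g" using assms(2) by (auto simp: indicator_def fun_eq_iff)
  then show ?thesis using assms(1) by (simp add: set_lebesgue_integral_def integral_completion)
qed

lemma test_outside: "\<phi> \<in> test_functions U \<Longrightarrow> x \<notin> U \<Longrightarrow> \<phi> x = 0"
  using test_functionsD(3)[of \<phi> U] not_in_support[of x \<phi>] by blast

lemma locally_integrable_test:
  assumes "\<phi> \<in> test_functions U" shows "locally_integrable U \<phi>"
proof -
  have "integrable lebesgue \<phi>"
    using test_integrable[OF assms] test_borel_measurable(1)[OF assms] by (simp add: integrable_completion)
  then show ?thesis
    unfolding locally_integrable_def set_integrable_def
    by (intro allI impI integrable_mult_indicator) (auto dest: lmeasurable_compact fmeasurableD)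
qed

text \<open>Only pure derivatives \<open>\<partial>\<^sub>i\<^sup>m\<close> are treated, as the Laplacian and the gradient involve no others; integration
by parts then needs no reordering of the derivatives.\<close>

lemma has_weak_deriv_test:
  assumes \<phi>: "\<phi> \<in> test_functions U"
  shows "has_weak_deriv U (replicate m i) \<phi> (iterated_deriv (replicate m i) \<phi>)"
proof -
  have iter: "iterated_deriv (replicate m i) f = (partial_deriv i ^^ m) f" for m and f :: "real ^ 'a \<Rightarrow> real"
    by (induction m) (simp_all add: iterated_deriv_def)
  have test: "(partial_deriv i ^^ m) f \<in> test_functions U" if "f \<in> test_functions U" for m f
    using that by (induction m) (auto intro: test_partial)
  have ibp: "(LINT x|lborel. f x * (partial_deriv i ^^ m) g x) = (-1) ^ m * (LINT x|lborel. (partial_deriv i ^^ m) f x * g x)"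
    if "f \<in> test_functions U" "g \<in> test_functions U" for m f g
    using that
  proof (induction m arbitrary: f)
    case (Suc m)
    have "(LINT x|lborel. f x * (partial_deriv i ^^ Suc m) g x) = - (LINT x|lborel. partial_deriv i f x * (partial_deriv i ^^ m) g x)"
      using test_integration_by_parts[OF Suc.prems(1) test[OF Suc.prems(2)], of i m] by simp
    also have "\<dots> = (-1) ^ Suc m * (LINT x|lborel. (partial_deriv i ^^ Suc m) f x * g x)"
      using Suc.IH[OF test_partial[OF Suc.prems(1)] Suc.prems(2)] by (simp add: funpow_swap1)
    finally show ?case .
  qed simp
  have set_int: "(LINT x:U|lebesgue. f x * g x) = (LINT x|lborel. f x * g x)"
    if "f \<in> test_functions U" "g \<in> test_functions U" for f g
    using test_mult[OF that] by (intro set_lebesgue_integral_supported test_borel_measurable(1) test_outside)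
  show ?thesis
    unfolding has_weak_deriv_def iter
    by (auto simp: locally_integrable_test \<phi> test set_int ibp)
qed

section \<open>Square-integrable functions\<close>

definition L2 :: "'a measure \<Rightarrow> ('a \<Rightarrow> real) \<Rightarrow> bool" where
  "L2 M f \<longleftrightarrow> f \<in> borel_measurable M \<and> integrable M (\<lambda>x. (f x)\<^sup>2)"

definition L2_lim :: "'a measure \<Rightarrow> (nat \<Rightarrow> 'a \<Rightarrow> real) \<Rightarrow> ('a \<Rightarrow> real) \<Rightarrow> bool" where
  "L2_lim M f g \<longleftrightarrow> (\<forall>n. L2 M (f n)) \<and> L2 M g \<and> (\<lambda>n. LINT x|M. (f n x - g x)\<^sup>2) \<longlonglongrightarrow> 0"

lemma L2_add:
  assumes "L2 M f" "L2 M g" shows "L2 M (\<lambda>x. f x + g x)"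
proof -
  have m: "f \<in> borel_measurable M" "g \<in> borel_measurable M" using assms by (auto simp: L2_def)
  have "integrable M (\<lambda>x. (f x + g x)\<^sup>2)"
  proof (rule Bochner_Integration.integrable_bound)
    show "integrable M (\<lambda>x. 2 * (f x)\<^sup>2 + 2 * (g x)\<^sup>2)" using assms by (simp add: L2_def)
    show "(\<lambda>x. (f x + g x)\<^sup>2) \<in> borel_measurable M" using m by simp
    have "(a + b)\<^sup>2 \<le> 2 * a\<^sup>2 + 2 * b\<^sup>2" for a b :: real
      using sum_squares_bound[of a b] by (simp add: power2_sum)
    then have "norm ((a + b)\<^sup>2) \<le> norm (2 * a\<^sup>2 + 2 * b\<^sup>2)" for a b :: real
      by (simp add: abs_of_nonneg)
    then show "AE x in M. norm ((f x + g x)\<^sup>2) \<le> norm (2 * (f x)\<^sup>2 + 2 * (g x)\<^sup>2)" by simp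
  qed
  then show ?thesis using m by (simp add: L2_def)
qed

lemma L2_mult_bounded:
  assumes f: "L2 M f" and k: "k \<in> borel_measurable M" "\<And>x. x \<in> space M \<Longrightarrow> \<bar>k x\<bar> \<le> C"
  shows "L2 M (\<lambda>x. k x * f x)" "(LINT x|M. (k x * f x)\<^sup>2) \<le> C\<^sup>2 * (LINT x|M. (f x)\<^sup>2)"
proof -
  have m: "f \<in> borel_measurable M" and i: "integrable M (\<lambda>x. C\<^sup>2 * (f x)\<^sup>2)" using f by (auto simp: L2_def)
  have b: "(k x * f x)\<^sup>2 \<le> C\<^sup>2 * (f x)\<^sup>2" if "x \<in> space M" for x
    using power_mono[OF k(2)[OF that], of 2] by (simp add: power_mult_distrib mult_right_mono)
  have int: "integrable M (\<lambda>x. (k x * f x)\<^sup>2)"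
    using b k(1) m by (intro Bochner_Integration.integrable_bound[OF i]) auto
  then show "L2 M (\<lambda>x. k x * f x)" using m k(1) by (simp add: L2_def)
  have "(LINT x|M. (k x * f x)\<^sup>2) \<le> (LINT x|M. C\<^sup>2 * (f x)\<^sup>2)"
    by (rule integral_mono[OF int i b])
  then show "(LINT x|M. (k x * f x)\<^sup>2) \<le> C\<^sup>2 * (LINT x|M. (f x)\<^sup>2)" by simp
qed

lemma L2_scale: "L2 M f \<Longrightarrow> L2 M (\<lambda>x. c * f x)"
  by (rule L2_mult_bounded(1)[where C = "\<bar>c\<bar>"]) auto

lemma L2_diff: "L2 M f \<Longrightarrow> L2 M g \<Longrightarrow> L2 M (\<lambda>x. f x - g x)"
  using L2_add[of M f "\<lambda>x. - 1 * g x"] L2_scale[of M g "- 1"] by simp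

lemma L2_sum: "(\<And>i. i \<in> I \<Longrightarrow> L2 M (f i)) \<Longrightarrow> L2 M (\<lambda>x. \<Sum>i\<in>I. f i x)"
proof (induction I rule: infinite_finite_induct)
  case (insert i I)
  then show ?case using L2_add[of M "f i"] by simp
qed (simp_all add: L2_def)

text \<open>From \<open>\<bar>f\<^sup>2 - g\<^sup>2\<bar> \<le> (1 + 1/\<delta>) (f - g)\<^sup>2 + \<delta> g\<^sup>2\<close>, with \<open>\<delta>\<close> chosen before \<open>n\<close>.\<close>

lemma L2_lim_norm:
  assumes "L2_lim M f g"
  shows "(\<lambda>n. LINT x|M. (f n x)\<^sup>2) \<longlonglongrightarrow> (LINT x|M. (g x)\<^sup>2)"
proof (rule LIMSEQ_I)
  fix r :: real assume r: "r > 0"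
  have f: "L2 M (f n)" and g: "L2 M g" and lim: "(\<lambda>n. LINT x|M. (f n x - g x)\<^sup>2) \<longlonglongrightarrow> 0" for n
    using assms by (auto simp: L2_lim_def)
  define G where "G = (LINT x|M. (g x)\<^sup>2)"
  have G: "G \<ge> 0" by (simp add: G_def)
  define \<delta> where "\<delta> = r / (2 * (G + 1))"
  have \<delta>: "\<delta> > 0" using r G by (simp add: \<delta>_def)
  have \<delta>G: "\<delta> * G \<le> r / 2" using r G by (simp add: \<delta>_def field_simps)
  have bound: "\<bar>(LINT x|M. (f n x)\<^sup>2) - G\<bar> \<le> (1 + 1 / \<delta>) * (LINT x|M. (f n x - g x)\<^sup>2) + \<delta> * G" for n
  proof -
    have i: "integrable M (\<lambda>x. (f n x)\<^sup>2)" "integrable M (\<lambda>x. (g x)\<^sup>2)" "integrable M (\<lambda>x. (f n x - g x)\<^sup>2)"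
      using f[of n] g L2_diff[OF f[of n] g] by (auto simp: L2_def)
    have p: "\<bar>a\<^sup>2 - b\<^sup>2\<bar> \<le> (1 + 1 / \<delta>) * (a - b)\<^sup>2 + \<delta> * b\<^sup>2" for a b :: real
    proof -
      have "0 \<le> (\<bar>a - b\<bar> - \<delta> * \<bar>b\<bar>)\<^sup>2 / \<delta>" using \<delta> by simp
      also have "\<dots> = (a - b)\<^sup>2 / \<delta> + \<delta> * b\<^sup>2 - 2 * \<bar>a - b\<bar> * \<bar>b\<bar>"
        using \<delta> by (simp add: power2_diff power_mult_distrib field_simps power2_eq_square)
      finally have 1: "2 * (\<bar>a - b\<bar> * \<bar>b\<bar>) \<le> (a - b)\<^sup>2 / \<delta> + \<delta> * b\<^sup>2" by simp
      have "\<bar>a\<^sup>2 - b\<^sup>2\<bar> = \<bar>(a - b)\<^sup>2 + 2 * ((a - b) * b)\<bar>"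
        by (simp add: power2_eq_square algebra_simps)
      also have "\<dots> \<le> (a - b)\<^sup>2 + 2 * (\<bar>a - b\<bar> * \<bar>b\<bar>)"
        using abs_triangle_ineq[of "(a - b)\<^sup>2" "2 * ((a - b) * b)"] by (simp add: abs_mult)
      finally show ?thesis using 1 by (simp add: algebra_simps)
    qed
    have "\<bar>(LINT x|M. (f n x)\<^sup>2) - G\<bar> = \<bar>LINT x|M. (f n x)\<^sup>2 - (g x)\<^sup>2\<bar>"
      using i by (simp add: G_def)
    also have "\<dots> \<le> (LINT x|M. \<bar>(f n x)\<^sup>2 - (g x)\<^sup>2\<bar>)" by (rule integral_abs_bound)
    also have "\<dots> \<le> (LINT x|M. (1 + 1 / \<delta>) * (f n x - g x)\<^sup>2 + \<delta> * (g x)\<^sup>2)"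
      using i by (intro integral_mono integrable_abs Bochner_Integration.integrable_diff
         Bochner_Integration.integrable_add integrable_mult_right p)
    also have "\<dots> = (1 + 1 / \<delta>) * (LINT x|M. (f n x - g x)\<^sup>2) + \<delta> * G"
      unfolding G_def by (subst Bochner_Integration.integral_add[OF integrable_mult_right[OF i(3)] integrable_mult_right[OF i(2)]]) simp
    finally show ?thesis .
  qed
  have "(\<lambda>n. (1 + 1 / \<delta>) * (LINT x|M. (f n x - g x)\<^sup>2)) \<longlonglongrightarrow> (1 + 1 / \<delta>) * 0"
    by (intro tendsto_intros lim)
  from LIMSEQ_D[OF this, of "r / 2"] r obtain n0 where
    n0: "\<And>n. n \<ge> n0 \<Longrightarrow> \<bar>(1 + 1 / \<delta>) * (LINT x|M. (f n x - g x)\<^sup>2)\<bar> < r / 2"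
    by auto
  show "\<exists>n0. \<forall>n\<ge>n0. norm ((LINT x|M. (f n x)\<^sup>2) - (LINT x|M. (g x)\<^sup>2)) < r"
  proof (intro exI[of _ n0] allI impI)
    fix n assume "n \<ge> n0"
    from n0[OF this] bound[of n] \<delta>G show "norm ((LINT x|M. (f n x)\<^sup>2) - (LINT x|M. (g x)\<^sup>2)) < r"
      unfolding G_def real_norm_def by linarith
  qed
qed

lemma L2_lim_mult_bounded:
  assumes "L2_lim M f g" and k: "k \<in> borel_measurable M" "\<And>x. x \<in> space M \<Longrightarrow> \<bar>k x\<bar> \<le> C"
  shows "L2_lim M (\<lambda>n x. k x * f n x) (\<lambda>x. k x * g x)"
proof -
  have f: "L2 M (f n)" and g: "L2 M g" and lim: "(\<lambda>n. LINT x|M. (f n x - g x)\<^sup>2) \<longlonglongrightarrow> 0" for n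
    using assms by (auto simp: L2_lim_def)
  have "(\<lambda>n. LINT x|M. (k x * f n x - k x * g x)\<^sup>2) \<longlonglongrightarrow> 0"
  proof (rule tendsto_sandwich[where f = "\<lambda>_. 0"])
    show "(\<lambda>n. C\<^sup>2 * (LINT x|M. (f n x - g x)\<^sup>2)) \<longlonglongrightarrow> 0"
      using tendsto_mult_left[OF lim, of "C\<^sup>2"] by simp
    show "\<forall>\<^sub>F n in sequentially. (LINT x|M. (k x * f n x - k x * g x)\<^sup>2) \<le> C\<^sup>2 * (LINT x|M. (f n x - g x)\<^sup>2)"
      using L2_mult_bounded(2)[OF L2_diff[OF f g] k] by (simp add: right_diff_distrib)
  qed auto
  then show ?thesis using L2_mult_bounded(1)[OF f k] L2_mult_bounded(1)[OF g k] by (simp add: L2_lim_def)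
qed

lemma L2_lim_sum:
  assumes "finite I" and lim: "\<And>i. i \<in> I \<Longrightarrow> L2_lim M (f i) (g i)"
  shows "L2_lim M (\<lambda>n x. \<Sum>i\<in>I. f i n x) (\<lambda>x. \<Sum>i\<in>I. g i x)"
proof -
  have f: "L2 M (f i n)" and g: "L2 M (g i)" if "i \<in> I" for i n using lim[OF that] by (auto simp: L2_lim_def)
  have "(\<lambda>n. LINT x|M. ((\<Sum>i\<in>I. f i n x) - (\<Sum>i\<in>I. g i x))\<^sup>2) \<longlonglongrightarrow> 0"
  proof (rule tendsto_sandwich[where f = "\<lambda>_. 0"])
    have "(\<lambda>n. (\<Sum>i\<in>I. LINT x|M. (f i n x - g i x)\<^sup>2) * real (card I)) \<longlonglongrightarrow> (\<Sum>i\<in>I. 0) * real (card I)"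
      using lim by (intro tendsto_intros) (auto simp: L2_lim_def)
    then show "(\<lambda>n. (\<Sum>i\<in>I. LINT x|M. (f i n x - g i x)\<^sup>2) * real (card I)) \<longlonglongrightarrow> 0" by simp
    show "\<forall>\<^sub>F n in sequentially. (LINT x|M. ((\<Sum>i\<in>I. f i n x) - (\<Sum>i\<in>I. g i x))\<^sup>2)
        \<le> (\<Sum>i\<in>I. LINT x|M. (f i n x - g i x)\<^sup>2) * real (card I)"
    proof (intro always_eventually allI)
      fix n
      have i: "integrable M (\<lambda>x. (f i n x - g i x)\<^sup>2)" if "i \<in> I" for i
        using L2_diff[OF f[OF that] g[OF that], of n] by (simp add: L2_def)
      have "integrable M (\<lambda>x. ((\<Sum>i\<in>I. f i n x) - (\<Sum>i\<in>I. g i x))\<^sup>2)"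
        using L2_diff[OF L2_sum[of I, OF f] L2_sum[of I, OF g]] by (simp add: L2_def)
      then have "(LINT x|M. ((\<Sum>i\<in>I. f i n x) - (\<Sum>i\<in>I. g i x))\<^sup>2)
        \<le> (LINT x|M. (\<Sum>i\<in>I. (f i n x - g i x)\<^sup>2) * real (card I))"
        using i sum_squared_le_sum_of_squares[of "\<lambda>i. f i n _ - g i _" I]
        by (intro integral_mono integrable_mult_left Bochner_Integration.integrable_sum) (simp_all add: sum_subtractf)
      then show "(LINT x|M. ((\<Sum>i\<in>I. f i n x) - (\<Sum>i\<in>I. g i x))\<^sup>2)
        \<le> (\<Sum>i\<in>I. LINT x|M. (f i n x - g i x)\<^sup>2) * real (card I)"
        using i by (simp add: Bochner_Integration.integral_sum)
    qed
  qed auto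
  then show ?thesis using L2_sum[of I, OF f] L2_sum[of I, OF g] by (simp add: L2_lim_def)
qed

lemma set_lebesgue_integral_restrict:
  fixes f :: "real ^ 'n::finite \<Rightarrow> real"
  assumes "U \<in> sets lebesgue"
  shows "(LINT x:U|lebesgue. f x) = (LINT x|lebesgue_on U. f x)"
  using assms by (simp add: set_lebesgue_integral_def integral_restrict_space)

lemma square_integrable_iff_L2:
  fixes f :: "real ^ 'n::finite \<Rightarrow> real"
  assumes "U \<in> sets lebesgue"
  shows "f \<in> square_integrable U \<longleftrightarrow> L2 (lebesgue_on U) f"
  using assms by (simp add: square_integrable_def L2_def set_borel_measurable_def set_integrable_def
    borel_measurable_restrict_space_iff integrable_restrict_space)

lemma open_lebesgue_sets: "open U \<Longrightarrow> U \<in> sets lebesgue"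
  by simp

text \<open>Lebesgue measure is complete, so the arbitrary representatives chosen by \<open>weak_deriv\<close> inherit
measurability from the square-integrable ones.\<close>

lemma L2_cong_AE:
  fixes f g :: "real ^ 'n::finite \<Rightarrow> real"
  assumes U: "open U" and f: "L2 (lebesgue_on U) f" and ae: "AE x in lebesgue. x \<in> U \<longrightarrow> f x = g x"
  shows "L2 (lebesgue_on U) g" "(LINT x|lebesgue_on U. (g x)\<^sup>2) = (LINT x|lebesgue_on U. (f x)\<^sup>2)"
proof -
  note Us = open_lebesgue_sets[OF U]
  have fm: "f \<in> borel_measurable (lebesgue_on U)" using f by (simp add: L2_def)
  have "(\<lambda>x. indicator U x *\<^sub>R g x) \<in> borel_measurable lebesgue"
  proof (rule borel_measurable_AE)
    show "(\<lambda>x. indicator U x *\<^sub>R f x) \<in> borel_measurable lebesgue"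
      using fm Us by (simp add: borel_measurable_restrict_space_iff)
    show "AE x in lebesgue. indicator U x *\<^sub>R f x = indicator U x *\<^sub>R g x"
      using ae by eventually_elim (auto simp: indicator_def)
  qed
  then have gm: "g \<in> borel_measurable (lebesgue_on U)" using Us by (simp add: borel_measurable_restrict_space_iff)
  have ae': "AE x in lebesgue_on U. (f x)\<^sup>2 = (g x)\<^sup>2"
    using ae Us by (subst AE_restrict_space_iff) (auto elim: eventually_mono)
  show "L2 (lebesgue_on U) g"
    using integrable_cong_AE[OF _ _ ae'] fm gm f by (simp add: L2_def)
  show "(LINT x|lebesgue_on U. (g x)\<^sup>2) = (LINT x|lebesgue_on U. (f x)\<^sup>2)"
    using integral_cong_AE[OF _ _ ae'] fm gm by simp
qed

lemma L2_test:
  assumes U: "open U" and \<phi>: "\<phi> \<in> test_functions U"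
  shows "L2 (lebesgue_on U) \<phi>"
proof -
  note m = test_borel_measurable[OF \<phi>]
  have "integrable lborel (\<lambda>x. (\<phi> x)\<^sup>2)"
    using test_integrable[OF test_mult[OF \<phi> \<phi>]] by (simp add: power2_eq_square)
  then have "integrable lebesgue (\<lambda>x. (\<phi> x)\<^sup>2)" using m(1) by (simp add: integrable_completion)
  then have "integrable (lebesgue_on U) (\<lambda>x. (\<phi> x)\<^sup>2)"
    using open_lebesgue_sets[OF U] integrable_mult_indicator[of U lebesgue "\<lambda>x. (\<phi> x)\<^sup>2"]
    by (simp add: integrable_restrict_space)
  then show ?thesis using m(2) by (simp add: L2_def measurable_restrict_space1)
qed

section \<open>Approximation by test functions\<close>

lemma weak_deriv_AE_eq:
  assumes "open U" "has_weak_deriv U \<alpha> u v"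
  shows "AE x in lebesgue. x \<in> U \<longrightarrow> v x = weak_deriv U \<alpha> u x"
  unfolding weak_deriv_def
  by (rule weak_deriv_unique[OF assms someI[of "has_weak_deriv U \<alpha> u", OF assms(2)]])

text \<open>One sequence serves for all pure derivatives of order at most two: each of them contributes one
nonnegative summand to the squared norm, and by uniqueness of weak derivatives this summand is the
distance of the derivatives.\<close>

lemma sobolev0_approximation:
  fixes u :: "real ^ 'n::finite \<Rightarrow> real"
  assumes U: "open U" and u: "u \<in> sobolev0 2 U"
  obtains \<phi> where "\<And>n. \<phi> n \<in> test_functions U"
    and "\<And>m i v. m \<le> 2 \<Longrightarrow> has_weak_deriv U (replicate m i) u v \<Longrightarrow>
      L2_lim (lebesgue_on U) (\<lambda>n. iterated_deriv (replicate m i) (\<phi> n)) v"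
proof -
  note Us = open_lebesgue_sets[OF U]
  have "\<forall>n. \<exists>\<phi>. \<phi> \<in> test_functions U \<and> sobolev_norm 2 U (\<lambda>x. u x - \<phi> x) < inverse (real (Suc n))"
  proof
    fix n
    have "inverse (real (Suc n)) > 0" by simp
    then show "\<exists>\<phi>. \<phi> \<in> test_functions U \<and> sobolev_norm 2 U (\<lambda>x. u x - \<phi> x) < inverse (real (Suc n))"
      using u unfolding sobolev0_def by blast
  qed
  then obtain \<phi> where \<phi>: "\<And>n. \<phi> n \<in> test_functions U"
    and norm: "\<And>n. sobolev_norm 2 U (\<lambda>x. u x - \<phi> n x) < inverse (real (Suc n))"
    by metis
  have "L2_lim (lebesgue_on U) (\<lambda>n. iterated_deriv (replicate m i) (\<phi> n)) v"
    if m: "m \<le> 2" and v: "has_weak_deriv U (replicate m i) u v" for m i v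
  proof -
    define \<alpha> where "\<alpha> = replicate m i"
    have v: "has_weak_deriv U \<alpha> u v" using v by (simp add: \<alpha>_def)
    define \<psi> where "\<psi> n = iterated_deriv \<alpha> (\<phi> n)" for n
    have \<psi>: "\<psi> n \<in> test_functions U" for n unfolding \<psi>_def by (rule iterated_deriv_test[OF \<phi>])
    obtain w where w: "w \<in> square_integrable U" "has_weak_deriv U \<alpha> u w"
    proof -
      have "\<forall>\<alpha>. length \<alpha> \<le> 2 \<longrightarrow> (\<exists>v\<in>square_integrable U. has_weak_deriv U \<alpha> u v)"
        using u by (simp add: sobolev0_def sobolev_def)
      moreover have "length \<alpha> \<le> 2" using m by (simp add: \<alpha>_def)
      ultimately show thesis using that by blast
    qed
    have L2_v: "L2 (lebesgue_on U) v"
      using w(1) square_integrable_iff_L2[OF Us] by (intro L2_cong_AE(1)[OF U _ weak_deriv_unique[OF U w(2) v]]) simp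
    have bound: "(LINT x|lebesgue_on U. (\<psi> n x - v x)\<^sup>2) \<le> (inverse (real (Suc n)))\<^sup>2" for n
    proof -
      let ?t = "\<lambda>\<alpha>. LINT x:U|lebesgue. (weak_deriv U \<alpha> (\<lambda>x. u x - \<phi> n x) x)\<^sup>2"
      have wd: "has_weak_deriv U \<alpha> (\<lambda>x. u x - \<phi> n x) (\<lambda>x. v x - \<psi> n x)"
        unfolding \<psi>_def \<alpha>_def by (intro has_weak_deriv_diff has_weak_deriv_test \<phi> v[unfolded \<alpha>_def])
      have "(LINT x|lebesgue_on U. (\<psi> n x - v x)\<^sup>2) = ?t \<alpha>"
        using L2_cong_AE(2)[OF U L2_diff[OF L2_v L2_test[OF U \<psi>]] weak_deriv_AE_eq[OF U wd]]
        by (simp add: set_lebesgue_integral_restrict[OF Us] power2_commute)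
      also have "\<dots> \<le> (\<Sum>\<alpha> | length \<alpha> \<le> 2. ?t \<alpha>)"
      proof (rule member_le_sum)
        show "\<alpha> \<in> {\<alpha>. length \<alpha> \<le> 2}" using m by (simp add: \<alpha>_def)
        show "finite {\<alpha> :: 'n list. length \<alpha> \<le> 2}" using finite_lists_length_le[of "UNIV :: 'n set" 2] by simp
        show "0 \<le> ?t \<beta>" for \<beta> by (simp add: set_lebesgue_integral_def)
      qed
      also have "\<dots> = (sobolev_norm 2 U (\<lambda>x. u x - \<phi> n x))\<^sup>2"
        unfolding sobolev_norm_def by (subst real_sqrt_pow2) (auto intro!: sum_nonneg simp: set_lebesgue_integral_def)
      also have "\<dots> \<le> (inverse (real (Suc n)))\<^sup>2"
      proof (rule power_mono)
        show "sobolev_norm 2 U (\<lambda>x. u x - \<phi> n x) \<le> inverse (real (Suc n))" using norm[of n] by simp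
        show "0 \<le> sobolev_norm 2 U (\<lambda>x. u x - \<phi> n x)"
          unfolding sobolev_norm_def by (auto intro!: sum_nonneg simp: set_lebesgue_integral_def)
      qed
      finally show ?thesis .
    qed
    have "(\<lambda>n. LINT x|lebesgue_on U. (\<psi> n x - v x)\<^sup>2) \<longlonglongrightarrow> 0"
    proof (rule tendsto_sandwich[where f = "\<lambda>_. 0"])
      show "(\<lambda>n. (inverse (real (Suc n)))\<^sup>2) \<longlonglongrightarrow> 0"
        using tendsto_power[OF LIMSEQ_inverse_real_of_nat, of 2] by simp
    qed (use bound in auto)
    then show ?thesis unfolding \<alpha>_def[symmetric] \<psi>_def[symmetric]
      using L2_v L2_test[OF U \<psi>] by (simp add: L2_lim_def)
  qed
  with \<phi> show thesis by (rule that)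
qed

section \<open>The inequalities on the annulus\<close>

lemma sobolev0_has_weak_deriv:
  assumes "u \<in> sobolev0 2 U" "length \<alpha> \<le> 2"
  shows "has_weak_deriv U \<alpha> u (weak_deriv U \<alpha> u)"
proof -
  obtain v where "has_weak_deriv U \<alpha> u v" using assms unfolding sobolev0_def sobolev_def by blast
  from someI[of "has_weak_deriv U \<alpha> u", OF this] show ?thesis unfolding weak_deriv_def .
qed

text \<open>On the annulus the weights are bounded, \<open>\<bar>x\<bar> \<ge> a\<close>, so that all integrals are continuous along the
approximating sequence.\<close>

lemma sobolev0_inequality:
  fixes u :: "real ^ 'n::finite \<Rightarrow> real"
  assumes a: "0 < a" and u: "u \<in> sobolev0 2 (annulus a b)"
  shows "(\<And>\<phi> :: real ^ 'n \<Rightarrow> real. \<phi> \<in> test_functions (annulus a b) \<Longrightarrow>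
      C * (LINT x|lborel. (\<phi> x)\<^sup>2 / norm x ^ 4)
        \<le> (LINT x|lborel. (\<Sum>i\<in>UNIV. partial_deriv i (partial_deriv i \<phi>) x)\<^sup>2)) \<Longrightarrow>
    C * (LINT x:annulus a b|lebesgue. (u x)\<^sup>2 / norm x ^ 4)
      \<le> (LINT x:annulus a b|lebesgue. (weak_laplacian (annulus a b) u x)\<^sup>2)" (is "PROP ?zero")
    and "(\<And>\<phi> :: real ^ 'n \<Rightarrow> real. \<phi> \<in> test_functions (annulus a b) \<Longrightarrow>
      C * (\<Sum>i\<in>UNIV. LINT x|lborel. (partial_deriv i \<phi> x)\<^sup>2 / (norm x)\<^sup>2)
        \<le> (LINT x|lborel. (\<Sum>i\<in>UNIV. partial_deriv i (partial_deriv i \<phi>) x)\<^sup>2)) \<Longrightarrow>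
    C * (LINT x:annulus a b|lebesgue. (norm (weak_gradient (annulus a b) u x))\<^sup>2 / (norm x)\<^sup>2)
      \<le> (LINT x:annulus a b|lebesgue. (weak_laplacian (annulus a b) u x)\<^sup>2)" (is "PROP ?grad")
proof -
  define U :: "(real ^ 'n) set" where "U = annulus a b"
  define M where "M = lebesgue_on U"
  have U: "open U" and Us: "U \<in> sets lebesgue" by (simp_all add: U_def open_annulus)
  have u: "u \<in> sobolev0 2 U" using u by (simp add: U_def)
  obtain \<phi> where \<phi>: "\<And>n. \<phi> n \<in> test_functions U"
    and lim: "\<And>m i v. m \<le> 2 \<Longrightarrow> has_weak_deriv U (replicate m i) u v \<Longrightarrow>
      L2_lim M (\<lambda>n. iterated_deriv (replicate m i) (\<phi> n)) v"
    unfolding M_def using sobolev0_approximation[OF U u] by blast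
  have lim0: "L2_lim M \<phi> u"
  proof -
    have "has_weak_deriv U [] u u"
      using sobolev0_has_weak_deriv[OF u, of "[]"] by (auto simp: has_weak_deriv_def iterated_deriv_def)
    then show ?thesis using lim[of 0] by (simp add: iterated_deriv_def)
  qed
  have lim1: "L2_lim M (\<lambda>n. partial_deriv i (\<phi> n)) (weak_deriv U [i] u)" for i
    using lim[of 1 i] sobolev0_has_weak_deriv[OF u, of "[i]"] by (simp add: iterated_deriv_def)
  have lim2: "L2_lim M (\<lambda>n. partial_deriv i (partial_deriv i (\<phi> n))) (weak_deriv U [i, i] u)" for i
    using lim[of 2 i] sobolev0_has_weak_deriv[OF u, of "[i, i]"] by (simp add: iterated_deriv_def numeral_2_eq_2)
  have inverse_norm: "(\<lambda>x. inverse (norm x ^ m)) \<in> borel_measurable M"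
    "\<And>x. x \<in> space M \<Longrightarrow> \<bar>inverse (norm x ^ m)\<bar> \<le> inverse (a ^ m)" for m
  proof -
    have "(\<lambda>x::real ^ 'n. inverse (norm x ^ m)) \<in> borel_measurable lborel" by measurable
    then have "(\<lambda>x::real ^ 'n. inverse (norm x ^ m)) \<in> borel_measurable lebesgue" by (rule measurable_completion)
    then show "(\<lambda>x. inverse (norm x ^ m)) \<in> borel_measurable M" unfolding M_def by (rule measurable_restrict_space1)
    fix x assume "x \<in> space M"
    then have "a \<le> norm x" by (simp add: M_def space_restrict_space U_def annulus_iff)
    then show "\<bar>inverse (norm x ^ m)\<bar> \<le> inverse (a ^ m)" using a by (simp add: le_imp_inverse_le power_mono)
  qed
  have lborel: "(LINT x|M. g x) = (LINT x|lborel. g x)"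
    if "g \<in> borel_measurable borel" "\<And>x. x \<notin> U \<Longrightarrow> g x = 0" for g :: "real ^ 'n \<Rightarrow> real"
    using set_lebesgue_integral_supported[of g U, OF that] by (simp add: M_def set_lebesgue_integral_restrict[OF Us])
  have M: "(LINT x:U|lebesgue. g x) = (LINT x|M. g x)" for g :: "real ^ 'n \<Rightarrow> real"
    by (simp add: M_def set_lebesgue_integral_restrict[OF Us])
  have lap: "(\<lambda>n. LINT x|lborel. (\<Sum>i\<in>UNIV. partial_deriv i (partial_deriv i (\<phi> n)) x)\<^sup>2)
    \<longlonglongrightarrow> (LINT x:U|lebesgue. (weak_laplacian U u x)\<^sup>2)"
  proof -
    have "(\<lambda>n. LINT x|M. (\<Sum>i\<in>UNIV. partial_deriv i (partial_deriv i (\<phi> n)) x)\<^sup>2)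
      \<longlonglongrightarrow> (LINT x|M. (weak_laplacian U u x)\<^sup>2)"
      unfolding weak_laplacian_def by (intro L2_lim_norm L2_lim_sum lim2) simp
    moreover have "(LINT x|M. (\<Sum>i\<in>UNIV. partial_deriv i (partial_deriv i (\<phi> n)) x)\<^sup>2)
      = (LINT x|lborel. (\<Sum>i\<in>UNIV. partial_deriv i (partial_deriv i (\<phi> n)) x)\<^sup>2)" for n
    proof (rule lborel)
      have t: "(\<lambda>x. \<Sum>i\<in>UNIV. partial_deriv i (partial_deriv i (\<phi> n)) x) \<in> test_functions U"
        by (intro test_sum test_partial \<phi>)
      show "(\<lambda>x. (\<Sum>i\<in>UNIV. partial_deriv i (partial_deriv i (\<phi> n)) x)\<^sup>2) \<in> borel_measurable borel"
        using test_borel_measurable(1)[OF t] by simp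
      show "(\<Sum>i\<in>UNIV. partial_deriv i (partial_deriv i (\<phi> n)) x)\<^sup>2 = 0" if "x \<notin> U" for x
        using test_outside[OF t that] by simp
    qed
    ultimately show ?thesis by (simp add: M)
  qed
  have weighted: "(\<lambda>n. LINT x|lborel. (f n x)\<^sup>2 / norm x ^ (2 * m)) \<longlonglongrightarrow> (LINT x|M. (v x)\<^sup>2 / norm x ^ (2 * m))"
    and weighted_int: "integrable M (\<lambda>x. (v x)\<^sup>2 / norm x ^ (2 * m))"
    if l: "L2_lim M f v" and f: "\<And>n. f n \<in> test_functions U" for f v m
  proof -
    have sq: "(inverse (norm x ^ m) * y)\<^sup>2 = y\<^sup>2 / norm x ^ (2 * m)" for x :: "real ^ 'n" and y
      by (simp add: power_mult_distrib power_inverse divide_inverse power_mult mult.commute flip: power_mult)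
    have lw: "L2_lim M (\<lambda>n x. inverse (norm x ^ m) * f n x) (\<lambda>x. inverse (norm x ^ m) * v x)"
      by (rule L2_lim_mult_bounded[OF l]) (rule inverse_norm, rule inverse_norm(2))
    show "integrable M (\<lambda>x. (v x)\<^sup>2 / norm x ^ (2 * m))"
      using lw unfolding L2_lim_def L2_def sq by blast
    have "(\<lambda>n. LINT x|M. (f n x)\<^sup>2 / norm x ^ (2 * m)) \<longlonglongrightarrow> (LINT x|M. (v x)\<^sup>2 / norm x ^ (2 * m))"
      using L2_lim_norm[OF lw] unfolding sq .
    moreover have "(LINT x|M. (f n x)\<^sup>2 / norm x ^ (2 * m)) = (LINT x|lborel. (f n x)\<^sup>2 / norm x ^ (2 * m))" for n
      using test_borel_measurable(1)[OF f[of n]] test_outside[OF f[of n]]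
      by (intro lborel) auto
    ultimately show "(\<lambda>n. LINT x|lborel. (f n x)\<^sup>2 / norm x ^ (2 * m)) \<longlonglongrightarrow> (LINT x|M. (v x)\<^sup>2 / norm x ^ (2 * m))"
      by simp
  qed
  show "PROP ?zero"
  proof -
    assume ineq: "\<And>\<phi> :: real ^ 'n \<Rightarrow> real. \<phi> \<in> test_functions (annulus a b) \<Longrightarrow>
      C * (LINT x|lborel. (\<phi> x)\<^sup>2 / norm x ^ 4)
        \<le> (LINT x|lborel. (\<Sum>i\<in>UNIV. partial_deriv i (partial_deriv i \<phi>) x)\<^sup>2)"
    have "(\<lambda>n. C * (LINT x|lborel. (\<phi> n x)\<^sup>2 / norm x ^ 4)) \<longlonglongrightarrow> C * (LINT x:U|lebesgue. (u x)\<^sup>2 / norm x ^ 4)"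
      using weighted[OF lim0 \<phi>, of 2] by (intro tendsto_mult tendsto_const) (simp add: M)
    from LIMSEQ_le[OF this lap] ineq[OF \<phi>[unfolded U_def]]
    show "C * (LINT x:annulus a b|lebesgue. (u x)\<^sup>2 / norm x ^ 4)
      \<le> (LINT x:annulus a b|lebesgue. (weak_laplacian (annulus a b) u x)\<^sup>2)"
      unfolding U_def by blast
  qed
  show "PROP ?grad"
  proof -
    assume ineq: "\<And>\<phi> :: real ^ 'n \<Rightarrow> real. \<phi> \<in> test_functions (annulus a b) \<Longrightarrow>
      C * (\<Sum>i\<in>UNIV. LINT x|lborel. (partial_deriv i \<phi> x)\<^sup>2 / (norm x)\<^sup>2)
        \<le> (LINT x|lborel. (\<Sum>i\<in>UNIV. partial_deriv i (partial_deriv i \<phi>) x)\<^sup>2)"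
    have "(LINT x:U|lebesgue. (norm (weak_gradient U u x))\<^sup>2 / (norm x)\<^sup>2)
      = (\<Sum>i\<in>UNIV. LINT x|M. (weak_deriv U [i] u x)\<^sup>2 / (norm x)\<^sup>2)"
    proof -
      have "(norm (weak_gradient U u x))\<^sup>2 / (norm x)\<^sup>2 = (\<Sum>i\<in>UNIV. (weak_deriv U [i] u x)\<^sup>2 / (norm x)\<^sup>2)" for x
      proof -
        have "(norm (weak_gradient U u x))\<^sup>2 = (\<Sum>i\<in>UNIV. (weak_deriv U [i] u x)\<^sup>2)"
          unfolding power2_norm_eq_inner by (simp add: inner_vec_def weak_gradient_def power2_eq_square)
        then show ?thesis by (simp add: sum_divide_distrib)
      qed
      then show ?thesis
        using weighted_int[OF lim1 test_partial[OF \<phi>], where m = 1] by (simp add: M Bochner_Integration.integral_sum)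
    qed
    moreover have "(\<lambda>n. C * (\<Sum>i\<in>UNIV. LINT x|lborel. (partial_deriv i (\<phi> n) x)\<^sup>2 / (norm x)\<^sup>2))
      \<longlonglongrightarrow> C * (\<Sum>i\<in>UNIV. LINT x|M. (weak_deriv U [i] u x)\<^sup>2 / (norm x)\<^sup>2)"
      using weighted[OF lim1 test_partial[OF \<phi>], where m = 1] by (intro tendsto_mult tendsto_const tendsto_sum) simp
    from LIMSEQ_le[OF this lap] ineq[OF \<phi>[unfolded U_def]]
    have "C * (\<Sum>i\<in>UNIV. LINT x|M. (weak_deriv U [i] u x)\<^sup>2 / (norm x)\<^sup>2) \<le> (LINT x:U|lebesgue. (weak_laplacian U u x)\<^sup>2)"
      unfolding U_def by blast
    ultimately show "C * (LINT x:annulus a b|lebesgue. (norm (weak_gradient (annulus a b) u x))\<^sup>2 / (norm x)\<^sup>2)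
      \<le> (LINT x:annulus a b|lebesgue. (weak_laplacian (annulus a b) u x)\<^sup>2)"
      unfolding U_def by simp
  qed
qed

text \<open>The three integrals of the theorem in terms of the weighted inner product: \<open>r\<^sup>-\<^sup>4\<close> absorbs the factors \<open>r\<close>
of \<open>r \<partial>\<^sub>i\<close> and \<open>r\<^sup>2 \<Delta>\<close>.\<close>

lemma test_function_polar:
  fixes \<phi> :: "real ^ 'n::finite \<Rightarrow> real"
  assumes "0 < a" and \<phi>: "\<phi> \<in> test_functions (annulus a b)"
  obtains f :: "'n punctured" where "Rep_punctured f = \<phi>"
    and "(LINT x|lborel. (\<phi> x)\<^sup>2 / norm x ^ 4) = weighted_inner f f"
    and "(\<Sum>i\<in>UNIV. LINT x|lborel. (partial_deriv i \<phi> x)\<^sup>2 / (norm x)\<^sup>2)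
      = (\<Sum>i\<in>UNIV. weighted_inner (radial_partial i f) (radial_partial i f))"
    and "(LINT x|lborel. (\<Sum>i\<in>UNIV. partial_deriv i (partial_deriv i \<phi>) x)\<^sup>2)
      = weighted_inner (polar.lap f) (polar.lap f)"
proof -
  have t: "\<phi> \<in> test_functions (- {0})"
    by (rule test_functions_mono[OF \<phi>]) (use \<open>0 < a\<close> in \<open>auto simp: annulus_iff\<close>)
  define f where "f = Abs_punctured \<phi>"
  have f: "Rep_punctured f = \<phi>" using t by (simp add: f_def Abs_punctured_inverse)
  have 1: "(\<phi> x)\<^sup>2 / norm x ^ 4 = \<phi> x * \<phi> x / norm x ^ 4" for x by (simp add: power2_eq_square)
  have 2: "(partial_deriv i \<phi> x)\<^sup>2 / (norm x)\<^sup>2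
      = norm x * partial_deriv i \<phi> x * (norm x * partial_deriv i \<phi> x) / norm x ^ 4" for i x
    by (cases "x = 0") (simp_all add: field_simps power_numeral_reduce)
  have 3: "(\<Sum>i\<in>UNIV. partial_deriv i (partial_deriv i \<phi>) x)\<^sup>2
      = Rep_punctured (polar.lap f) x * Rep_punctured (polar.lap f) x / norm x ^ 4" for x
    using test_at_zero[OF test_sum[of UNIV "\<lambda>i. partial_deriv i (partial_deriv i \<phi>)", OF test_partial[OF test_partial[OF t]]]]
    by (cases "x = 0") (simp_all add: polar_lap f field_simps power_numeral_reduce)
  show thesis
    by (rule that[OF f]; simp only: weighted_inner.rep_eq radial_partial.rep_eq f 1 2 3)
qed

theorem theoremC:
  fixes d :: nat
  assumes "d = CARD('n::finite)" and "d \<ge> 3"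
  shows "\<exists>R::real. \<forall>a b. 0 < a \<and> a < b \<and> ln (b / a) \<ge> R \<longrightarrow>
    (\<forall>u \<in> sobolev0 2 (annulus a b :: (real ^ 'n) set).
      (LINT x:annulus a b|lebesgue. (weak_laplacian (annulus a b) u x)\<^sup>2)
        \<ge> ((real d)\<^sup>2 / 4 + pi\<^sup>2 / (ln (b / a))\<^sup>2) *
          ((real d - 4)\<^sup>2 / 4 + pi\<^sup>2 / (ln (b / a))\<^sup>2) *
          (LINT x:annulus a b|lebesgue. (u x)\<^sup>2 / norm x ^ 4) \<and>
      (d \<ge> 5 \<longrightarrow>
        (LINT x:annulus a b|lebesgue. (weak_laplacian (annulus a b) u x)\<^sup>2)
          \<ge> ((real d)\<^sup>2 * (real d - 4)\<^sup>2
               + ((real d - 2)\<^sup>2 + 4) * (8 * pi\<^sup>2 / (ln (b / a))\<^sup>2)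
               + 16 * pi ^ 4 / (ln (b / a)) ^ 4) /
             (4 * (real d - 4)\<^sup>2 + 16 * pi\<^sup>2 / (ln (b / a))\<^sup>2) *
            (LINT x:annulus a b|lebesgue. (norm (weak_gradient (annulus a b) u x))\<^sup>2 / (norm x)\<^sup>2)) \<and>
      (d = 3 \<longrightarrow>
        (LINT x:annulus a b|lebesgue. (weak_laplacian (annulus a b) u x)\<^sup>2)
          \<ge> (25 + 104 * pi\<^sup>2 / (ln (b / a))\<^sup>2 + 16 * pi ^ 4 / (ln (b / a)) ^ 4) /
             (36 + 16 * pi\<^sup>2 / (ln (b / a))\<^sup>2) *
            (LINT x:annulus a b|lebesgue. (norm (weak_gradient (annulus a b) u x))\<^sup>2 / (norm x)\<^sup>2)) \<and>
      (d = 4 \<longrightarrow>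
        (LINT x:annulus a b|lebesgue. (weak_laplacian (annulus a b) u x)\<^sup>2)
          \<ge> (9 + 10 * pi\<^sup>2 / (ln (b / a))\<^sup>2 + pi ^ 4 / (ln (b / a)) ^ 4) /
             (3 + pi\<^sup>2 / (ln (b / a))\<^sup>2) *
            (LINT x:annulus a b|lebesgue. (norm (weak_gradient (annulus a b) u x))\<^sup>2 / (norm x)\<^sup>2)))"
\<comment> \<open>\<open>R = \<pi>\<close> gives \<open>s \<le> 1\<close>, which suffices for the cases \<open>d = 3\<close> and \<open>d = 4\<close>\<close>
proof (intro exI[of _ pi] allI impI ballI)
  fix a b :: real and u :: "real ^ 'n \<Rightarrow> real"
  assume ab: "0 < a \<and> a < b \<and> ln (b / a) \<ge> pi" and u: "u \<in> sobolev0 2 (annulus a b)"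
  define s where "s = pi\<^sup>2 / (ln (b / a))\<^sup>2"
  have a: "0 < a" and b: "a < b" and ln: "pi \<le> ln (b / a)" using ab by auto
  have ln0: "0 < ln (b / a)" using ln pi_gt_zero by linarith
  have s: "0 < s" "s \<le> 1"
    using power_mono[OF ln, of 2] ln0 by (simp_all add: s_def)
  have N: "real d = real CARD('n)" and N3: "real d = 3 \<or> real d \<ge> 4" using assms by auto
  have zero: "((real d)\<^sup>2 / 4 + s) * ((real d - 4)\<^sup>2 / 4 + s) * (LINT x:annulus a b|lebesgue. (u x)\<^sup>2 / norm x ^ 4)
      \<le> (LINT x:annulus a b|lebesgue. (weak_laplacian (annulus a b) u x)\<^sup>2)"
  proof (rule sobolev0_inequality(1)[OF a u])
    fix \<phi> :: "real ^ 'n \<Rightarrow> real" assume \<phi>: "\<phi> \<in> test_functions (annulus a b)"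
    obtain f :: "'n punctured" where f: "Rep_punctured f = \<phi>"
      and f_eq: "(LINT x|lborel. (\<phi> x)\<^sup>2 / norm x ^ 4) = weighted_inner f f"
      "(\<Sum>i\<in>UNIV. LINT x|lborel. (partial_deriv i \<phi> x)\<^sup>2 / (norm x)\<^sup>2)
        = (\<Sum>i\<in>UNIV. weighted_inner (radial_partial i f) (radial_partial i f))"
      "(LINT x|lborel. (\<Sum>i\<in>UNIV. partial_deriv i (partial_deriv i \<phi>) x)\<^sup>2)
        = weighted_inner (polar.lap f) (polar.lap f)"
      by (rule test_function_polar[OF a \<phi>])
    have "polar.radial_gap s f" unfolding s_def by (rule radial_gap_annulus[OF a b]) (simp add: f \<phi>)
    from polar.Rellich_inequality[OF this] s N3
    show "((real d)\<^sup>2 / 4 + s) * ((real d - 4)\<^sup>2 / 4 + s) * (LINT x|lborel. (\<phi> x)\<^sup>2 / norm x ^ 4)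
        \<le> (LINT x|lborel. (\<Sum>i\<in>UNIV. partial_deriv i (partial_deriv i \<phi>) x)\<^sup>2)"
      unfolding f_eq N by simp
  qed
  have grad: "C * (LINT x:annulus a b|lebesgue. (norm (weak_gradient (annulus a b) u x))\<^sup>2 / (norm x)\<^sup>2)
      \<le> (LINT x:annulus a b|lebesgue. (weak_laplacian (annulus a b) u x)\<^sup>2)"
    if ineq: "\<And>f :: 'n punctured. polar.radial_gap s f \<Longrightarrow>
      C * (\<Sum>i\<in>UNIV. weighted_inner (radial_partial i f) (radial_partial i f))
        \<le> weighted_inner (polar.lap f) (polar.lap f)" for C
  proof (rule sobolev0_inequality(2)[OF a u])
    fix \<phi> :: "real ^ 'n \<Rightarrow> real" assume \<phi>: "\<phi> \<in> test_functions (annulus a b)"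
    obtain f :: "'n punctured" where f: "Rep_punctured f = \<phi>"
      and f_eq: "(LINT x|lborel. (\<phi> x)\<^sup>2 / norm x ^ 4) = weighted_inner f f"
      "(\<Sum>i\<in>UNIV. LINT x|lborel. (partial_deriv i \<phi> x)\<^sup>2 / (norm x)\<^sup>2)
        = (\<Sum>i\<in>UNIV. weighted_inner (radial_partial i f) (radial_partial i f))"
      "(LINT x|lborel. (\<Sum>i\<in>UNIV. partial_deriv i (partial_deriv i \<phi>) x)\<^sup>2)
        = weighted_inner (polar.lap f) (polar.lap f)"
      by (rule test_function_polar[OF a \<phi>])
    have "polar.radial_gap s f" unfolding s_def by (rule radial_gap_annulus[OF a b]) (simp add: f \<phi>)
    from ineq[OF this]
    show "C * (\<Sum>i\<in>UNIV. LINT x|lborel. (partial_deriv i \<phi> x)\<^sup>2 / (norm x)\<^sup>2)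
        \<le> (LINT x|lborel. (\<Sum>i\<in>UNIV. partial_deriv i (partial_deriv i \<phi>) x)\<^sup>2)"
      unfolding f_eq .
  qed
  have s_eqs: "k * pi\<^sup>2 / (ln (b / a))\<^sup>2 = k * s" "k * pi ^ 4 / (ln (b / a)) ^ 4 = k * s\<^sup>2"
    "pi ^ 4 / (ln (b / a)) ^ 4 = s\<^sup>2" for k
    by (simp_all add: s_def power_divide flip: power_mult)
  have high: "((real d)\<^sup>2 * (real d - 4)\<^sup>2 + ((real d - 2)\<^sup>2 + 4) * (8 * s) + 16 * s\<^sup>2) / (4 * (real d - 4)\<^sup>2 + 16 * s)
      * (LINT x:annulus a b|lebesgue. (norm (weak_gradient (annulus a b) u x))\<^sup>2 / (norm x)\<^sup>2)
      \<le> (LINT x:annulus a b|lebesgue. (weak_laplacian (annulus a b) u x)\<^sup>2)" if d5: "d \<ge> 5"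
  proof -
    have "4 * (real d - 4)\<^sup>2 + 16 * s > 0" using s(1) by (simp add: add_nonneg_pos)
    then have eq: "((real d)\<^sup>2 * (real d - 4)\<^sup>2 + ((real d - 2)\<^sup>2 + 4) * (8 * s) + 16 * s\<^sup>2) / (4 * (real d - 4)\<^sup>2 + 16 * s)
      = (real d)\<^sup>2 / 4 + s"
      by (subst divide_eq_eq) (simp add: power2_eq_square algebra_simps)
    show ?thesis unfolding eq
    proof (rule grad)
      fix f :: "'n punctured" assume gap: "polar.radial_gap s f"
      have "real CARD('n) \<ge> 5" using d5 assms(1) by simp
      from polar.gradient_inequality_high[OF gap less_imp_le[OF s(1)] this]
      show "((real d)\<^sup>2 / 4 + s) * (\<Sum>i\<in>UNIV. weighted_inner (radial_partial i f) (radial_partial i f))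
        \<le> weighted_inner (polar.lap f) (polar.lap f)" unfolding N .
    qed
  qed
  have low3: "(25 + 104 * s + 16 * s\<^sup>2) / (36 + 16 * s)
      * (LINT x:annulus a b|lebesgue. (norm (weak_gradient (annulus a b) u x))\<^sup>2 / (norm x)\<^sup>2)
      \<le> (LINT x:annulus a b|lebesgue. (weak_laplacian (annulus a b) u x)\<^sup>2)" if d3: "d = 3"
  proof (rule grad)
    fix f :: "'n punctured" assume gap: "polar.radial_gap s f"
    \<comment> \<open>\<open>C\<close> solves \<open>p(2) = 0\<close> for the polynomial of \<open>gradient_inequality_low\<close>\<close>
    define C where "C = (25 + 104 * s + 16 * s\<^sup>2) / (36 + 16 * s)"
    have N: "real CARD('n) = 3" using assms d3 by simp
    have C: "C * (36 + 16 * s) = 25 + 104 * s + 16 * s\<^sup>2" using s by (simp add: C_def)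
    have pos: "36 + 16 * s > 0" using s by simp
    have A': "(s + 5 / 2 - C) * (36 + 16 * s) = 65 - 28 * s"
      using C by (simp add: algebra_simps power2_eq_square)
    then have A: "s + 5 / 2 - C = (65 - 28 * s) / (36 + 16 * s)"
      using pos by (simp add: eq_divide_eq)
    have A0: "0 \<le> s + 5 / 2 - C" unfolding A using s by (intro divide_nonneg_pos) auto
    have "(s * (s + 5 / 2 - C) + 9 / 16 - C / 4) * (36 + 16 * s)
      = s * ((s + 5 / 2 - C) * (36 + 16 * s)) + 9 / 16 * (36 + 16 * s) - C * (36 + 16 * s) / 4"
      by (simp add: algebra_simps)
    also have "\<dots> = 14 + 48 * s - 32 * s\<^sup>2"
      unfolding A' C by (simp add: field_simps power2_eq_square)
    finally have F: "s * (s + 5 / 2 - C) + 9 / 16 - C / 4 = (14 + 48 * s - 32 * s\<^sup>2) / (36 + 16 * s)"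
      using pos by (simp add: eq_divide_eq)
    have "s\<^sup>2 \<le> s" using s by (simp add: power2_eq_square mult_left_le)
    moreover have "0 \<le> 14 + 48 * s - 32 * t" "14 + 48 * s - 32 * t \<le> 4 * (36 + 16 * s)" if "0 \<le> t" "t \<le> s" for t
      using s that by (simp_all add: algebra_simps)
    ultimately have q: "0 \<le> 14 + 48 * s - 32 * s\<^sup>2" "14 + 48 * s - 32 * s\<^sup>2 \<le> 4 * (36 + 16 * s)"
      using zero_le_power2[of s] by blast+
    have Fb: "0 \<le> s * (s + 5 / 2 - C) + 9 / 16 - C / 4" "s * (s + 5 / 2 - C) + 9 / 16 - C / 4 \<le> 4"
      unfolding F pos_divide_le_eq[OF pos] by (rule divide_nonneg_pos[OF q(1) pos], rule q(2))
    have "C * (\<Sum>i\<in>UNIV. weighted_inner (radial_partial i f) (radial_partial i f)) \<le> weighted_inner (polar.lap f) (polar.lap f)"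
    proof (rule polar.gradient_inequality_low[OF gap _ _ refl, unfolded N])
      show "0 \<le> s + 2 * (3 * (3 - 4) / 4) + 4 - C" using A0 by simp
    qed (use Fb C in \<open>simp_all add: power2_eq_square algebra_simps\<close>)
    then show "(25 + 104 * s + 16 * s\<^sup>2) / (36 + 16 * s) * (\<Sum>i\<in>UNIV. weighted_inner (radial_partial i f) (radial_partial i f))
      \<le> weighted_inner (polar.lap f) (polar.lap f)" by (simp add: C_def)
  qed
  have low4: "(9 + 10 * s + s\<^sup>2) / (3 + s)
      * (LINT x:annulus a b|lebesgue. (norm (weak_gradient (annulus a b) u x))\<^sup>2 / (norm x)\<^sup>2)
      \<le> (LINT x:annulus a b|lebesgue. (weak_laplacian (annulus a b) u x)\<^sup>2)" if d4: "d = 4"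
  proof (rule grad)
    fix f :: "'n punctured" assume gap: "polar.radial_gap s f"
    \<comment> \<open>\<open>C\<close> solves \<open>p(3) = 0\<close> for the polynomial of \<open>gradient_inequality_low\<close>\<close>
    define C where "C = (9 + 10 * s + s\<^sup>2) / (3 + s)"
    have N: "real CARD('n) = 4" using assms d4 by simp
    have C: "C * (3 + s) = 9 + 10 * s + s\<^sup>2" using s by (simp add: C_def)
    have pos: "3 + s > 0" using s by simp
    have "(s + 4 - C) * (3 + s) = 3 - 3 * s"
      using C by (simp add: algebra_simps power2_eq_square)
    then have A: "s + 4 - C = (3 - 3 * s) / (3 + s)"
      using pos by (simp add: eq_divide_eq)
    have A0: "0 \<le> s + 4 - C" "s + 4 - C \<le> 1" unfolding A using s by (simp_all add: divide_le_eq)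
    have Fb: "0 \<le> s * (s + 4 - C)" "s * (s + 4 - C) \<le> 9"
      using A0 s mult_mono[of s 1 "s + 4 - C" 1] by simp_all
    have "C * (\<Sum>i\<in>UNIV. weighted_inner (radial_partial i f) (radial_partial i f)) \<le> weighted_inner (polar.lap f) (polar.lap f)"
      by (rule polar.gradient_inequality_low[OF gap _ _ refl, unfolded N])
        (use A0 Fb C in \<open>simp_all add: power2_eq_square algebra_simps\<close>)
    then show "(9 + 10 * s + s\<^sup>2) / (3 + s) * (\<Sum>i\<in>UNIV. weighted_inner (radial_partial i f) (radial_partial i f))
      \<le> weighted_inner (polar.lap f) (polar.lap f)" by (simp add: C_def)
  qed
  show "(LINT x:annulus a b|lebesgue. (weak_laplacian (annulus a b) u x)\<^sup>2)
        \<ge> ((real d)\<^sup>2 / 4 + pi\<^sup>2 / (ln (b / a))\<^sup>2) *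
          ((real d - 4)\<^sup>2 / 4 + pi\<^sup>2 / (ln (b / a))\<^sup>2) *
          (LINT x:annulus a b|lebesgue. (u x)\<^sup>2 / norm x ^ 4) \<and>
      (d \<ge> 5 \<longrightarrow>
        (LINT x:annulus a b|lebesgue. (weak_laplacian (annulus a b) u x)\<^sup>2)
          \<ge> ((real d)\<^sup>2 * (real d - 4)\<^sup>2
               + ((real d - 2)\<^sup>2 + 4) * (8 * pi\<^sup>2 / (ln (b / a))\<^sup>2)
               + 16 * pi ^ 4 / (ln (b / a)) ^ 4) /
             (4 * (real d - 4)\<^sup>2 + 16 * pi\<^sup>2 / (ln (b / a))\<^sup>2) *
            (LINT x:annulus a b|lebesgue. (norm (weak_gradient (annulus a b) u x))\<^sup>2 / (norm x)\<^sup>2)) \<and>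
      (d = 3 \<longrightarrow>
        (LINT x:annulus a b|lebesgue. (weak_laplacian (annulus a b) u x)\<^sup>2)
          \<ge> (25 + 104 * pi\<^sup>2 / (ln (b / a))\<^sup>2 + 16 * pi ^ 4 / (ln (b / a)) ^ 4) /
             (36 + 16 * pi\<^sup>2 / (ln (b / a))\<^sup>2) *
            (LINT x:annulus a b|lebesgue. (norm (weak_gradient (annulus a b) u x))\<^sup>2 / (norm x)\<^sup>2)) \<and>
      (d = 4 \<longrightarrow>
        (LINT x:annulus a b|lebesgue. (weak_laplacian (annulus a b) u x)\<^sup>2)
          \<ge> (9 + 10 * pi\<^sup>2 / (ln (b / a))\<^sup>2 + pi ^ 4 / (ln (b / a)) ^ 4) /
             (3 + pi\<^sup>2 / (ln (b / a))\<^sup>2) *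
            (LINT x:annulus a b|lebesgue. (norm (weak_gradient (annulus a b) u x))\<^sup>2 / (norm x)\<^sup>2))"
    unfolding s_eqs s_def[symmetric] using zero high low3 low4 by blast
qed

end
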